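(* Let $T$ be a complete first order theory which is independent, and let $\lambda,\theta,\kappa$ be infinite cardinals with $|T|\le\lambda=\lambda^\theta=2^\kappa>\theta=\mathrm{cf}(\theta)$. For $\alpha<\lambda^+$ let $K_\alpha$ be the set of models of $T$ with universe $\lambda\times(1+\alpha)$ (ordinal product). Then: (1) $T$ has no $(\lambda,\theta)$-md-limit model. (2) Moreover, there is $\mathbf F$ such that (a) $\mathbf F$ is a function with domain $\bigcup\{K_\alpha:\alpha<\lambda^+\text{ odd}\}$; (b) if $\alpha<\lambda^+$ is odd and $M\in K_\alpha$ then $M\prec\mathbf F(M)\in K_{\alpha+1}$; (c) if $M_\alpha\in K_\alpha$ for $\alpha<\lambda^+$, the sequence $\langle M_\alpha:\alpha<\lambda^+\rangle$ is $\prec$-increasing continuous and $M_{2\alpha+2}=\mathbf F(M_{2\alpha+1})$ for every $\alpha<\lambda^+$, then for no $\alpha<\lambda^+$ is the set $\{\delta<\lambda^+:M_\delta\cong M_\alpha\text{ and }\mathrm{cf}(\delta)=\theta\}$ stationary in $\lambda^+$. (3) One can strengthen (2) by adding to the conclusion of clause (c) the following: there are $\bar c_\alpha\in{}^\kappa(M_{2\alpha+2})$ for $\alpha<\lambda^+$ such that if, for $\ell=1,2$, $\langle\alpha_{\ell,\varepsilon}:\varepsilon<\theta\rangle$ is an increasing continuous sequence of ordinals $<\lambda^+$ with limit $\alpha_\ell$, and $\alpha_1\ne\alpha_2$, then there is no isomorphism $f$ from $M_{\alpha_1}$ onto $M_{\alpha_2}$ mapping $\bar c_{\alpha_{1,\varepsilon}}$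 to $\bar c_{\alpha_{2,\varepsilon}}$ for every $\varepsilon<\theta$. (4) In (2) one can replace the classes $K_\alpha$ ($\alpha<\lambda^+$) by $K_{<\lambda^+}:=\bigcup\{K_\alpha:\alpha<\lambda^+\}$; that is, there is a function $\mathbf F$ with domain $K_{<\lambda^+}$ such that $M\prec\mathbf F(M)\in K_{<\lambda^+}$ for every $M\in K_{<\lambda^+}$, and if $\langle M_\alpha:\alpha<\lambda^+\rangle$ is a $\prec$-increasing continuous sequence of members of $K_{<\lambda^+}$ with $M_{2\alpha+2}=\mathbf F(M_{2\alpha+1})$ for every $\alpha<\lambda^+$, then for no $\alpha<\lambda^+$ is the set $\{\delta<\lambda^+:M_\delta\cong M_\alpha\text{ and }\mathrm{cf}(\delta)=\theta\}$ stationary in $\lambda^+$.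
   Context: A formula $\varphi(\bar x,\bar y)$ is independent (for $T$) when for every $n$ and $M\models T$ there are tuples $\bar a_\ell$ from $M$ of the length of $\bar y$ ($\ell<n$) such that for every $u\subseteq\{0,\dots,n-1\}$, $M\models(\exists\bar x)\big[\bigwedge_{\ell\in u}\varphi(\bar x,\bar a_\ell)\wedge\bigwedge_{\ell<n,\ \ell\notin u}\neg\varphi(\bar x,\bar a_\ell)\big]$. $T$ is independent iff some $\varphi(x,\bar y)$ ($x$ a single variable) is independent. $\mathrm{EC}_\lambda(T)$ is the class of models of $T$ of cardinality $\lambda$; $\prec$ is elementary submodel. $M\in\mathrm{EC}_\lambda(T)$ is a $(\lambda,\theta)$-md-limit (medium limit) model when there is a function $\mathbf F$ assigning to each $\prec$-increasing continuous sequence $\langle M_j:j\le i\rangle$ ($i<\lambda^+$) of members of $\mathrm{EC}_\lambda(T)$ a model $\mathbf F(\langle M_j:j\le i\rangle)\in\mathrm{EC}_\lambda(T)$ with $M_i\prec\mathbf F(\langle M_j:j\le i\rangle)$, such that: if $\delta<\lambda^+$ is a limit ordinal of cofinality $\theta$ and $\langle M_i:i<\delta\rangle$ is a $\prec$-increasing continuous sequence of members of $\mathrm{EC}_\lambda(T)$ with $M_{i+1}\prec\mathbf F(\langle M_j:j\le i+1\rangle)\prec M_{i+2}$ for every $i<\delta$, then $M\cong\bigcup\{M_i:i<\delta\}$. (To speak of such $\mathbf F$ one assumes global choice, or restricts to models whose universe is an ordinal in $[\lambda,\lambda^+)$.) *)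

theory Defs
  imports Main "HOL-Library.FuncSet"
begin

unbundle cardinal_syntax

section \<open>Ordinals\<close>

text \<open>
  Ordinals are the points of a well-ordered type, the point \<open>a\<close> standing for the set \<open>{..<a}\<close> of
  its predecessors. The definitions are meant for types whose order type is an uncountable
  successor cardinal: this makes every \<^const>\<open>Least\<close> below well defined.
\<close>

definition ozero :: "'o::wellorder" where
  "ozero = (LEAST a. True)"

definition osuc :: "'o::wellorder \<Rightarrow> 'o" where
  "osuc a = (LEAST b. a < b)"

definition olimit :: "'o::wellorder \<Rightarrow> bool" where
  "olimit d \<longleftrightarrow> (\<exists>a. a < d) \<and> (\<forall>a<d. \<exists>b<d. a < b)"

function oadd :: "'o::wellorder \<Rightarrow> 'o \<Rightarrow> 'o" where
  "oadd a b = (LEAST c. a \<le> c \<and> (\<forall>b'<b. oadd a b' < c))"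
  by pat_completeness auto
termination
  by (relation "inv_image {(x, y). x < y} snd") (rule wf_inv_image[OF wf], simp)

declare oadd.simps [simp del]

text \<open>\<open>omul a b\<close> is \<open>a\<close> repeated \<open>b\<close> times, so that \<open>omul 2 \<omega> = \<omega>\<close>.\<close>

function omul :: "'o::wellorder \<Rightarrow> 'o \<Rightarrow> 'o" where
  "omul a b = (LEAST c. \<forall>b'<b. oadd (omul a b') a \<le> c)"
  by pat_completeness auto
termination
  by (relation "inv_image {(x, y). x < y} snd") (rule wf_inv_image[OF wf], simp)

declare omul.simps [simp del]

definition odouble :: "'o::wellorder \<Rightarrow> 'o" where
  "odouble a = omul (osuc (osuc ozero)) a"

definition oodd :: "'o::wellorder \<Rightarrow> bool" where
  "oodd a \<longleftrightarrow> (\<exists>b. a = osuc (odouble b))"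

definition infinite_cardinal :: "'o::wellorder \<Rightarrow> bool" where
  "infinite_cardinal a \<longleftrightarrow> infinite {..<a} \<and> (\<forall>b<a. |{..<b}| <o |{..<a}| )"

definition cf :: "'o::wellorder \<Rightarrow> 'o" where
  "cf d = (LEAST m. \<exists>f. (\<forall>i<m. f i < d) \<and> (\<forall>b<d. \<exists>i<m. b \<le> f i))"

definition club :: "'o::wellorder set \<Rightarrow> bool" where
  "club C \<longleftrightarrow> (\<forall>a. \<exists>b\<in>C. a < b) \<and> (\<forall>d. olimit d \<and> (\<forall>a<d. \<exists>b\<in>C. a < b \<and> b < d) \<longrightarrow> d \<in> C)"

definition stationary :: "'o::wellorder set \<Rightarrow> bool" where
  "stationary S \<longleftrightarrow> (\<forall>C. club C \<longrightarrow> S \<inter> C \<noteq> {})"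

definition seq_limit :: "('o::wellorder \<Rightarrow> 'o) \<Rightarrow> 'o \<Rightarrow> 'o \<Rightarrow> bool" where
  "seq_limit e m a \<longleftrightarrow> (\<forall>i<m. e i < a) \<and> (\<forall>b<a. \<exists>i<m. b < e i)"

definition inc_cont_ords :: "'o::wellorder \<Rightarrow> ('o \<Rightarrow> 'o) \<Rightarrow> bool" where
  "inc_cont_ords m e \<longleftrightarrow>
     strict_mono_on {..<m} e \<and> (\<forall>i<m. olimit i \<longrightarrow> seq_limit e i (e i))"

section \<open>First-order logic\<close>

text \<open>A symbol of a vocabulary is a name together with its arity.\<close>

record ('f, 'p) vocab =
  funs :: "('f \<times> nat) set"
  rels :: "('p \<times> nat) set"

datatype 'f trm = Var nat | App 'f "'f trm list"

datatype ('f, 'p) fm =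
    Equal "'f trm" "'f trm"
  | Rel 'p "'f trm list"
  | Neg "('f, 'p) fm"
  | Conj "('f, 'p) fm" "('f, 'p) fm"
  | Exi nat "('f, 'p) fm"

fun trm_vars :: "'f trm \<Rightarrow> nat set" where
  "trm_vars (Var x) = {x}"
| "trm_vars (App f ts) = (\<Union>t\<in>set ts. trm_vars t)"

fun trm_over :: "('f, 'p) vocab \<Rightarrow> 'f trm \<Rightarrow> bool" where
  "trm_over V (Var x) \<longleftrightarrow> True"
| "trm_over V (App f ts) \<longleftrightarrow> (f, length ts) \<in> funs V \<and> (\<forall>t\<in>set ts. trm_over V t)"

fun free_vars :: "('f, 'p) fm \<Rightarrow> nat set" where
  "free_vars (Equal s t) = trm_vars s \<union> trm_vars t"
| "free_vars (Rel r ts) = (\<Union>t\<in>set ts. trm_vars t)"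
| "free_vars (Neg \<phi>) = free_vars \<phi>"
| "free_vars (Conj \<phi> \<psi>) = free_vars \<phi> \<union> free_vars \<psi>"
| "free_vars (Exi x \<phi>) = free_vars \<phi> - {x}"

fun fm_over :: "('f, 'p) vocab \<Rightarrow> ('f, 'p) fm \<Rightarrow> bool" where
  "fm_over V (Equal s t) \<longleftrightarrow> trm_over V s \<and> trm_over V t"
| "fm_over V (Rel r ts) \<longleftrightarrow> (r, length ts) \<in> rels V \<and> (\<forall>t\<in>set ts. trm_over V t)"
| "fm_over V (Neg \<phi>) \<longleftrightarrow> fm_over V \<phi>"
| "fm_over V (Conj \<phi> \<psi>) \<longleftrightarrow> fm_over V \<phi> \<and> fm_over V \<psi>"
| "fm_over V (Exi x \<phi>) \<longleftrightarrow> fm_over V \<phi>"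

definition sentences :: "('f, 'p) vocab \<Rightarrow> ('f, 'p) fm set" where
  "sentences V = {\<phi>. fm_over V \<phi> \<and> free_vars \<phi> = {}}"

record ('f, 'p, 'a) struct =
  universe :: "'a set"
  fint :: "'f \<times> nat \<Rightarrow> 'a list \<Rightarrow> 'a"
  rint :: "'p \<times> nat \<Rightarrow> 'a list set"

definition tuples :: "'a set \<Rightarrow> nat \<Rightarrow> 'a list set" where
  "tuples A n = {xs. length xs = n \<and> set xs \<subseteq> A}"

text \<open>
  The interpretations are fixed outside the vocabulary and outside the universe, so that
  equality of structures is equality in the usual sense.
\<close>

definition is_struct :: "('f, 'p) vocab \<Rightarrow> ('f, 'p, 'a) struct \<Rightarrow> bool" where
  "is_struct V M \<longleftrightarrow>
     universe M \<noteq> {} \<and>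
     (\<forall>f n. (f, n) \<in> funs V \<longrightarrow> fint M (f, n) \<in> tuples (universe M) n \<rightarrow>\<^sub>E universe M) \<and>
     (\<forall>r n. (r, n) \<in> rels V \<longrightarrow> rint M (r, n) \<subseteq> tuples (universe M) n) \<and>
     (\<forall>s. s \<notin> funs V \<longrightarrow> fint M s = (\<lambda>_. undefined)) \<and>
     (\<forall>s. s \<notin> rels V \<longrightarrow> rint M s = {})"

fun eval_trm :: "('f, 'p, 'a) struct \<Rightarrow> (nat \<Rightarrow> 'a) \<Rightarrow> 'f trm \<Rightarrow> 'a" where
  "eval_trm M v (Var x) = v x"
| "eval_trm M v (App f ts) = fint M (f, length ts) (map (eval_trm M v) ts)"

fun sat :: "('f, 'p, 'a) struct \<Rightarrow> (nat \<Rightarrow> 'a) \<Rightarrow> ('f, 'p) fm \<Rightarrow> bool" where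
  "sat M v (Equal s t) \<longleftrightarrow> eval_trm M v s = eval_trm M v t"
| "sat M v (Rel r ts) \<longleftrightarrow> map (eval_trm M v) ts \<in> rint M (r, length ts)"
| "sat M v (Neg \<phi>) \<longleftrightarrow> \<not> sat M v \<phi>"
| "sat M v (Conj \<phi> \<psi>) \<longleftrightarrow> sat M v \<phi> \<and> sat M v \<psi>"
| "sat M v (Exi x \<phi>) \<longleftrightarrow> (\<exists>a\<in>universe M. sat M (v(x := a)) \<phi>)"

definition Mod :: "('f, 'p) vocab \<Rightarrow> ('f, 'p) fm set \<Rightarrow> ('f, 'p, 'a) struct set" where
  "Mod V T = {M. is_struct V M \<and> (\<forall>\<phi>\<in>T. \<forall>v. range v \<subseteq> universe M \<longrightarrow> sat M v \<phi>)}"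

definition elem_sub ::
  "('f, 'p) vocab \<Rightarrow> ('f, 'p, 'a) struct \<Rightarrow> ('f, 'p, 'a) struct \<Rightarrow> bool" where
  "elem_sub V M N \<longleftrightarrow>
     universe M \<subseteq> universe N \<and>
     (\<forall>\<phi> v. fm_over V \<phi> \<and> range v \<subseteq> universe M \<longrightarrow> (sat M v \<phi> \<longleftrightarrow> sat N v \<phi>))"

definition is_isomorphism ::
  "('f, 'p) vocab \<Rightarrow> ('f, 'p, 'a) struct \<Rightarrow> ('f, 'p, 'b) struct \<Rightarrow> ('a \<Rightarrow> 'b) \<Rightarrow> bool" where
  "is_isomorphism V M N h \<longleftrightarrow>
     bij_betw h (universe M) (universe N) \<and>
     (\<forall>f n. (f, n) \<in> funs V \<longrightarrow>
        (\<forall>xs\<in>tuples (universe M) n. h (fint M (f, n) xs) = fint N (f, n) (map h xs))) \<and>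
     (\<forall>r n. (r, n) \<in> rels V \<longrightarrow>
        (\<forall>xs\<in>tuples (universe M) n. xs \<in> rint M (r, n) \<longleftrightarrow> map h xs \<in> rint N (r, n)))"

definition isomorphic ::
  "('f, 'p) vocab \<Rightarrow> ('f, 'p, 'a) struct \<Rightarrow> ('f, 'p, 'b) struct \<Rightarrow> bool" where
  "isomorphic V M N \<longleftrightarrow> (\<exists>h. is_isomorphism V M N h)"

text \<open>
  The next three notions speak about all models of a theory. HOL cannot quantify over all element
  types inside a formula, hence the type argument. By the Loewenheim-Skolem theorem the type is
  immaterial as soon as it has at least as many elements as there are formulas over the vocabulary.
\<close>

definition entails ::
  "'a itself \<Rightarrow> ('f, 'p) vocab \<Rightarrow> ('f, 'p) fm set \<Rightarrow> ('f, 'p) fm \<Rightarrow> bool" where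
  "entails TYPE('a) V T \<phi> \<longleftrightarrow> (Mod V T :: ('f, 'p, 'a) struct set) \<subseteq> Mod V {\<phi>}"

definition complete_theory :: "'a itself \<Rightarrow> ('f, 'p) vocab \<Rightarrow> ('f, 'p) fm set \<Rightarrow> bool" where
  "complete_theory TYPE('a) V T \<longleftrightarrow>
     T \<subseteq> sentences V \<and>
     (Mod V T :: ('f, 'p, 'a) struct set) \<noteq> {} \<and>
     (\<forall>\<phi>\<in>sentences V. entails TYPE('a) V T \<phi> \<or> entails TYPE('a) V T (Neg \<phi>))"

text \<open>
  \<open>assign xs as\<close> gives the variables \<open>xs\<close> the values \<open>as\<close>; it is used only for formulas without
  further free variables.
\<close>

definition assign :: "nat list \<Rightarrow> 'a list \<Rightarrow> nat \<Rightarrow> 'a" where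
  "assign xs as = (\<lambda>x. the (map_of (zip xs as) x))"

definition independent_fm ::
  "'a itself \<Rightarrow> ('f, 'p) vocab \<Rightarrow> ('f, 'p) fm set \<Rightarrow> nat list \<Rightarrow> nat list \<Rightarrow> ('f, 'p) fm \<Rightarrow> bool" where
  "independent_fm TYPE('a) V T xs ys \<phi> \<longleftrightarrow>
     (\<forall>n::nat. \<forall>M \<in> (Mod V T :: ('f, 'p, 'a) struct set).
        \<exists>a. (\<forall>l<n. a l \<in> tuples (universe M) (length ys)) \<and>
            (\<forall>u. u \<subseteq> {..<n} \<longrightarrow>
               (\<exists>b \<in> tuples (universe M) (length xs).
                  (\<forall>l\<in>u. sat M (assign (xs @ ys) (b @ a l)) \<phi>) \<and>
                  (\<forall>l\<in>{..<n} - u. \<not> sat M (assign (xs @ ys) (b @ a l)) \<phi>))))"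

definition independent_theory :: "'a itself \<Rightarrow> ('f, 'p) vocab \<Rightarrow> ('f, 'p) fm set \<Rightarrow> bool" where
  "independent_theory TYPE('a) V T \<longleftrightarrow>
     (\<exists>\<phi> x ys. fm_over V \<phi> \<and> distinct (x # ys) \<and> free_vars \<phi> \<subseteq> set (x # ys) \<and>
        independent_fm TYPE('a) V T [x] ys \<phi>)"

section \<open>Increasing continuous sequences and medium limit models\<close>

definition chain_union :: "'i set \<Rightarrow> ('i \<Rightarrow> ('f, 'p, 'a) struct) \<Rightarrow> ('f, 'p, 'a) struct" where
  "chain_union I Ms =
     \<lparr> universe = (\<Union>i\<in>I. universe (Ms i)),
       fint = (\<lambda>s xs. if \<exists>i\<in>I. set xs \<subseteq> universe (Ms i)
                       then fint (Ms (SOME i. i \<in> I \<and> set xs \<subseteq> universe (Ms i))) s xs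
                       else undefined),
       rint = (\<lambda>s. \<Union>i\<in>I. rint (Ms i) s) \<rparr>"

text \<open>The index set \<open>I\<close> is meant to be an initial segment of the ordinals.\<close>

definition inc_cont ::
  "('f, 'p) vocab \<Rightarrow> 'o::wellorder set \<Rightarrow> ('o \<Rightarrow> ('f, 'p, 'a) struct) \<Rightarrow> bool" where
  "inc_cont V I Ms \<longleftrightarrow>
     (\<forall>i\<in>I. \<forall>j\<in>I. i < j \<longrightarrow> elem_sub V (Ms i) (Ms j)) \<and>
     (\<forall>d\<in>I. olimit d \<longrightarrow> Ms d = chain_union {..<d} Ms)"

definition EC :: "('f, 'p) vocab \<Rightarrow> ('f, 'p) fm set \<Rightarrow> 'o::wellorder \<Rightarrow> ('f, 'p, 'a) struct set" where
  "EC V T lam = {M \<in> Mod V T. |universe M| =o |{..<lam}| }"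

text \<open>The models whose universe is an ordinal in the interval \<open>[\<lambda>, \<lambda>\<^sup>+)\<close>, for \<open>'o\<close> of order type
  \<open>\<lambda>\<^sup>+\<close>.\<close>

definition EC_ord ::
  "('f, 'p) vocab \<Rightarrow> ('f, 'p) fm set \<Rightarrow> 'o::wellorder \<Rightarrow> ('f, 'p, 'o) struct set" where
  "EC_ord V T lam = {M \<in> EC V T lam. \<exists>b\<ge>lam. universe M = {..<b}}"

text \<open>
  A strategy \<open>F\<close> acts on sequences of models with an ordinal as universe, which avoids global
  choice; the model \<open>M\<close> is arbitrary. Here \<open>F i (restrict Ms {..i})\<close> is the value at the sequence
  of the \<open>Ms j\<close> with \<open>j \<le> i\<close>.
\<close>

definition md_limit ::
  "('f, 'p) vocab \<Rightarrow> ('f, 'p) fm set \<Rightarrow> 'o::wellorder \<Rightarrow> 'o \<Rightarrow> ('f, 'p, 'm) struct \<Rightarrow> bool" where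
  "md_limit V T lam theta M \<longleftrightarrow>
     M \<in> EC V T lam \<and>
     (\<exists>F :: 'o \<Rightarrow> ('o \<Rightarrow> ('f, 'p, 'o) struct) \<Rightarrow> ('f, 'p, 'o) struct.
        (\<forall>i Ms. inc_cont V {..i} Ms \<and> (\<forall>j\<le>i. Ms j \<in> EC_ord V T lam) \<longrightarrow>
           F i (restrict Ms {..i}) \<in> EC_ord V T lam \<and>
           elem_sub V (Ms i) (F i (restrict Ms {..i}))) \<and>
        (\<forall>d Ms. olimit d \<and> cf d = theta \<and>
           inc_cont V {..<d} Ms \<and> (\<forall>i<d. Ms i \<in> EC_ord V T lam) \<and>
           (\<forall>i<d. elem_sub V (Ms (osuc i)) (F (osuc i) (restrict Ms {..osuc i})) \<and>
                  elem_sub V (F (osuc i) (restrict Ms {..osuc i})) (Ms (osuc (osuc i)))) \<longrightarrow>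
           isomorphic V M (chain_union {..<d} Ms)))"

definition K ::
  "('f, 'p) vocab \<Rightarrow> ('f, 'p) fm set \<Rightarrow> 'o::wellorder \<Rightarrow> 'o \<Rightarrow> ('f, 'p, 'o) struct set" where
  "K V T lam a = {M \<in> Mod V T. universe M = {..<omul lam (oadd (osuc ozero) a)}}"

end

theory Submission
  imports Defs
begin

text \<open>
  Let \<open>\<phi>(x, y)\<close> be independent. Call a sequence of \<open>\<kappa>\<close> parameters in a model good if every subset
  \<open>v\<close> of \<open>\<kappa>\<close> is realized, i.e. some \<open>b\<close> satisfies \<open>\<phi>(b, c i)\<close> exactly for \<open>i \<in> v\<close>. Given a model with
  universe \<open>\<beta>\<close> and a good sequence \<open>c\<close>, the extension \<open>F\<close> adds \<open>\<kappa>\<close> averages of \<open>c\<close> along ultrafilters: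
  for \<open>b\<close> in the old model, the set of averages that \<open>b\<close> satisfies is a function \<open>h\<^sub>\<beta>\<close> of the subset
  realized by \<open>b\<close>. On an independent family of \<open>\<lambda> = 2\<^sup>\<kappa>\<close> subsets \<open>u z\<close> of \<open>\<kappa>\<close> the values \<open>h\<^sub>\<beta> (u z)\<close> are
  arbitrary, so they can be chosen such that \<open>h\<^sub>\<beta>\<close> and \<open>h\<^sub>\<gamma>\<close> agree on \<open>u z\<close> only for boundedly many
  \<open>z < \<lambda>\<close> when \<open>\<beta> \<noteq> \<gamma>\<close>.

  The code of stage \<open>\<alpha>\<close> consists of \<open>c\<close> and the averages added there. An isomorphism \<open>f\<close> of limit models
  that matches the codes along cofinal \<open>\<theta>\<close>-sequences with different limits fixes \<open>c\<close>, hence it preserves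
  realized subsets; as soon as \<open>f b\<close> has appeared, where \<open>b\<close> realizes \<open>u z\<close>, the two functions
  \<open>h\<close> at matching stages agree on \<open>u z\<close>. So \<open>\<lambda>\<close> is a union of \<open>\<theta>\<close> bounded sets, contrary to
  \<open>\<lambda>\<^sup>\<theta> = \<lambda>\<close>. There are only \<open>\<lambda>\<close> many \<open>\<theta>\<close>-sequences of codes in a given model of size \<open>\<lambda>\<close>, so it is
  isomorphic to few limits of cofinality \<open>\<theta>\<close>. A medium limit model would be isomorphic to
  all of them, since \<open>F\<close> can be interleaved with any strategy.
\<close>

section \<open>Ultrafilters and structures\<close>

text \<open>A single average gives one truth value for each \<open>u z\<close>, and of three
  functions with two values some two agree unboundedly often. With \<kappa> averages the value at
  \<open>u z\<close> is a subset of \<kappa>, and 2^\<kappa> = \<lambda> values leave room to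
  diagonalise against \<lambda> earlier functions. One ultrafilter on pairs \<open>(j, s)\<close>
  yields all averages of a stage: its image under \<open>(j, s) \<mapsto> j k\<close> is an
  ultrafilter \<open>D_k\<close> on \<kappa>, and \<open>b\<close> satisfies the \<open>k\<close>-th
  average iff the subset realized by \<open>b\<close> belongs to \<open>D_k\<close>. Independence of
  the family \<open>u\<close> makes every prescription of \<open>u z \<in> D_k\<close> consistent.
  The extension sees the present model and not its history, and in (4) not even its index. So a
  stage is labelled by the ordinal \<beta> itself, which grows strictly from one extended model to
  the next, and one function \<open>step\<close> serves all four statements. The new universe is a
  prescribed ordinal with \<lambda> new elements. Hence the ultrapower is cut down to a Skolem hull
  of size at most \<lambda>, whose classes are named by ordinals.\<close>

definition ultra :: "'j set set \<Rightarrow> bool" where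
  "ultra U \<longleftrightarrow> (\<forall>A B. A \<inter> B \<in> U \<longleftrightarrow> A \<in> U \<and> B \<in> U) \<and> (\<forall>A. - A \<in> U \<longleftrightarrow> A \<notin> U)"

text \<open>The two clauses of \<open>ultra\<close> are those that the induction for Los's theorem
  meets at conjunction and negation; upward closure and properness follow from them.\<close>

lemma ultra_Int: "ultra U \<Longrightarrow> A \<inter> B \<in> U \<longleftrightarrow> A \<in> U \<and> B \<in> U"
  and ultra_Compl: "ultra U \<Longrightarrow> - A \<in> U \<longleftrightarrow> A \<notin> U"
  by (simp_all add: ultra_def)

lemma ultra_mono:
  assumes "ultra U" "A \<in> U" "A \<subseteq> B"
  shows "B \<in> U"
proof -
  have "A \<inter> B \<in> U" using assms(2,3) by (simp add: Int_absorb2)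
  then show ?thesis using ultra_Int[OF assms(1), of A B] by simp
qed

lemma ultra_UNIV: "ultra U \<Longrightarrow> UNIV \<in> U"
  using ultra_Compl[of U UNIV] ultra_mono[of U "{}" UNIV] by auto

lemma ultra_empty: "ultra U \<Longrightarrow> {} \<notin> U"
  using ultra_Compl[of U UNIV] ultra_UNIV[of U] by simp

lemma ultra_ev_cong:
  assumes "ultra U" "C \<in> U" "\<And>t. t \<in> C \<Longrightarrow> t \<in> A \<longleftrightarrow> t \<in> B"
  shows "A \<in> U \<longleftrightarrow> B \<in> U"
proof -
  have "A \<inter> C = B \<inter> C" using assms(3) by blast
  then show ?thesis using ultra_Int[OF assms(1), of A C] ultra_Int[OF assms(1), of B C] assms(2) by simp
qed

text \<open>Take a family maximal among those that contain \<open>S\<close> and have the finite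
  intersection property. A set that cannot be added is disjoint from a finite intersection of
  members (\<open>nfip\<close>); if this happened to both \<open>A\<close> and \<open>- A\<close>,
  the two intersections together would be empty (\<open>dich\<close>).\<close>

lemma ultra_extends:
  assumes fip: "\<And>F. finite F \<Longrightarrow> F \<subseteq> S \<Longrightarrow> \<Inter>F \<noteq> {}"
  shows "\<exists>U. ultra U \<and> S \<subseteq> U"
proof -
  define FIP where "FIP = (\<lambda>S :: 'a set set. \<forall>F. finite F \<longrightarrow> F \<subseteq> S \<longrightarrow> \<Inter>F \<noteq> {})"
  have FIPD: "\<Inter>F \<noteq> {}" if "FIP S" "finite F" "F \<subseteq> S" for F and S :: "'a set set"
    using that by (simp add: FIP_def)
  define AA where "AA = {S'. S \<subseteq> S' \<and> FIP S'}"
  have "FIP S" using fip by (simp add: FIP_def)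
  then have "AA \<noteq> {}" by (auto simp: AA_def)
  then have "\<exists>M\<in>AA. \<forall>X\<in>AA. M \<subseteq> X \<longrightarrow> X = M"
  proof (rule subset_Zorn_nonempty)
    fix C assume ne: "C \<noteq> {}" and ch: "subset.chain AA C"
    then have sub: "C \<subseteq> AA" by (simp add: subset_chain_def)
    have "FIP (\<Union>C)"
      unfolding FIP_def
    proof (intro allI impI)
      fix F assume F: "finite F" "F \<subseteq> \<Union>C"
      obtain B where "B \<in> C" "F \<subseteq> B"
        by (rule finite_subset_Union_chain[OF F ne ch])
      moreover have "FIP B" using sub \<open>B \<in> C\<close> by (auto simp: AA_def)
      ultimately show "\<Inter>F \<noteq> {}" using F(1) by (simp add: FIP_def)
    qed
    moreover obtain B where "B \<in> C" using ne by blast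
    then have "S \<subseteq> \<Union>C" using sub by (auto simp: AA_def)
    ultimately show "\<Union>C \<in> AA" by (simp add: AA_def)
  qed
  then obtain M where M: "M \<in> AA" and max: "\<And>X. X \<in> AA \<Longrightarrow> M \<subseteq> X \<Longrightarrow> X = M"
    by metis
  have SM: "S \<subseteq> M" and fM: "FIP M" using M by (simp_all add: AA_def)
  have nfip: "\<exists>F. finite F \<and> F \<subseteq> M \<and> A \<inter> \<Inter>F = {}" if "A \<notin> M" for A
  proof -
    have "insert A M \<notin> AA" using max[of "insert A M"] that by auto
    then have "\<not> FIP (insert A M)" using SM by (auto simp: AA_def)
    then obtain F where F: "finite F" "F \<subseteq> insert A M" "\<Inter>F = {}" by (auto simp: FIP_def)
    have "A \<inter> \<Inter>(F - {A}) \<subseteq> \<Inter>F" by auto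
    then have "finite (F - {A}) \<and> F - {A} \<subseteq> M \<and> A \<inter> \<Inter>(F - {A}) = {}" using F by auto
    then show ?thesis by (rule exI)
  qed
  have dich: "A \<in> M \<or> - A \<in> M" for A
  proof (rule ccontr)
    assume "\<not> ?thesis"
    then obtain F G where F: "finite F" "F \<subseteq> M" "A \<inter> \<Inter>F = {}"
      and G: "finite G" "G \<subseteq> M" "- A \<inter> \<Inter>G = {}"
      using nfip[of A] nfip[of "- A"] by auto
    have "\<Inter>(F \<union> G) = {}" using F(3) G(3) by (auto simp: Inter_Un_distrib)
    then show False using FIPD[OF fM, of "F \<union> G"] F G by simp
  qed
  have excl: "A \<in> M \<Longrightarrow> - A \<notin> M" for A
    using FIPD[OF fM, of "{A, - A}"] by auto
  have int: "A \<inter> B \<in> M \<longleftrightarrow> A \<in> M \<and> B \<in> M" for A B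
  proof
    assume "A \<inter> B \<in> M"
    then have "- A \<notin> M" "- B \<notin> M"
      using FIPD[OF fM, of "{A \<inter> B, - A}"] FIPD[OF fM, of "{A \<inter> B, - B}"] by auto
    then show "A \<in> M \<and> B \<in> M" using dich[of A] dich[of B] by simp
  next
    assume "A \<in> M \<and> B \<in> M"
    then have "- (A \<inter> B) \<notin> M"
      using FIPD[OF fM, of "{A, B, - (A \<inter> B)}"] by auto
    then show "A \<inter> B \<in> M" using dich[of "A \<inter> B"] by simp
  qed
  have "- A \<in> M \<longleftrightarrow> A \<notin> M" for A using dich[of A] excl[of A] by auto
  then have "ultra M" unfolding ultra_def using int by simp
  then show ?thesis using SM by auto
qed

section \<open>Satisfaction, isomorphisms and elementary submodels\<close>

lemma finite_trm_vars: "finite (trm_vars t)"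
  by (induction t) auto

lemma finite_free_vars: "finite (free_vars \<phi>)"
  by (induction \<phi>) (auto simp: finite_trm_vars)

lemma eval_trm_cong: "(\<And>x. x \<in> trm_vars t \<Longrightarrow> v x = w x) \<Longrightarrow> eval_trm M v t = eval_trm M w t"
proof (induction t)
  case (App f ts)
  have "map (eval_trm M v) ts = map (eval_trm M w) ts"
  proof (rule map_cong[OF refl])
    fix t assume "t \<in> set ts"
    then show "eval_trm M v t = eval_trm M w t"
      by (rule App.IH) (use App.prems \<open>t \<in> set ts\<close> in auto)
  qed
  then show ?case by (simp only: eval_trm.simps)
qed simp

lemma sat_cong: "(\<forall>x\<in>free_vars \<phi>. v x = w x) \<Longrightarrow> sat M v \<phi> = sat M w \<phi>"
proof (induction \<phi> arbitrary: v w)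
  case (Equal s t)
  have "eval_trm M v s = eval_trm M w s" "eval_trm M v t = eval_trm M w t"
    by (rule eval_trm_cong, use Equal in simp)+
  then show ?case by simp
next
  case (Rel r ts)
  have "map (eval_trm M v) ts = map (eval_trm M w) ts"
    by (rule map_cong[OF refl], rule eval_trm_cong) (use Rel in simp)
  then show ?case by (simp only: sat.simps)
next
  case (Neg \<phi>)
  have "sat M v \<phi> = sat M w \<phi>" by (rule Neg.IH) (use Neg.prems in simp)
  then show ?case by simp
next
  case (Conj \<phi> \<psi>)
  have "sat M v \<phi> = sat M w \<phi>" by (rule Conj.IH(1)) (use Conj.prems in simp)
  moreover have "sat M v \<psi> = sat M w \<psi>" by (rule Conj.IH(2)) (use Conj.prems in simp)
  ultimately show ?case by simp
next
  case (Exi x \<phi>)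
  have "sat M (v(x := a)) \<phi> = sat M (w(x := a)) \<phi>" for a
    by (rule Exi.IH) (use Exi.prems in simp)
  then show ?case by simp
qed

lemma is_structD:
  assumes "is_struct V M"
  shows universe_nonempty: "universe M \<noteq> {}"
    and fint_PiE: "(f, n) \<in> funs V \<Longrightarrow> fint M (f, n) \<in> tuples (universe M) n \<rightarrow>\<^sub>E universe M"
    and rint_tuples: "(r, n) \<in> rels V \<Longrightarrow> rint M (r, n) \<subseteq> tuples (universe M) n"
    and fint_undefined: "s \<notin> funs V \<Longrightarrow> fint M s = (\<lambda>_. undefined)"
    and rint_empty: "s' \<notin> rels V \<Longrightarrow> rint M s' = {}"
  using assms[unfolded is_struct_def] by metis+

lemma fint_in_universe:
  "is_struct V M \<Longrightarrow> (f, n) \<in> funs V \<Longrightarrow> xs \<in> tuples (universe M) n \<Longrightarrow> fint M (f, n) xs \<in> universe M"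
  using fint_PiE PiE_mem by metis

lemma eval_trm_in_universe:
  assumes "is_struct V M" "range v \<subseteq> universe M"
  shows "trm_over V t \<Longrightarrow> eval_trm M v t \<in> universe M"
proof (induction t)
  case (App f ts)
  then have "map (eval_trm M v) ts \<in> tuples (universe M) (length ts)"
    by (auto simp: tuples_def)
  then show ?case using App.prems by (simp add: fint_in_universe[OF assms(1)])
qed (use assms in auto)

lemma range_upd: "range v \<subseteq> A \<Longrightarrow> a \<in> A \<Longrightarrow> range (v(x := a)) \<subseteq> A"
  by auto

lemma iso_fint:
  "is_isomorphism V M N h \<Longrightarrow> (f, n) \<in> funs V \<Longrightarrow> xs \<in> tuples (universe M) n \<Longrightarrow>
    h (fint M (f, n) xs) = fint N (f, n) (map h xs)"
  and iso_rint:
  "is_isomorphism V M N h \<Longrightarrow> (r, n) \<in> rels V \<Longrightarrow> xs \<in> tuples (universe M) n \<Longrightarrow>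
    xs \<in> rint M (r, n) \<longleftrightarrow> map h xs \<in> rint N (r, n)"
  and iso_bij: "is_isomorphism V M N h \<Longrightarrow> bij_betw h (universe M) (universe N)"
  by (simp_all add: is_isomorphism_def)

lemma eval_trm_iso:
  assumes "is_struct V M" "is_isomorphism V M N h" "range v \<subseteq> universe M"
  shows "trm_over V t \<Longrightarrow> h (eval_trm M v t) = eval_trm N (h \<circ> v) t"
proof (induction t)
  case (App f ts)
  have tup: "map (eval_trm M v) ts \<in> tuples (universe M) (length ts)"
    using App.prems eval_trm_in_universe[OF assms(1,3)] by (auto simp: tuples_def)
  have "map h (map (eval_trm M v) ts) = map (eval_trm N (h \<circ> v)) ts"
    unfolding map_map
  proof (rule map_cong[OF refl])
    fix t assume "t \<in> set ts"
    then show "(h \<circ> eval_trm M v) t = eval_trm N (h \<circ> v) t"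
      using App.IH[of t] App.prems by (simp del: o_apply add: o_apply[of h "eval_trm M v"])
  qed
  then show ?case using iso_fint[OF assms(2) _ tup, of f] App.prems by (simp del: map_map o_apply)
qed simp

text \<open>Injectivity of \<open>h\<close> enters at equality, surjectivity at the
  quantifier.\<close>

lemma sat_iso:
  assumes "is_struct V M" "is_isomorphism V M N h"
  shows "fm_over V \<phi> \<Longrightarrow> range v \<subseteq> universe M \<Longrightarrow> sat M v \<phi> \<longleftrightarrow> sat N (h \<circ> v) \<phi>"
proof (induction \<phi> arbitrary: v)
  case (Equal s t)
  have "inj_on h (universe M)" using iso_bij[OF assms(2)] by (simp add: bij_betw_def)
  moreover have "eval_trm M v s \<in> universe M" "eval_trm M v t \<in> universe M"
    using Equal eval_trm_in_universe[OF assms(1)] by auto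
  ultimately have "h (eval_trm M v s) = h (eval_trm M v t) \<longleftrightarrow> eval_trm M v s = eval_trm M v t"
    by (rule inj_on_eq_iff)
  then show ?case
    using Equal.prems(1) eval_trm_iso[OF assms Equal.prems(2)] by (simp del: o_apply)
next
  case (Rel r ts)
  have "map (eval_trm M v) ts \<in> tuples (universe M) (length ts)"
    using Rel eval_trm_in_universe[OF assms(1)] by (auto simp: tuples_def)
  moreover have "map h (map (eval_trm M v) ts) = map (eval_trm N (h \<circ> v)) ts"
    unfolding map_map
  proof (rule map_cong[OF refl])
    fix t assume "t \<in> set ts"
    then show "(h \<circ> eval_trm M v) t = eval_trm N (h \<circ> v) t"
      using eval_trm_iso[OF assms Rel.prems(2)] Rel.prems(1)
      by (simp del: o_apply add: o_apply[of h "eval_trm M v"])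
  qed
  ultimately show ?case using iso_rint[OF assms(2), of r] Rel.prems by (simp del: map_map o_apply)
next
  case (Exi x \<phi>)
  have im: "universe N = h ` universe M" using iso_bij[OF assms(2)] by (simp add: bij_betw_def)
  have "sat M (v(x := a)) \<phi> \<longleftrightarrow> sat N ((h \<circ> v)(x := h a)) \<phi>" if "a \<in> universe M" for a
  proof -
    have "sat M (v(x := a)) \<phi> \<longleftrightarrow> sat N (h \<circ> v(x := a)) \<phi>"
      by (rule Exi.IH[OF _ range_upd[OF Exi.prems(2) that]]) (use Exi.prems(1) in simp)
    then show ?thesis unfolding fun_upd_comp .
  qed
  then show ?case by (simp add: im del: o_apply)
qed auto

lemma isomorphism_comp:
  assumes h: "is_isomorphism V M N h" and k: "is_isomorphism V N P k"
  shows "is_isomorphism V M P (k \<circ> h)"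
proof -
  have tup: "map h xs \<in> tuples (universe N) n" if "xs \<in> tuples (universe M) n" for xs n
    using that h by (auto simp: tuples_def is_isomorphism_def bij_betw_def)
  show ?thesis
    unfolding is_isomorphism_def
  proof (intro conjI allI impI ballI)
    show "bij_betw (k \<circ> h) (universe M) (universe P)"
      using h k by (auto simp: is_isomorphism_def intro: bij_betw_trans)
  next
    fix f n xs assume "(f, n) \<in> funs V" and xs: "xs \<in> tuples (universe M) n"
    then have "h (fint M (f, n) xs) = fint N (f, n) (map h xs)"
      "k (fint N (f, n) (map h xs)) = fint P (f, n) (map k (map h xs))"
      using h k tup[OF xs] by (auto simp: is_isomorphism_def)
    then show "(k \<circ> h) (fint M (f, n) xs) = fint P (f, n) (map (k \<circ> h) xs)" by simp
  next
    fix r n xs assume "(r, n) \<in> rels V" and xs: "xs \<in> tuples (universe M) n"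
    then have "xs \<in> rint M (r, n) \<longleftrightarrow> map h xs \<in> rint N (r, n)"
      "map h xs \<in> rint N (r, n) \<longleftrightarrow> map k (map h xs) \<in> rint P (r, n)"
      using h k tup[OF xs] by (auto simp: is_isomorphism_def)
    then show "xs \<in> rint M (r, n) \<longleftrightarrow> map (k \<circ> h) xs \<in> rint P (r, n)" by simp
  qed
qed

lemma isomorphism_inv:
  assumes st: "is_struct V M" and h: "is_isomorphism V M N h"
  shows "is_isomorphism V N M (inv_into (universe M) h)"
proof -
  let ?g = "inv_into (universe M) h"
  have bij: "bij_betw h (universe M) (universe N)" using h by (simp add: is_isomorphism_def)
  have g: "?g y \<in> universe M" "h (?g y) = y" if "y \<in> universe N" for y
    using bij that by (auto simp: bij_betw_def inv_into_into f_inv_into_f)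
  have gh: "?g (h x) = x" if "x \<in> universe M" for x
    using bij that by (simp add: bij_betw_def)
  have tup: "map ?g ys \<in> tuples (universe M) n" "map h (map ?g ys) = ys"
    if "ys \<in> tuples (universe N) n" for ys n
    using that g by (auto simp: tuples_def map_idI subset_iff)
  show ?thesis
    unfolding is_isomorphism_def
  proof (intro conjI allI impI ballI)
    show "bij_betw ?g (universe N) (universe M)" using bij by (rule bij_betw_inv_into)
  next
    fix f n ys assume fn: "(f, n) \<in> funs V" and ys: "ys \<in> tuples (universe N) n"
    have "h (fint M (f, n) (map ?g ys)) = fint N (f, n) ys"
      using h fn tup[OF ys] unfolding is_isomorphism_def by metis
    then show "?g (fint N (f, n) ys) = fint M (f, n) (map ?g ys)"
      using gh[OF fint_in_universe[OF st fn tup(1)[OF ys]]] by simp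
  next
    fix r n ys assume "(r, n) \<in> rels V" and ys: "ys \<in> tuples (universe N) n"
    then show "ys \<in> rint N (r, n) \<longleftrightarrow> map ?g ys \<in> rint M (r, n)"
      using h tup[OF ys] unfolding is_isomorphism_def by metis
  qed
qed

lemma isomorphic_sym: "is_struct V M \<Longrightarrow> isomorphic V M N \<Longrightarrow> isomorphic V N M"
  unfolding isomorphic_def using isomorphism_inv by blast

lemma elem_sub_refl: "elem_sub V M M"
  by (simp add: elem_sub_def)

lemma elem_sub_trans: "elem_sub V M N \<Longrightarrow> elem_sub V N P \<Longrightarrow> elem_sub V M P"
  unfolding elem_sub_def by (metis subset_trans)

lemma elem_sub_sat:
  "elem_sub V M N \<Longrightarrow> fm_over V \<phi> \<Longrightarrow> range v \<subseteq> universe M \<Longrightarrow> sat M v \<phi> \<longleftrightarrow> sat N v \<phi>"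
  unfolding elem_sub_def by blast

lemma sat_sentence: "\<phi> \<in> sentences V \<Longrightarrow> sat M v \<phi> \<longleftrightarrow> sat M w \<phi>"
  by (rule sat_cong) (simp add: sentences_def)

lemma elem_sub_Mod:
  assumes "T \<subseteq> sentences V" "M \<in> Mod V T" "is_struct V N" "elem_sub V M N"
  shows "N \<in> Mod V T"
proof -
  have "sat N v \<phi>" if "\<phi> \<in> T" for v \<phi>
  proof -
    obtain m where m: "m \<in> universe M" using assms(2) universe_nonempty[of V M] by (auto simp: Mod_def)
    then have "sat M (\<lambda>_. m) \<phi>" using assms(2) that by (auto simp: Mod_def)
    moreover have "fm_over V \<phi>" using assms(1) that by (auto simp: sentences_def)
    ultimately have "sat N (\<lambda>_. m) \<phi>" using elem_sub_sat[OF assms(4), of \<phi> "\<lambda>_. m"] m by auto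
    then show ?thesis using sat_sentence assms(1) that by blast
  qed
  then show ?thesis using assms(3) by (simp add: Mod_def)
qed

lemma isomorphic_Mod:
  assumes "T \<subseteq> sentences V" "M \<in> Mod V T" "is_struct V N" "is_isomorphism V M N h"
  shows "N \<in> Mod V T"
proof -
  have "sat N v \<phi>" if "\<phi> \<in> T" for v \<phi>
  proof -
    obtain m where m: "m \<in> universe M" using assms(2) universe_nonempty[of V M] by (auto simp: Mod_def)
    then have "sat M (\<lambda>_. m) \<phi>" using assms(2) that by (auto simp: Mod_def)
    moreover have "fm_over V \<phi>" using assms(1) that by (auto simp: sentences_def)
    moreover have "is_struct V M" using assms(2) by (simp add: Mod_def)
    ultimately have "sat N (h \<circ> (\<lambda>_. m)) \<phi>" using sat_iso[OF _ assms(4), of \<phi> "\<lambda>_. m"] m by auto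
    then show ?thesis using sat_sentence assms(1) that by blast
  qed
  then show ?thesis using assms(3) by (simp add: Mod_def)
qed

text \<open>An alleged medium limit model may have elements of any type; its copy on the ordinal
  \<lambda> starts the sequence that refutes it. Outside the vocabulary and the universe the default
  values are inserted, as \<open>is_struct\<close> demands.\<close>

lemma transport_struct:
  fixes M :: "('f, 'p, 'a) struct" and A :: "'b set"
  assumes st: "is_struct V M" and h: "bij_betw h (universe M) A"
  shows "\<exists>N. is_struct V N \<and> universe N = A \<and> is_isomorphism V M N h"
proof -
  let ?g = "inv_into (universe M) h"
  define N where "N = \<lparr> universe = A,
    fint = (\<lambda>s. if s \<in> funs V then (\<lambda>xs. if xs \<in> tuples A (snd s) then h (fint M s (map ?g xs)) else undefined)
              else (\<lambda>_. undefined)),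
    rint = (\<lambda>s. if s \<in> rels V then map h ` rint M s else {}) \<rparr>"
  have g: "?g y \<in> universe M" "h (?g y) = y" if "y \<in> A" for y
    using h that by (auto simp: bij_betw_def inv_into_into f_inv_into_f)
  have gh: "?g (h x) = x" if "x \<in> universe M" for x
    using h that by (simp add: bij_betw_def)
  have tup: "map ?g ys \<in> tuples (universe M) n" if "ys \<in> tuples A n" for ys n
    using that g by (auto simp: tuples_def)
  have tuh: "map h xs \<in> tuples A n" "map ?g (map h xs) = xs" if "xs \<in> tuples (universe M) n" for xs n
    using that gh h by (auto simp: tuples_def map_idI subset_iff bij_betw_def)
  have ne: "A \<noteq> {}" using universe_nonempty[OF st] h by (auto simp: bij_betw_def)
  have rl: "rint M (r, n) \<subseteq> tuples (universe M) n" if "(r, n) \<in> rels V" for r n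
    using rint_tuples[OF st that] .
  have hA: "h x \<in> A" if "x \<in> universe M" for x using that h by (auto simp: bij_betw_def)
  have "is_struct V N"
    unfolding is_struct_def
  proof (intro conjI allI impI)
    fix f n assume "(f, n) \<in> funs V"
    then show "fint N (f, n) \<in> tuples (universe N) n \<rightarrow>\<^sub>E universe N"
      by (auto simp: N_def intro!: hA fint_in_universe[OF st] tup)
  next
    fix r n assume "(r, n) \<in> rels V"
    then show "rint N (r, n) \<subseteq> tuples (universe N) n"
      using rl[of r n] tuh(1)[of _ n] by (auto simp: N_def)
  qed (use ne in \<open>auto simp: N_def\<close>)
  moreover have "is_isomorphism V M N h"
    unfolding is_isomorphism_def
  proof (intro conjI allI impI ballI)
    show "bij_betw h (universe M) (universe N)" using h by (simp add: N_def)
  next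
    fix f n xs assume "(f, n) \<in> funs V" "xs \<in> tuples (universe M) n"
    then show "h (fint M (f, n) xs) = fint N (f, n) (map h xs)"
      using tuh[of xs n] by (simp add: N_def)
  next
    fix r n xs assume rn: "(r, n) \<in> rels V" and xs: "xs \<in> tuples (universe M) n"
    have "xs \<in> rint M (r, n)" if "map h xs = map h ys" "ys \<in> rint M (r, n)" for ys
      using that rl[OF rn] tuh(2)[OF xs] tuh(2)[of ys n] by auto
    then show "xs \<in> rint M (r, n) \<longleftrightarrow> map h xs \<in> rint N (r, n)"
      using rn by (auto simp: N_def)
  qed
  ultimately show ?thesis by (auto simp: N_def)
qed

section \<open>Unions of elementary chains\<close>

lemma card_of_Un_ordLeq_infinite:
  assumes "infinite C" "|A| \<le>o |C|" "|B| \<le>o |C|"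
  shows "|A \<union> B| \<le>o |C|"
proof (rule card_of_Un_ordLeq_infinite_Field)
  show "infinite (Field |C| )" using assms(1) by (simp add: Field_card_of)
qed (use assms card_of_Card_order in auto)

lemma card_of_lists_ordLeq:
  assumes inf: "infinite L" and A: "|A| \<le>o |L|"
  shows "|lists A| \<le>o |L|"
proof -
  have n: "|{xs \<in> lists A. length xs = n}| \<le>o |L|" for n
  proof (induction n)
    case 0
    have "{xs \<in> lists A. length xs = 0} = {[]}" by auto
    then show ?case using card_of_singl_ordLeq[of L "[]"] inf by auto
  next
    case (Suc n)
    have "{xs \<in> lists A. length xs = Suc n} \<subseteq> (\<lambda>(x, xs). x # xs) ` (A \<times> {xs \<in> lists A. length xs = n})"
      by (auto simp: length_Suc_conv image_iff)
    then have "|{xs \<in> lists A. length xs = Suc n}| \<le>o |A \<times> {xs \<in> lists A. length xs = n}|"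
      by (rule surj_imp_ordLeq)
    also have "|A \<times> {xs \<in> lists A. length xs = n}| \<le>o |L|"
      by (rule card_of_Sigma_ordLeq_infinite[OF inf A]) (use Suc in simp)
    finally show ?case .
  qed
  have "lists A = (\<Union>n. {xs \<in> lists A. length xs = n})" by auto
  moreover have "|\<Union>n. {xs \<in> lists A. length xs = n}| \<le>o |L|"
    by (rule card_of_UNION_ordLeq_infinite[OF inf]) (use n inf infinite_iff_card_of_nat in auto)
  ultimately show ?thesis by simp
qed

lemma ultra_finite_all:
  assumes U: "ultra U" and "finite A" "\<And>a. a \<in> A \<Longrightarrow> {t. P a t} \<in> U"
  shows "{t. \<forall>a\<in>A. P a t} \<in> U"
  using assms(2,3)
proof (induction A)
  case empty
  then show ?case using ultra_UNIV[OF U] by simp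
next
  case (insert a A)
  have "{t. \<forall>x\<in>insert a A. P x t} = {t. P a t} \<inter> {t. \<forall>x\<in>A. P x t}" by auto
  then show ?case using insert ultra_Int[OF U] by simp
qed

lemma map_eval_vars:
  "length xs = n \<Longrightarrow> (\<forall>i<n. v i = xs ! i) \<Longrightarrow> map (eval_trm M v) (map Var [0..<n]) = xs"
  by (auto intro: nth_equalityI)

text \<open>Elementarity is applied to the formula saying that variable \<open>n\<close> equals
  \<open>f\<close> of the variables below \<open>n\<close>; the valuation gives variable
  \<open>n\<close> the value computed in \<open>M\<close>.\<close>

lemma elem_sub_fint:
  assumes sub: "elem_sub V M N" and st: "is_struct V M" and f: "(f, n) \<in> funs V"
    and xs: "xs \<in> tuples (universe M) n"
  shows "fint N (f, n) xs = fint M (f, n) xs"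
proof -
  define v where "v = (\<lambda>i. if i < n then xs ! i else fint M (f, n) xs)"
  have len: "length xs = n" and sx: "set xs \<subseteq> universe M" using xs by (auto simp: tuples_def)
  have "range v \<subseteq> universe M"
    using fint_in_universe[OF st f xs] sx len unfolding v_def by (auto intro: nth_mem)
  moreover have "fm_over V (Equal (Var n) (App f (map Var [0..<n])))" using f by auto
  ultimately have "sat M v (Equal (Var n) (App f (map Var [0..<n]))) \<longleftrightarrow>
      sat N v (Equal (Var n) (App f (map Var [0..<n])))"
    using elem_sub_sat[OF sub] by metis
  moreover have "map (eval_trm M v) (map Var [0..<n]) = xs" "map (eval_trm N v) (map Var [0..<n]) = xs"
    by (rule map_eval_vars[OF len]; simp add: v_def)+
  ultimately show ?thesis
    by (simp del: map_map add: v_def[THEN fun_cong, of n])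
qed

lemma elem_sub_rint:
  assumes sub: "elem_sub V M N" and r: "(r, n) \<in> rels V"
    and xs: "xs \<in> tuples (universe M) n" and ne: "universe M \<noteq> {}"
  shows "xs \<in> rint N (r, n) \<longleftrightarrow> xs \<in> rint M (r, n)"
proof -
  obtain m where m: "m \<in> universe M" using ne by blast
  define v where "v = (\<lambda>i. if i < n then xs ! i else m)"
  have len: "length xs = n" and sx: "set xs \<subseteq> universe M" using xs by (auto simp: tuples_def)
  have "range v \<subseteq> universe M" using m sx len unfolding v_def by (auto intro: nth_mem)
  moreover have "fm_over V (Rel r (map Var [0..<n]))" using r by auto
  ultimately have "sat M v (Rel r (map Var [0..<n])) \<longleftrightarrow> sat N v (Rel r (map Var [0..<n]))"
    using elem_sub_sat[OF sub] by metis
  moreover have "map (eval_trm M v) (map Var [0..<n]) = xs" "map (eval_trm N v) (map Var [0..<n]) = xs"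
    by (rule map_eval_vars[OF len]; simp add: v_def)+
  ultimately show ?thesis by (simp del: map_map)
qed

section \<open>Tarski's chain theorem\<close>

locale elem_chain =
  fixes V :: "('f, 'p) vocab" and I :: "'i::linorder set" and Ms :: "'i \<Rightarrow> ('f, 'p, 'a) struct"
  assumes ne: "I \<noteq> {}"
    and st: "i \<in> I \<Longrightarrow> is_struct V (Ms i)"
    and chain: "i \<in> I \<Longrightarrow> j \<in> I \<Longrightarrow> i < j \<Longrightarrow> elem_sub V (Ms i) (Ms j)"
begin

lemma chain_le: "i \<in> I \<Longrightarrow> j \<in> I \<Longrightarrow> i \<le> j \<Longrightarrow> elem_sub V (Ms i) (Ms j)"
  using chain elem_sub_refl by (metis order_le_less)

lemma univ_mono: "i \<in> I \<Longrightarrow> j \<in> I \<Longrightarrow> i \<le> j \<Longrightarrow> universe (Ms i) \<subseteq> universe (Ms j)"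
  using chain_le by (simp add: elem_sub_def)

lemma univ_union: "universe (chain_union I Ms) = (\<Union>i\<in>I. universe (Ms i))"
  by (simp add: chain_union_def)

lemma fint_agree:
  assumes i: "i \<in> I" and j: "j \<in> I" and f: "(f, n) \<in> funs V"
    and xi: "xs \<in> tuples (universe (Ms i)) n" and xj: "xs \<in> tuples (universe (Ms j)) n"
  shows "fint (Ms i) (f, n) xs = fint (Ms j) (f, n) xs"
proof (cases "i \<le> j")
  case True
  then show ?thesis using elem_sub_fint[OF chain_le[OF i j] st[OF i] f xi] by simp
next
  case False
  then show ?thesis using elem_sub_fint[OF chain_le[OF j i] st[OF j] f xj] by simp
qed

text \<open>\<open>chain_union\<close> evaluates a tuple at an index picked by \<open>SOME\<close>;
  any two members that contain the tuple agree on it, so the choice is immaterial.\<close>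

lemma fint_union:
  assumes i: "i \<in> I" and f: "(f, n) \<in> funs V" and x: "xs \<in> tuples (universe (Ms i)) n"
  shows "fint (chain_union I Ms) (f, n) xs = fint (Ms i) (f, n) xs"
proof -
  define j where "j = (SOME j. j \<in> I \<and> set xs \<subseteq> universe (Ms j))"
  have ex: "\<exists>j. j \<in> I \<and> set xs \<subseteq> universe (Ms j)" using i x by (auto simp: tuples_def)
  have j: "j \<in> I \<and> set xs \<subseteq> universe (Ms j)" unfolding j_def by (rule someI_ex[OF ex])
  have "fint (chain_union I Ms) (f, n) xs = fint (Ms j) (f, n) xs"
    using ex by (auto simp: chain_union_def j_def)
  also have "\<dots> = fint (Ms i) (f, n) xs"
    using fint_agree[OF _ i f _ x, of j] j x by (simp add: tuples_def)
  finally show ?thesis .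
qed

lemma rint_union:
  assumes i: "i \<in> I" and r: "(r, n) \<in> rels V" and x: "xs \<in> tuples (universe (Ms i)) n"
  shows "xs \<in> rint (chain_union I Ms) (r, n) \<longleftrightarrow> xs \<in> rint (Ms i) (r, n)"
proof
  assume "xs \<in> rint (chain_union I Ms) (r, n)"
  then obtain j where j: "j \<in> I" "xs \<in> rint (Ms j) (r, n)" by (auto simp: chain_union_def)
  have xj: "xs \<in> tuples (universe (Ms j)) n" using rint_tuples[OF st[OF j(1)] r] j(2) by auto
  show "xs \<in> rint (Ms i) (r, n)"
  proof (cases "i \<le> j")
    case True
    then show ?thesis
      using elem_sub_rint[OF chain_le[OF i j(1)] r x universe_nonempty[OF st[OF i]]] j by simp
  next
    case False
    then show ?thesis
      using elem_sub_rint[OF chain_le[OF j(1) i] r xj universe_nonempty[OF st[OF j(1)]]] j by simp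
  qed
qed (use i in \<open>auto simp: chain_union_def\<close>)

lemma struct_union: "is_struct V (chain_union I Ms)"
  unfolding is_struct_def
proof (intro conjI allI impI)
  obtain i where "i \<in> I" using ne by blast
  then show "universe (chain_union I Ms) \<noteq> {}"
    using universe_nonempty[OF st, of i] by (auto simp: univ_union)
next
  fix f n assume f: "(f, n) \<in> funs V"
  show "fint (chain_union I Ms) (f, n) \<in> tuples (universe (chain_union I Ms)) n \<rightarrow>\<^sub>E universe (chain_union I Ms)"
  proof (rule PiE_I)
    fix xs assume "xs \<in> tuples (universe (chain_union I Ms)) n"
    then have len: "length xs = n" and sub: "set xs \<subseteq> (\<Union>i\<in>I. universe (Ms i))"
      by (auto simp: tuples_def univ_union)
    have "\<exists>i\<in>I. set xs \<subseteq> universe (Ms i)"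
      using sub
    proof (induction xs)
      case (Cons a xs)
      then obtain i j where "i \<in> I" "set xs \<subseteq> universe (Ms i)" "j \<in> I" "a \<in> universe (Ms j)" by auto
      then have "max i j \<in> I" "set (a # xs) \<subseteq> universe (Ms (max i j))"
        using univ_mono[of i "max i j"] univ_mono[of j "max i j"] by (auto simp: max_def subset_iff)
      then show ?case by blast
    qed (use ne in auto)
    then obtain i where i: "i \<in> I" "xs \<in> tuples (universe (Ms i)) n" using len by (auto simp: tuples_def)
    then show "fint (chain_union I Ms) (f, n) xs \<in> universe (chain_union I Ms)"
      using fint_union[OF i(1) f i(2)] fint_in_universe[OF st[OF i(1)] f i(2)] by (auto simp: univ_union)
  next
    fix xs assume x: "xs \<notin> tuples (universe (chain_union I Ms)) n"
    have "fint (Ms i) (f, n) xs = undefined" if "i \<in> I" "set xs \<subseteq> universe (Ms i)" for i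
    proof -
      have "xs \<notin> tuples (universe (Ms i)) n" using x that by (auto simp: tuples_def univ_union)
      then show ?thesis using fint_PiE[OF st[OF that(1)] f] PiE_arb by metis
    qed
    then show "fint (chain_union I Ms) (f, n) xs = undefined"
      by (simp add: chain_union_def) (metis (mono_tags, lifting) someI_ex)
  qed
next
  fix r n assume r: "(r, n) \<in> rels V"
  show "rint (chain_union I Ms) (r, n) \<subseteq> tuples (universe (chain_union I Ms)) n"
    using rint_tuples[OF st r] by (fastforce simp: chain_union_def tuples_def)
next
  fix s assume s: "s \<notin> funs V"
  have "fint (Ms (SOME i. i \<in> I \<and> set xs \<subseteq> universe (Ms i))) s xs = undefined"
    if "\<exists>i\<in>I. set xs \<subseteq> universe (Ms i)" for xs
  proof -
    have "(SOME i. i \<in> I \<and> set xs \<subseteq> universe (Ms i)) \<in> I" using that by (metis (mono_tags, lifting) someI_ex)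
    then show ?thesis using fint_undefined[OF st s] by simp
  qed
  then show "fint (chain_union I Ms) s = (\<lambda>_. undefined)"
    by (simp add: chain_union_def fun_eq_iff)
next
  fix s assume s: "s \<notin> rels V"
  then show "rint (chain_union I Ms) s = {}" using rint_empty[OF st s] by (simp add: chain_union_def)
qed

lemma eval_union:
  assumes i: "i \<in> I" and v: "range v \<subseteq> universe (Ms i)"
  shows "trm_over V t \<Longrightarrow> eval_trm (chain_union I Ms) v t = eval_trm (Ms i) v t"
proof (induction t)
  case (App f ts)
  have "map (eval_trm (chain_union I Ms) v) ts = map (eval_trm (Ms i) v) ts"
    by (rule map_cong[OF refl]) (use App in auto)
  moreover have "map (eval_trm (Ms i) v) ts \<in> tuples (universe (Ms i)) (length ts)"
    using App.prems eval_trm_in_universe[OF st[OF i] v] by (auto simp: tuples_def)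
  ultimately show ?case using fint_union[OF i] App.prems by (simp del: map_eq_conv)
qed simp

text \<open>Induction on the formula for all members at once: a witness in the union appears in some
  later member, where the induction hypothesis applies, and elementarity between members brings the
  existential statement back to \<open>Ms i\<close>.\<close>

lemma elem_sub_union:
  assumes "i \<in> I"
  shows "elem_sub V (Ms i) (chain_union I Ms)"
proof -
  have "sat (Ms i) v \<phi> \<longleftrightarrow> sat (chain_union I Ms) v \<phi>"
    if "fm_over V \<phi>" "i \<in> I" "range v \<subseteq> universe (Ms i)" for \<phi> v i
    using that
  proof (induction \<phi> arbitrary: v i)
    case (Rel r ts)
    have "map (eval_trm (chain_union I Ms) v) ts = map (eval_trm (Ms i) v) ts"
      by (rule map_cong[OF refl]) (use Rel eval_union[OF Rel.prems(2,3)] in auto)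
    moreover have "map (eval_trm (Ms i) v) ts \<in> tuples (universe (Ms i)) (length ts)"
      using Rel eval_trm_in_universe[OF st[OF Rel.prems(2)] Rel.prems(3)] by (auto simp: tuples_def)
    ultimately show ?case using rint_union[OF Rel.prems(2)] Rel.prems(1) by (simp del: map_eq_conv)
  next
    case (Exi x \<phi>)
    have o: "fm_over V \<phi>" using Exi.prems(1) by simp
    show ?case
    proof
      assume "sat (Ms i) v (Exi x \<phi>)"
      then obtain a where a: "a \<in> universe (Ms i)" "sat (Ms i) (v(x := a)) \<phi>" by auto
      then have "sat (chain_union I Ms) (v(x := a)) \<phi>"
        using Exi.IH[OF o Exi.prems(2) range_upd[OF Exi.prems(3) a(1)], of x] by blast
      then show "sat (chain_union I Ms) v (Exi x \<phi>)" using a(1) Exi.prems(2) by (auto simp: univ_union)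
    next
      assume "sat (chain_union I Ms) v (Exi x \<phi>)"
      then obtain j a where a: "j \<in> I" "a \<in> universe (Ms j)" "sat (chain_union I Ms) (v(x := a)) \<phi>"
        by (auto simp: univ_union)
      define k where "k = max i j"
      have k: "k \<in> I" "i \<le> k" "j \<le> k" using a(1) Exi.prems(2) by (auto simp: k_def max_def)
      have ak: "a \<in> universe (Ms k)" using univ_mono[OF a(1) k(1,3)] a(2) by auto
      have vk: "range v \<subseteq> universe (Ms k)" using univ_mono[OF Exi.prems(2) k(1,2)] Exi.prems(3) by auto
      have "sat (Ms k) (v(x := a)) \<phi>"
        using Exi.IH[OF o k(1) range_upd[OF vk ak], of x] a(3) by blast
      then have "sat (Ms k) v (Exi x \<phi>)" using ak by auto
      then show "sat (Ms i) v (Exi x \<phi>)"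
        using elem_sub_sat[OF chain_le[OF Exi.prems(2) k(1,2)] Exi.prems(1,3)] by simp
    qed
  qed (simp_all add: eval_union)
  then show ?thesis using assms by (auto simp: elem_sub_def univ_union)
qed

end

section \<open>Skolem hulls in ultrapowers\<close>

text \<open>Skolem functions act coordinate by coordinate on functions into \<open>M\<close>, before
  anything is divided by an ultrafilter. A formula has finitely many free variables, so its
  parameters form a finite list, which keeps each of the countably many closure steps within the
  size of \<open>L\<close>.\<close>

lemma skolem_hull:
  fixes M :: "('f, 'p, 'a) struct" and X :: "('j \<Rightarrow> 'a) set"
  assumes ne: "universe M \<noteq> {}" and X: "\<And>y. y \<in> X \<Longrightarrow> range y \<subseteq> universe M"
    and inf: "infinite L" and fms: "|{\<phi>. fm_over V \<phi>}| \<le>o |L|" and cX: "|X| \<le>o |L|"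
  obtains Y where "X \<subseteq> Y" "|Y| \<le>o |L|" "\<And>y. y \<in> Y \<Longrightarrow> range y \<subseteq> universe M"
    "\<And>\<phi> x v. fm_over V \<phi> \<Longrightarrow> range v \<subseteq> Y \<Longrightarrow>
      \<exists>w\<in>Y. \<forall>t. (\<exists>a\<in>universe M. sat M ((\<lambda>n. v n t)(x := a)) \<phi>) \<longrightarrow> sat M ((\<lambda>n. v n t)(x := w t)) \<phi>"
proof -
  obtain m0 where m0: "m0 \<in> universe M" using ne by blast
  \<comment> \<open>Variables beyond the list read \<open>m0\<close>; likewise \<open>sk\<close>
    falls back on \<open>m0\<close> at coordinates without a witness, so its values always lie in
    \<open>M\<close>.\<close>
  define lv where "lv = (\<lambda>(l :: ('j \<Rightarrow> 'a) list) n. if n < length l then l ! n else (\<lambda>_. m0))"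
  define sk where "sk = (\<lambda>(\<phi> :: ('f, 'p) fm, x, l) t.
    if \<exists>a\<in>universe M. sat M ((\<lambda>n. lv l n t)(x := a)) \<phi>
    then SOME a. a \<in> universe M \<and> sat M ((\<lambda>n. lv l n t)(x := a)) \<phi> else m0)"
  define S where "S = (\<lambda>Z. Z \<union> sk ` ({\<phi>. fm_over V \<phi>} \<times> UNIV \<times> lists Z))"
  define Y where "Y = (\<Union>k. (S ^^ k) X)"
  have sk1: "sk (\<phi>, x, l) t \<in> universe M" for \<phi> x l t
    using m0 someI_ex[of "\<lambda>a. a \<in> universe M \<and> sat M ((\<lambda>n. lv l n t)(x := a)) \<phi>"]
    by (auto simp: sk_def)
  have sk2: "sat M ((\<lambda>n. lv l n t)(x := sk (\<phi>, x, l) t)) \<phi>"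
    if "\<exists>a\<in>universe M. sat M ((\<lambda>n. lv l n t)(x := a)) \<phi>" for \<phi> x l t
  proof -
    have "sk (\<phi>, x, l) t = (SOME a. a \<in> universe M \<and> sat M ((\<lambda>n. lv l n t)(x := a)) \<phi>)"
      using that by (simp add: sk_def)
    then show ?thesis
      using someI_ex[of "\<lambda>a. a \<in> universe M \<and> sat M ((\<lambda>n. lv l n t)(x := a)) \<phi>"] that by metis
  qed
  have natL: "|UNIV :: nat set| \<le>o |L|" using inf infinite_iff_card_of_nat by blast
  have ck: "|(S ^^ k) X| \<le>o |L|" for k
  proof (induction k)
    case (Suc k)
    let ?Z = "(S ^^ k) X"
    have "|(UNIV :: nat set) \<times> lists ?Z| \<le>o |L|"
      by (rule card_of_Sigma_ordLeq_infinite[OF inf natL]) (use card_of_lists_ordLeq[OF inf Suc] in simp)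
    then have "|{\<phi>. fm_over V \<phi>} \<times> (UNIV :: nat set) \<times> lists ?Z| \<le>o |L|"
      by (intro card_of_Sigma_ordLeq_infinite[OF inf fms]) simp
    then have "|sk ` ({\<phi>. fm_over V \<phi>} \<times> UNIV \<times> lists ?Z)| \<le>o |L|"
      using card_of_image ordLeq_transitive by blast
    then have "|?Z \<union> sk ` ({\<phi>. fm_over V \<phi>} \<times> UNIV \<times> lists ?Z)| \<le>o |L|"
      by (rule card_of_Un_ordLeq_infinite[OF inf Suc])
    then show ?case by (simp add: S_def)
  qed (use cX in simp)
  have mono: "(S ^^ k) X \<subseteq> (S ^^ k') X" if "k \<le> k'" for k k'
    by (rule lift_Suc_mono_le[OF _ that]) (auto simp: S_def)
  show ?thesis
  proof
    have "(S ^^ 0) X \<subseteq> Y" unfolding Y_def by blast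
    then show "X \<subseteq> Y" by simp
    show "|Y| \<le>o |L|" unfolding Y_def
      by (rule card_of_UNION_ordLeq_infinite[OF inf natL]) (use ck in simp)
    have "\<forall>y\<in>(S ^^ k) X. range y \<subseteq> universe M" for k
    proof (induction k)
      case (Suc k)
      show ?case
      proof
        fix y assume "y \<in> (S ^^ Suc k) X"
        then have "y \<in> (S ^^ k) X \<or> (\<exists>\<phi> x l. y = sk (\<phi>, x, l))" by (auto simp: S_def)
        then show "range y \<subseteq> universe M" using Suc sk1 by blast
      qed
    qed (use X in simp)
    then show "range y \<subseteq> universe M" if "y \<in> Y" for y using that by (auto simp: Y_def)
    fix \<phi> x and v :: "nat \<Rightarrow> 'j \<Rightarrow> 'a" assume \<phi>: "fm_over V \<phi>" and v: "range v \<subseteq> Y"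
    \<comment> \<open>The first \<open>m\<close> entries of \<open>v\<close> contain all parameters
      of \<open>\<phi>\<close>, and finitely many entries lie in a common stage of the
      closure.\<close>
    obtain m where m: "\<forall>n\<in>free_vars \<phi>. n < m"
      using finite_free_vars[of \<phi>] finite_nat_set_iff_bounded by blast
    define l where "l = map v [0..<m]"
    have "\<exists>k. set (map v [0..<m']) \<subseteq> (S ^^ k) X" for m'
    proof (induction m')
      case (Suc m')
      then obtain k where k: "set (map v [0..<m']) \<subseteq> (S ^^ k) X" by blast
      obtain k' where k': "v m' \<in> (S ^^ k') X" using v by (auto simp: Y_def)
      have "set (map v [0..<Suc m']) \<subseteq> (S ^^ max k k') X"
        using k k' mono[of k "max k k'"] mono[of k' "max k k'"] by auto
      then show ?case by blast
    qed simp
    then obtain k where "l \<in> lists ((S ^^ k) X)" unfolding l_def by blast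
    then have "sk (\<phi>, x, l) \<in> (S ^^ Suc k) X" using \<phi> by (auto simp: S_def)
    then have "sk (\<phi>, x, l) \<in> Y" unfolding Y_def by blast
    moreover have "sat M ((\<lambda>n. v n t)(x := a)) \<phi> \<longleftrightarrow> sat M ((\<lambda>n. lv l n t)(x := a)) \<phi>" for a t
      by (rule sat_cong) (use m in \<open>simp add: lv_def l_def\<close>)
    ultimately show "\<exists>w\<in>Y. \<forall>t. (\<exists>a\<in>universe M. sat M ((\<lambda>n. v n t)(x := a)) \<phi>) \<longrightarrow>
        sat M ((\<lambda>n. v n t)(x := w t)) \<phi>"
      using sk2 by (intro bexI[of _ "sk (\<phi>, x, l)"]) auto
  qed
qed

section \<open>Los's theorem for Skolem hulls\<close>

locale ultra_hull =
  fixes V :: "('f, 'p) vocab" and M :: "('f, 'p, 'a) struct" and U :: "'j set set"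
    and Y :: "('j \<Rightarrow> 'a) set" and B :: "'b set" and r :: "('j \<Rightarrow> 'a) \<Rightarrow> 'b" and sec :: "'b \<Rightarrow> 'j \<Rightarrow> 'a"
  assumes U: "ultra U" and st: "is_struct V M"
    and YM: "y \<in> Y \<Longrightarrow> range y \<subseteq> universe M"
    and skolem: "fm_over V \<phi> \<Longrightarrow> range v \<subseteq> Y \<Longrightarrow>
      \<exists>w\<in>Y. \<forall>t. (\<exists>a\<in>universe M. sat M ((\<lambda>n. v n t)(x := a)) \<phi>) \<longrightarrow> sat M ((\<lambda>n. v n t)(x := w t)) \<phi>"
    and r: "y \<in> Y \<Longrightarrow> r y \<in> B"
    and r_eq: "y \<in> Y \<Longrightarrow> y' \<in> Y \<Longrightarrow> r y = r y' \<longleftrightarrow> {t. y t = y' t} \<in> U"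
    and sec: "p \<in> B \<Longrightarrow> sec p \<in> Y" "p \<in> B \<Longrightarrow> r (sec p) = p"
    and Bne: "B \<noteq> {}"
begin

text \<open>No quotient is formed: \<open>r\<close> names the class of a function by an element of
  \<open>B\<close> and \<open>sec\<close> picks a representative, so that the universe can be a
  prescribed set.\<close>

definition N :: "('f, 'p, 'b) struct" where
  "N = \<lparr> universe = B,
     fint = (\<lambda>s. if s \<in> funs V then (\<lambda>xs. if xs \<in> tuples B (snd s)
                then r (\<lambda>t. fint M s (map (\<lambda>p. sec p t) xs)) else undefined) else (\<lambda>_. undefined)),
     rint = (\<lambda>s. if s \<in> rels V
                then {xs \<in> tuples B (snd s). {t. map (\<lambda>p. sec p t) xs \<in> rint M s} \<in> U} else {}) \<rparr>"

lemma sec_r: "y \<in> Y \<Longrightarrow> {t. sec (r y) t = y t} \<in> U"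
  using r_eq[of "sec (r y)" y] sec r by simp

lemma sec_univ: "p \<in> B \<Longrightarrow> sec p t \<in> universe M"
  using YM[OF sec(1)] by auto

text \<open>The Skolem property is applied to the formula that defines the value of
  \<open>f\<close>: the witness is unique at every coordinate, so the Skolem function is the
  pointwise value itself.\<close>

lemma fint_closed:
  assumes f: "(f, n) \<in> funs V" and xs: "xs \<in> tuples B n"
  shows "(\<lambda>t. fint M (f, n) (map (\<lambda>p. sec p t) xs)) \<in> Y"
proof -
  obtain p0 where p0: "p0 \<in> B" using Bne by blast
  define v where "v = (\<lambda>i. sec (if i < n then xs ! i else p0))"
  have len: "length xs = n" and sx: "set xs \<subseteq> B" using xs by (auto simp: tuples_def)
  have "range v \<subseteq> Y" using sx len p0 sec(1) unfolding v_def by (auto intro!: sec(1) simp: nth_mem subset_iff)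
  moreover have "fm_over V (Equal (Var n) (App f (map Var [0..<n])))" using f by auto
  ultimately obtain w where w: "w \<in> Y"
    "\<And>t. (\<exists>a\<in>universe M. sat M ((\<lambda>i. v i t)(n := a)) (Equal (Var n) (App f (map Var [0..<n])))) \<Longrightarrow>
      sat M ((\<lambda>i. v i t)(n := w t)) (Equal (Var n) (App f (map Var [0..<n])))"
    using skolem[of "Equal (Var n) (App f (map Var [0..<n]))" v n] by blast
  have ev: "map (eval_trm M ((\<lambda>i. v i t)(n := a))) (map Var [0..<n]) = map (\<lambda>p. sec p t) xs" for t a
    by (rule map_eval_vars) (use len in \<open>simp_all add: v_def\<close>)
  have "map (\<lambda>p. sec p t) xs \<in> tuples (universe M) n" for t
    using len sx sec_univ by (auto simp: tuples_def)
  then have "fint M (f, n) (map (\<lambda>p. sec p t) xs) \<in> universe M" for t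
    by (rule fint_in_universe[OF st f])
  then have "sat M ((\<lambda>i. v i t)(n := w t)) (Equal (Var n) (App f (map Var [0..<n])))" for t
    using ev[of t] by (intro w(2) bexI[of _ "fint M (f, n) (map (\<lambda>p. sec p t) xs)"]) (simp_all del: map_map map_eq_conv)
  then have "w t = fint M (f, n) (map (eval_trm M ((\<lambda>i. v i t)(n := w t))) (map Var [0..<n]))" for t
    by (simp del: map_map map_eq_conv)
  then have "w t = fint M (f, n) (map (\<lambda>p. sec p t) xs)" for t unfolding ev .
  then have "w = (\<lambda>t. fint M (f, n) (map (\<lambda>p. sec p t) xs))" by (rule ext)
  then show ?thesis using w(1) by simp
qed

lemma struct_N: "is_struct V N"
  unfolding is_struct_def
proof (intro conjI allI impI)
  fix f n assume "(f, n) \<in> funs V"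
  then show "fint N (f, n) \<in> tuples (universe N) n \<rightarrow>\<^sub>E universe N"
    by (auto simp: N_def intro!: r fint_closed)
qed (auto simp: N_def Bne)

lemma universe_N: "universe N = B" by (simp add: N_def)

lemma los_trm:
  assumes v: "range v \<subseteq> B"
  shows "trm_over V e \<Longrightarrow> {t. sec (eval_trm N v e) t = eval_trm M (\<lambda>n. sec (v n) t) e} \<in> U"
proof (induction e)
  case (Var x)
  then show ?case using ultra_UNIV[OF U] by simp
next
  case (App f ts)
  let ?ps = "map (eval_trm N v) ts" and ?n = "length ts"
  let ?g = "\<lambda>t. fint M (f, ?n) (map (\<lambda>p. sec p t) ?ps)"
  have f: "(f, ?n) \<in> funs V" using App.prems by simp
  have "range v \<subseteq> universe N" using v by (simp add: universe_N)
  then have ps: "?ps \<in> tuples B ?n"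
    using App.prems eval_trm_in_universe[OF struct_N, of v] by (auto simp: tuples_def universe_N)
  have "fint N (f, ?n) ?ps = r ?g" using f ps by (simp add: N_def)
  then have e: "eval_trm N v (App f ts) = r ?g" by (simp only: eval_trm.simps)
  have "{t. sec (r ?g) t = ?g t} \<in> U" by (rule sec_r[OF fint_closed[OF f ps]])
  moreover have "{t. \<forall>s\<in>set ts. sec (eval_trm N v s) t = eval_trm M (\<lambda>n. sec (v n) t) s} \<in> U"
    by (rule ultra_finite_all[OF U]) (use App in auto)
  ultimately have "{t. sec (r ?g) t = ?g t} \<inter>
    {t. \<forall>s\<in>set ts. sec (eval_trm N v s) t = eval_trm M (\<lambda>n. sec (v n) t) s} \<in> U"
    by (simp add: ultra_Int[OF U])
  then show ?case
  proof (rule ultra_mono[OF U], intro subsetI, elim IntE CollectE, intro CollectI)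
    fix t assume 1: "sec (r ?g) t = ?g t"
      and 2: "\<forall>s\<in>set ts. sec (eval_trm N v s) t = eval_trm M (\<lambda>n. sec (v n) t) s"
    have "map (\<lambda>p. sec p t) ?ps = map (eval_trm M (\<lambda>n. sec (v n) t)) ts" using 2 by simp
    then show "sec (eval_trm N v (App f ts)) t = eval_trm M (\<lambda>n. sec (v n) t) (App f ts)"
      unfolding e using 1 by (simp only: eval_trm.simps)
  qed
qed

text \<open>At the quantifier a function of \<open>Y\<close> gives witnesses at all coordinates
  where one exists; its class is a witness in \<open>N\<close>, because the chosen representative
  agrees with it almost everywhere.\<close>

lemma los_sec:
  shows "fm_over V \<phi> \<Longrightarrow> range v \<subseteq> B \<Longrightarrow> sat N v \<phi> \<longleftrightarrow> {t. sat M (\<lambda>n. sec (v n) t) \<phi>} \<in> U"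
proof (induction \<phi> arbitrary: v)
  case (Equal s e)
  have vN: "range v \<subseteq> universe N" using Equal.prems(2) by (simp add: universe_N)
  have "eval_trm N v s \<in> B" "eval_trm N v e \<in> B"
    using Equal.prems(1) eval_trm_in_universe[OF struct_N vN] by (auto simp: universe_N)
  then have "eval_trm N v s = eval_trm N v e \<longleftrightarrow> {t. sec (eval_trm N v s) t = sec (eval_trm N v e) t} \<in> U"
    using r_eq[of "sec (eval_trm N v s)" "sec (eval_trm N v e)"] sec by simp
  also have "\<dots> \<longleftrightarrow> {t. eval_trm M (\<lambda>n. sec (v n) t) s = eval_trm M (\<lambda>n. sec (v n) t) e} \<in> U"
  proof (rule ultra_ev_cong[OF U])
    show "{t. sec (eval_trm N v s) t = eval_trm M (\<lambda>n. sec (v n) t) s} \<inter>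
      {t. sec (eval_trm N v e) t = eval_trm M (\<lambda>n. sec (v n) t) e} \<in> U"
      using Equal.prems los_trm by (simp add: ultra_Int[OF U])
  qed simp
  finally show ?case by simp
next
  case (Rel q ts)
  let ?ps = "map (eval_trm N v) ts" and ?n = "length ts"
  have q: "(q, ?n) \<in> rels V" using Rel.prems by simp
  have vN: "range v \<subseteq> universe N" using Rel.prems(2) by (simp add: universe_N)
  have ps: "?ps \<in> tuples B ?n"
    using Rel.prems eval_trm_in_universe[OF struct_N vN] by (auto simp: tuples_def universe_N)
  have "sat N v (Rel q ts) \<longleftrightarrow> ?ps \<in> rint N (q, ?n)" by (simp only: sat.simps)
  also have "\<dots> \<longleftrightarrow> {t. map (\<lambda>p. sec p t) ?ps \<in> rint M (q, ?n)} \<in> U"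
    using q ps by (simp add: N_def)
  also have "\<dots> \<longleftrightarrow> {t. sat M (\<lambda>n. sec (v n) t) (Rel q ts)} \<in> U"
  proof (rule ultra_ev_cong[OF U])
    show "{t. \<forall>s\<in>set ts. sec (eval_trm N v s) t = eval_trm M (\<lambda>n. sec (v n) t) s} \<in> U"
      by (rule ultra_finite_all[OF U]) (use Rel los_trm in auto)
    fix t assume "t \<in> {t. \<forall>s\<in>set ts. sec (eval_trm N v s) t = eval_trm M (\<lambda>n. sec (v n) t) s}"
    then have "map (\<lambda>p. sec p t) ?ps = map (eval_trm M (\<lambda>n. sec (v n) t)) ts" by simp
    then show "t \<in> {t. map (\<lambda>p. sec p t) ?ps \<in> rint M (q, ?n)} \<longleftrightarrow>
        t \<in> {t. sat M (\<lambda>n. sec (v n) t) (Rel q ts)}"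
      by (simp only: sat.simps mem_Collect_eq)
  qed
  finally show ?case .
next
  case (Neg \<phi>)
  have "{t. sat M (\<lambda>n. sec (v n) t) (Neg \<phi>)} = - {t. sat M (\<lambda>n. sec (v n) t) \<phi>}" by auto
  then show ?case using Neg ultra_Compl[OF U] by simp
next
  case (Conj \<phi> \<psi>)
  have "{t. sat M (\<lambda>n. sec (v n) t) (Conj \<phi> \<psi>)} =
    {t. sat M (\<lambda>n. sec (v n) t) \<phi>} \<inter> {t. sat M (\<lambda>n. sec (v n) t) \<psi>}" by auto
  then show ?case using Conj ultra_Int[OF U] by simp
next
  case (Exi x \<phi>)
  have o: "fm_over V \<phi>" using Exi.prems(1) by simp
  have IH: "sat N (v(x := a)) \<phi> \<longleftrightarrow> {t. sat M ((\<lambda>n. sec (v n) t)(x := sec a t)) \<phi>} \<in> U" if "a \<in> B" for a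
  proof -
    have "(\<lambda>n. sec ((v(x := a)) n) t) = (\<lambda>n. sec (v n) t)(x := sec a t)" for t by auto
    then show ?thesis using Exi.IH[OF o range_upd[OF Exi.prems(2) that], of x] by (simp only:)
  qed
  show ?case
  proof
    assume "sat N v (Exi x \<phi>)"
    then obtain a where a: "a \<in> B" "sat N (v(x := a)) \<phi>" by (auto simp: universe_N)
    have "{t. sat M ((\<lambda>n. sec (v n) t)(x := sec a t)) \<phi>} \<in> U" using IH a by blast
    then show "{t. sat M (\<lambda>n. sec (v n) t) (Exi x \<phi>)} \<in> U"
      by (rule ultra_mono[OF U]) (use sec_univ[OF a(1)] in auto)
  next
    assume A: "{t. sat M (\<lambda>n. sec (v n) t) (Exi x \<phi>)} \<in> U"
    have "range (\<lambda>n. sec (v n)) \<subseteq> Y" using Exi.prems(2) sec(1) by auto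
    from skolem[OF o this, of x] obtain w where w: "w \<in> Y"
      "\<forall>t. (\<exists>a\<in>universe M. sat M ((\<lambda>n. sec (v n) t)(x := a)) \<phi>) \<longrightarrow> sat M ((\<lambda>n. sec (v n) t)(x := w t)) \<phi>"
      by blast
    have "{t. sat M (\<lambda>n. sec (v n) t) (Exi x \<phi>)} \<inter> {t. sec (r w) t = w t} \<in> U"
      using A sec_r[OF w(1)] ultra_Int[OF U] by blast
    then have "{t. sat M ((\<lambda>n. sec (v n) t)(x := sec (r w) t)) \<phi>} \<in> U"
      by (rule ultra_mono[OF U]) (use w(2) in auto)
    then have "sat N (v(x := r w)) \<phi>" using IH r[OF w(1)] by blast
    then show "sat N v (Exi x \<phi>)" using r[OF w(1)] by (auto simp: universe_N)
  qed
qed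

text \<open>Representatives may be replaced by arbitrary functions of \<open>Y\<close>, since the
  finitely many free variables change only outside a set of \<open>U\<close>.\<close>

lemma los:
  assumes \<phi>: "fm_over V \<phi>" and v: "range v \<subseteq> Y"
  shows "sat N (\<lambda>n. r (v n)) \<phi> \<longleftrightarrow> {t. sat M (\<lambda>n. v n t) \<phi>} \<in> U"
proof -
  have "sat N (\<lambda>n. r (v n)) \<phi> \<longleftrightarrow> {t. sat M (\<lambda>n. sec (r (v n)) t) \<phi>} \<in> U"
    by (rule los_sec[OF \<phi>]) (use v r in auto)
  also have "\<dots> \<longleftrightarrow> {t. sat M (\<lambda>n. v n t) \<phi>} \<in> U"
  proof (rule ultra_ev_cong[OF U])
    show "{t. \<forall>n\<in>free_vars \<phi>. sec (r (v n)) t = v n t} \<in> U"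
      by (rule ultra_finite_all[OF U finite_free_vars]) (use v sec_r in auto)
    fix t assume t: "t \<in> {t. \<forall>n\<in>free_vars \<phi>. sec (r (v n)) t = v n t}"
    have "sat M (\<lambda>n. sec (r (v n)) t) \<phi> = sat M (\<lambda>n. v n t) \<phi>" by (rule sat_cong) (use t in simp)
    then show "t \<in> {t. sat M (\<lambda>n. sec (r (v n)) t) \<phi>} \<longleftrightarrow> t \<in> {t. sat M (\<lambda>n. v n t) \<phi>}" by simp
  qed
  finally show ?thesis .
qed

end

text \<open>A class that contains a constant function is named by that constant, which makes
  \<open>M\<close> literally an elementary submodel. The other classes are matched with
  \<open>B - universe M\<close>; the functions \<open>w \<xi>\<close> provide enough of them for the
  two sets to be equinumerous.\<close>

lemma ultrapower_hull:
  fixes V :: "('f, 'p) vocab" and M :: "('f, 'p, 'a) struct" and U :: "'j set set"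
    and X :: "('j \<Rightarrow> 'a) set" and L :: "'l set"
  assumes U: "ultra U" and st: "is_struct V M" and XM: "\<And>y. y \<in> X \<Longrightarrow> range y \<subseteq> universe M"
    and inf: "infinite L" and fms: "|{\<phi>. fm_over V \<phi>}| \<le>o |L|"
    and cM: "|universe M| \<le>o |L|" and cX: "|X| \<le>o |L|"
    and MB: "universe M \<subseteq> B" and cB: "|B - universe M| =o |L|"
    and w: "\<And>\<xi>. \<xi> \<in> L \<Longrightarrow> w \<xi> \<in> X"
    and w_new: "\<And>\<xi> m. \<xi> \<in> L \<Longrightarrow> m \<in> universe M \<Longrightarrow> {t. w \<xi> t = m} \<notin> U"
    and w_neq: "\<And>\<xi> \<xi>'. \<xi> \<in> L \<Longrightarrow> \<xi>' \<in> L \<Longrightarrow> \<xi> \<noteq> \<xi>' \<Longrightarrow> {t. w \<xi> t = w \<xi>' t} \<notin> U"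
  obtains N and r :: "('j \<Rightarrow> 'a) \<Rightarrow> 'a" where "is_struct V N" "universe N = B" "elem_sub V M N"
    "\<And>m. m \<in> universe M \<Longrightarrow> r (\<lambda>_. m) = m" "\<And>y. y \<in> X \<Longrightarrow> r y \<in> B"
    "\<And>\<phi> v. fm_over V \<phi> \<Longrightarrow> range v \<subseteq> X \<union> (\<lambda>m _. m) ` universe M \<Longrightarrow>
      sat N (\<lambda>n. r (v n)) \<phi> \<longleftrightarrow> {t. sat M (\<lambda>n. v n t) \<phi>} \<in> U"
proof -
  let ?K = "(\<lambda>m _. m) ` universe M :: ('j \<Rightarrow> 'a) set"
  have "|?K| \<le>o |L|" using card_of_image cM ordLeq_transitive by blast
  then have cXK: "|X \<union> ?K| \<le>o |L|"
    by (rule card_of_Un_ordLeq_infinite[OF inf cX])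
  have XK: "range y \<subseteq> universe M" if "y \<in> X \<union> ?K" for y using XM that by auto
  obtain Y where Y: "X \<union> ?K \<subseteq> Y" "|Y| \<le>o |L|" "\<And>y. y \<in> Y \<Longrightarrow> range y \<subseteq> universe M"
    "\<And>\<phi> x v. fm_over V \<phi> \<Longrightarrow> range v \<subseteq> Y \<Longrightarrow>
      \<exists>w\<in>Y. \<forall>t. (\<exists>a\<in>universe M. sat M ((\<lambda>n. v n t)(x := a)) \<phi>) \<longrightarrow> sat M ((\<lambda>n. v n t)(x := w t)) \<phi>"
    by (rule skolem_hull[OF universe_nonempty[OF st] XK inf fms cXK]) auto
  define eqv where "eqv = (\<lambda>y y' :: 'j \<Rightarrow> 'a. {t. y t = y' t} \<in> U)"
  have eqv_refl: "eqv y y" for y using ultra_UNIV[OF U] by (simp add: eqv_def)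
  have eqv_sym: "eqv y y' \<Longrightarrow> eqv y' y" for y y' by (simp add: eqv_def eq_commute)
  have eqv_trans: "eqv y y'' " if "eqv y y'" "eqv y' y''" for y y' y''
  proof -
    have "{t. y t = y' t} \<inter> {t. y' t = y'' t} \<in> U" using that ultra_Int[OF U] by (simp add: eqv_def)
    then show ?thesis unfolding eqv_def by (rule ultra_mono[OF U]) auto
  qed
  define cls where "cls = (\<lambda>y. {y' \<in> Y. eqv y y'})"
  have cls_eq: "cls y = cls y' \<longleftrightarrow> eqv y y'" if "y \<in> Y" "y' \<in> Y" for y y'
  proof
    assume "cls y = cls y'"
    moreover have "y' \<in> cls y'" using that eqv_refl by (simp add: cls_def)
    ultimately have "y' \<in> cls y" by simp
    then show "eqv y y'" by (simp add: cls_def)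
  next
    assume "eqv y y'"
    then have "eqv y z \<longleftrightarrow> eqv y' z" for z using eqv_trans eqv_sym by metis
    then show "cls y = cls y'" by (simp add: cls_def)
  qed
  define old where "old = (\<lambda>y m. m \<in> universe M \<and> eqv y (\<lambda>_. m))"
  define Q where "Q = cls ` {y \<in> Y. \<nexists>m. old y m}"
  have KY: "(\<lambda>_. m) \<in> Y" if "m \<in> universe M" for m using Y(1) that by auto
  have const_eq: "m = m'" if "eqv (\<lambda>_. m) (\<lambda>_. m')" for m m'
    using that ultra_empty[OF U] by (cases "m = m'") (auto simp: eqv_def)
  have old_uniq: "m = m'" if "old y m" "old y m'" for y m m'
    using that const_eq eqv_trans eqv_sym unfolding old_def by metis
  have "|Q| \<le>o |{y \<in> Y. \<nexists>m. old y m}|" unfolding Q_def by (rule card_of_image)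
  also have "|{y \<in> Y. \<nexists>m. old y m}| \<le>o |Y|" by (rule card_of_mono1) auto
  finally have Q1: "|Q| \<le>o |L|" using Y(2) ordLeq_transitive by blast
  have wY: "w \<xi> \<in> Y" if "\<xi> \<in> L" for \<xi> using w[OF that] Y(1) by auto
  have Q2: "|L| \<le>o |Q|"
  proof (rule card_of_ordLeqI[of "\<lambda>\<xi>. cls (w \<xi>)"])
    show "inj_on (\<lambda>\<xi>. cls (w \<xi>)) L"
      using w_neq cls_eq wY unfolding inj_on_def eqv_def by metis
    show "cls (w \<xi>) \<in> Q" if "\<xi> \<in> L" for \<xi>
      using w_new[OF that] wY[OF that] by (auto simp: Q_def old_def eqv_def)
  qed
  have "|Q| =o |B - universe M|"
    using Q1 Q2 cB ordIso_iff_ordLeq ordIso_transitive ordIso_symmetric by metis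
  then obtain g where g: "bij_betw g Q (B - universe M)" using card_of_ordIso by blast
  define r where "r = (\<lambda>y. if \<exists>m. old y m then THE m. old y m else g (cls y))"
  have r_old: "r y = m" if "old y m" for y m
    using that old_uniq unfolding r_def by (auto intro!: the_equality)
  have r_new: "r y = g (cls y)" "cls y \<in> Q" "g (cls y) \<in> B - universe M"
    if "y \<in> Y" "\<nexists>m. old y m" for y
  proof -
    show Q: "cls y \<in> Q" using that by (auto simp: Q_def)
    show "g (cls y) \<in> B - universe M" using g Q by (auto simp: bij_betw_def)
    show "r y = g (cls y)" unfolding r_def using that(2) by (rule if_not_P)
  qed
  have rB: "r y \<in> B" if "y \<in> Y" for y
    using r_old[of y] r_new[OF that] MB by (cases "\<exists>m. old y m") (auto simp: old_def)
  have old_eqv: "old y' m" if "eqv y y'" "old y m" for y y' m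
    using that eqv_trans eqv_sym unfolding old_def by metis
  have r_eq: "r y = r y' \<longleftrightarrow> eqv y y'" if y: "y \<in> Y" "y' \<in> Y" for y y'
  proof (cases "\<exists>m. old y m")
    case True
    then obtain m where m: "old y m" by blast
    show ?thesis
    proof (cases "\<exists>m. old y' m")
      case True
      then obtain m' where m': "old y' m'" by blast
      have "m = m' \<longleftrightarrow> eqv y y'"
        using m m' old_eqv old_uniq eqv_trans eqv_sym unfolding old_def by metis
      then show ?thesis using r_old m m' by simp
    next
      case False
      then have "\<not> eqv y y'" using m old_eqv by blast
      moreover have "r y \<noteq> r y'" using r_old[OF m] r_new[OF y(2) False] m by (auto simp: old_def)
      ultimately show ?thesis by simp
    qed
  next
    case no: False
    show ?thesis
    proof (cases "\<exists>m. old y' m")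
      case True
      then obtain m' where m': "old y' m'" by blast
      then have "\<not> eqv y y'" using no old_eqv eqv_sym by blast
      moreover have "r y \<noteq> r y'" using r_old[OF m'] r_new[OF y(1) no] m' by (auto simp: old_def)
      ultimately show ?thesis by simp
    next
      case False
      have "inj_on g Q" using g by (simp add: bij_betw_def)
      then have "g (cls y) = g (cls y') \<longleftrightarrow> cls y = cls y'"
        using r_new(2)[OF y(1) no] r_new(2)[OF y(2) False] by (simp add: inj_on_eq_iff)
      then show ?thesis using r_new(1)[OF y(1) no] r_new(1)[OF y(2) False] cls_eq[OF y] by simp
    qed
  qed
  have const_old: "old (\<lambda>_. m) m" if "m \<in> universe M" for m using that eqv_refl by (simp add: old_def)
  have surj: "\<exists>y\<in>Y. r y = p" if "p \<in> B" for p
  proof (cases "p \<in> universe M")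
    case True
    then show ?thesis using r_old[OF const_old] KY by blast
  next
    case False
    then have "p \<in> g ` Q" using g \<open>p \<in> B\<close> by (simp add: bij_betw_def)
    then obtain q where "q \<in> Q" "g q = p" by blast
    then obtain y where "y \<in> Y" "\<nexists>m. old y m" "g (cls y) = p" by (auto simp: Q_def)
    then show ?thesis using r_new(1) by auto
  qed
  define sec where "sec = (\<lambda>p. SOME y. y \<in> Y \<and> r y = p)"
  have sec: "sec p \<in> Y \<and> r (sec p) = p" if "p \<in> B" for p
    unfolding sec_def using surj[OF that] someI_ex[of "\<lambda>y. y \<in> Y \<and> r y = p"] by blast
  interpret H: ultra_hull V M U Y B r sec
  proof
    show "r y = r y' \<longleftrightarrow> {t. y t = y' t} \<in> U" if "y \<in> Y" "y' \<in> Y" for y y'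
      using r_eq[OF that] by (simp add: eqv_def)
    show "B \<noteq> {}" using universe_nonempty[OF st] MB by blast
  qed (use U st Y(3,4) rB sec in simp_all)
  show ?thesis
  proof (rule that[of H.N r])
    show "is_struct V H.N" by (rule H.struct_N)
    show "universe H.N = B" by (rule H.universe_N)
    show rc: "r (\<lambda>_. m) = m" if "m \<in> universe M" for m by (rule r_old[OF const_old[OF that]])
    show "r y \<in> B" if "y \<in> X" for y using rB Y(1) that by auto
    show los: "sat H.N (\<lambda>n. r (v n)) \<phi> \<longleftrightarrow> {t. sat M (\<lambda>n. v n t) \<phi>} \<in> U"
      if "fm_over V \<phi>" "range v \<subseteq> X \<union> ?K" for \<phi> v
      by (rule H.los[OF that(1)]) (use that(2) Y(1) in blast)
    have "sat M v \<phi> \<longleftrightarrow> sat H.N v \<phi>" if "fm_over V \<phi>" "range v \<subseteq> universe M" for \<phi> v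
    proof -
      have v: "v n \<in> universe M" for n using that(2) by auto
      have "(\<lambda>n. r (\<lambda>_. v n)) = v" using rc v by auto
      moreover have "sat H.N (\<lambda>n. r (\<lambda>_. v n)) \<phi> \<longleftrightarrow> {t :: 'j. sat M (\<lambda>n. v n) \<phi>} \<in> U"
        by (rule los[OF that(1)]) (use v in auto)
      \<comment> \<open>For constant functions the formula holds at all coordinates or at none,
        which turns \<open>los\<close> into elementarity.\<close>
      ultimately show ?thesis using ultra_UNIV[OF U] ultra_empty[OF U] by (cases "sat M v \<phi>") auto
    qed
    then show "elem_sub V M H.N" using MB by (auto simp: elem_sub_def H.universe_N)
  qed
qed

section \<open>Ordinals and cardinals\<close>

locale ordinals =
  fixes lam theta kappa :: "'o::wellorder"
  assumes order_type: "{(a :: 'o, b). a \<le> b} =o cardSuc |{..<lam}|"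
    and inf_card: "infinite_cardinal lam" "infinite_cardinal theta" "infinite_cardinal kappa"
    and lam_theta: "|{..<lam}| =o |{..<lam}| ^c |{..<theta}|"
    and lam_kappa: "|{..<lam}| =o ctwo ^c |{..<kappa}|"
    and theta: "theta < lam" "theta = cf theta"
begin

lemma infinite_lam: "infinite {..<lam}" and infinite_kappa: "infinite {..<kappa}"
  using inf_card by (simp_all add: infinite_cardinal_def)

lemma card_initial: "|{..<b :: 'o}| \<le>o |{..<lam}|"
proof -
  let ?r = "{(a :: 'o, b). a \<le> b}"
  have r: "Card_order ?r"
    by (rule Card_order_ordIso[OF cardSuc_Card_order[OF card_of_Card_order] order_type])
  have "b \<in> Field ?r" by (auto simp: Field_def)
  from card_of_underS[OF r this] have "|{..<b}| <o ?r"
    by (simp add: underS_def less_le lessThan_def conj_commute)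
  then have "|{..<b}| <o cardSuc |{..<lam}|" using order_type ordLess_ordIso_trans by blast
  then show ?thesis using cardSuc_ordLeq_ordLess card_of_Card_order by blast
qed

lemma card_UNIV: "\<not> |UNIV :: 'o set| \<le>o |{..<lam}|"
proof
  let ?r = "{(a :: 'o, b). a \<le> b}"
  assume A: "|UNIV :: 'o set| \<le>o |{..<lam}|"
  have "Field ?r = UNIV" by (auto simp: Field_def)
  moreover have r: "Card_order ?r"
    by (rule Card_order_ordIso[OF cardSuc_Card_order[OF card_of_Card_order] order_type])
  ultimately have "|UNIV :: 'o set| =o ?r" using card_of_Field_ordIso by fastforce
  then have "|UNIV :: 'o set| =o cardSuc |{..<lam}|" using order_type ordIso_transitive by blast
  then have "cardSuc |{..<lam}| \<le>o |{..<lam}|"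
    using A ordIso_ordLeq_trans ordIso_symmetric by blast
  then show False using cardSuc_greater[OF card_of_Card_order] not_ordLess_ordLeq by blast
qed

lemma card_atMost: "|{..b :: 'o}| \<le>o |{..<lam}|"
proof -
  have "{..b} = {..<b} \<union> {b}" by auto
  moreover have "|{..<b} \<union> {b}| \<le>o |{..<lam}|"
    by (rule card_of_Un_ordLeq_infinite[OF infinite_lam card_initial card_of_singl_ordLeq])
      (use infinite_lam in auto)
  ultimately show ?thesis by simp
qed

text \<open>Regularity of \<lambda>^+: the closed initial segments at the points of an unbounded set
  of size at most \<lambda> would cover everything by \<lambda> sets of size at most
  \<lambda>.\<close>

lemma small_bounded:
  fixes S :: "'o set"
  assumes "|S| \<le>o |{..<lam}|"
  obtains b where "\<And>s. s \<in> S \<Longrightarrow> s < b"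
proof -
  have "\<exists>b. \<forall>s\<in>S. s < b"
  proof (rule ccontr)
    assume A: "\<not> ?thesis"
    have "UNIV = (\<Union>s\<in>S. {..s})" using A by (auto simp: not_less)
    moreover have "|\<Union>s\<in>S. {..s}| \<le>o |{..<lam}|"
      by (rule card_of_UNION_ordLeq_infinite[OF infinite_lam assms]) (use card_atMost in blast)
    ultimately show False using card_UNIV by simp
  qed
  then show ?thesis using that by blast
qed

text \<open>A bound for the values of a recursion at earlier arguments shows that the
  \<open>LEAST\<close> in \<open>oadd\<close> and \<open>omul\<close> ranges over a nonempty
  set.\<close>

lemma image_bounded:
  fixes b :: 'o and f :: "'o \<Rightarrow> 'o"
  obtains c where "\<forall>b'<b. f b' < c"
proof -
  have "|f ` {..<b}| \<le>o |{..<lam}|" using card_of_image card_initial ordLeq_transitive by blast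
  then obtain c where "\<And>s. s \<in> f ` {..<b} \<Longrightarrow> s < c" using small_bounded by blast
  then have "\<forall>b'<b. f b' < c" by simp
  then show ?thesis by (rule that)
qed

section \<open>Ordinal arithmetic\<close>

lemma ozero_le [simp]: "ozero \<le> (a :: 'o)"
  unfolding ozero_def by (rule Least_le) simp

lemma not_less_ozero [simp]: "\<not> (a :: 'o) < ozero"
  by (simp add: not_less)

lemma less_osuc [simp]: "(a :: 'o) < osuc a"
proof -
  obtain b where "a < b" using small_bounded[of "{a}"] card_of_singl_ordLeq[of "{..<lam}"] infinite_lam
    by (metis finite.emptyI insertI1)
  then show ?thesis unfolding osuc_def by (rule LeastI)
qed

lemma osuc_le: "(a :: 'o) < b \<Longrightarrow> osuc a \<le> b"
  unfolding osuc_def by (rule Least_le)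

lemma less_osuc_iff: "(b :: 'o) < osuc a \<longleftrightarrow> b \<le> a"
  by (metis leD leI less_osuc order_le_less_trans osuc_le)

lemma limit_osuc: "olimit (d :: 'o) \<Longrightarrow> a < d \<Longrightarrow> osuc a < d"
  unfolding olimit_def by (metis order_le_less_trans osuc_le)

lemma olimit_alt: "olimit (d :: 'o) \<longleftrightarrow> ozero < d \<and> (\<forall>a<d. osuc a < d)"
  unfolding olimit_def by (metis less_osuc order_le_less_trans osuc_le ozero_le)

lemma oadd_ex: "\<exists>c :: 'o. a \<le> c \<and> (\<forall>b'<b. oadd a b' < c)"
proof -
  obtain c where "\<forall>b'<b. oadd a b' < c" by (rule image_bounded)
  then have "\<forall>b'<b. oadd a b' < max a c" by (auto simp: less_max_iff_disj)
  then show ?thesis by (intro exI[of _ "max a c"]) simp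
qed

lemma oadd_ge: "(a :: 'o) \<le> oadd a b" and oadd_less: "b' < b \<Longrightarrow> oadd a b' < oadd a (b :: 'o)"
  using LeastI_ex[OF oadd_ex[of a b]] unfolding oadd.simps[of a b, symmetric] by auto

lemma oadd_least: "(a :: 'o) \<le> c \<Longrightarrow> (\<And>b'. b' < b \<Longrightarrow> oadd a b' < c) \<Longrightarrow> oadd a b \<le> c"
  by (subst oadd.simps, rule Least_le) simp

lemma oadd_ozero: "oadd (a :: 'o) ozero = a"
  by (rule antisym[OF oadd_least oadd_ge]) auto

lemma oadd_osuc: "oadd (a :: 'o) (osuc b) = osuc (oadd a b)"
proof (rule antisym)
  show "oadd a (osuc b) \<le> osuc (oadd a b)"
  proof (rule oadd_least)
    show "a \<le> osuc (oadd a b)" using oadd_ge less_osuc by (metis order_le_less_trans order_less_imp_le)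
    show "oadd a b' < osuc (oadd a b)" if "b' < osuc b" for b'
      using that oadd_less[of b' b a] by (auto simp: less_osuc_iff le_less)
  qed
qed (rule osuc_le[OF oadd_less[OF less_osuc]])

lemma omul_ge: "b' < b \<Longrightarrow> oadd (omul a b') a \<le> omul a (b :: 'o)"
proof -
  obtain c where "\<forall>b'<b. oadd (omul a b') a < c" by (rule image_bounded)
  then have "\<exists>c. \<forall>b'<b. oadd (omul a b') a \<le> c" by (meson less_imp_le)
  from LeastI_ex[OF this] show "b' < b \<Longrightarrow> oadd (omul a b') a \<le> omul a b"
    by (subst omul.simps[of a b]) simp
qed

lemma omul_least: "(\<And>b'. b' < b \<Longrightarrow> oadd (omul a b') a \<le> c) \<Longrightarrow> omul a (b :: 'o) \<le> c"
  by (subst omul.simps, rule Least_le) simp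

lemma omul_osuc: "omul a (osuc b) = oadd (omul a b) (a :: 'o)"
proof (rule antisym)
  show "omul a (osuc b) \<le> oadd (omul a b) a"
  proof (rule omul_least)
    fix b' assume "b' < osuc b"
    then have "b' = b \<or> b' < b" by (auto simp: less_osuc_iff)
    then show "oadd (omul a b') a \<le> oadd (omul a b) a"
      using omul_ge[of b' b a] oadd_ge[of "omul a b" a] by auto
  qed
qed (rule omul_ge[OF less_osuc])

lemma odouble_step: "g < g' \<Longrightarrow> osuc (osuc (odouble g)) \<le> odouble (g' :: 'o)"
  using omul_ge[of g g' "osuc (osuc ozero)"] by (simp add: odouble_def oadd_osuc oadd_ozero)

lemma odouble_less: "g < g' \<Longrightarrow> odouble g < odouble (g' :: 'o)"
  using odouble_step less_osuc by (metis order_less_le_trans order_less_trans)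

lemma odouble_ge: "(g :: 'o) \<le> odouble g"
proof (induction g rule: less_induct)
  case (less g)
  then show ?case using odouble_less by (metis leI order_less_irrefl order_le_less_trans)
qed

text \<open>This keeps the odd stages cofinal below every limit. The bound \<open>d\<close> is
  generalised because the limit case applies the induction hypothesis with \<open>g\<close> itself
  as bound and obtains \<open>odouble g \<le> g\<close>.\<close>

lemma odouble_limit: "olimit (d :: 'o) \<Longrightarrow> g < d \<Longrightarrow> odouble g < d"
proof (induction g arbitrary: d rule: less_induct)
  case (less g)
  have fin: "osuc (osuc (odouble g')) < d'" if "g' < g" "g' < d'" "olimit d'" for g' d'
    using less.IH[OF that(1) that(3) that(2)] limit_osuc that(3) by blast
  consider "olimit g" | "g = ozero" | g' where "g = osuc g'"
    unfolding olimit_alt by (metis leI le_neq_trans osuc_le ozero_le)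
  then show ?case
  proof cases
    case 1
    have "odouble g \<le> g"
      unfolding odouble_def
    proof (rule omul_least)
      fix g' assume "g' < g"
      then have "osuc (osuc (odouble g')) < g" using fin 1 by blast
      then show "oadd (omul (osuc (osuc ozero)) g') (osuc (osuc ozero)) \<le> g"
        by (simp add: odouble_def oadd_osuc oadd_ozero)
    qed
    then show ?thesis using less.prems by simp
  next
    case 2
    have "odouble g \<le> g" unfolding odouble_def by (rule omul_least) (simp add: 2)
    then show ?thesis using less.prems by simp
  next
    case 3
    then have "g' < g" by simp
    have "odouble g = osuc (osuc (odouble g'))"
      by (simp add: 3 odouble_def omul_osuc oadd_osuc oadd_ozero)
    then show ?thesis using fin[OF \<open>g' < g\<close> _ less.prems(1)] \<open>g' < g\<close> less.prems by simp
  qed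
qed

lemma infinite_cardinal_olimit:
  assumes "infinite_cardinal (c :: 'o)"
  shows "olimit c"
  unfolding olimit_alt
proof (intro conjI allI impI)
  have "{..<c} \<noteq> {}" using assms by (auto simp: infinite_cardinal_def)
  then show "ozero < c" using ozero_le by (metis lessThan_iff ex_in_conv order_le_less_trans)
  fix a assume a: "a < c"
  show "osuc a < c"
  proof (rule ccontr)
    assume "\<not> osuc a < c"
    then have "c = osuc a" using osuc_le[OF a] by simp
    then have e: "{..<c} = {..<a} \<union> {a}" by (auto simp: less_osuc_iff)
    then have inf: "infinite {..<a}" using assms by (simp add: infinite_cardinal_def)
    then have "{..<a} \<noteq> {}" by auto
    then have "|{..<a} \<union> {a}| \<le>o |{..<a}|"
      by (rule card_of_Un_ordLeq_infinite[OF inf card_of_mono1[OF order_refl] card_of_singl_ordLeq])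
    moreover have "|{..<a}| <o |{..<c}|" using assms a by (simp add: infinite_cardinal_def)
    ultimately show False using e not_ordLess_ordLeq by metis
  qed
qed

lemma lam_limit: "olimit lam" and theta_limit: "olimit theta"
  using inf_card infinite_cardinal_olimit by blast+

lemma lam_pos: "ozero < lam" using lam_limit by (simp add: olimit_alt)

lemma theta_pos: "ozero < theta" using theta_limit by (simp add: olimit_alt)

section \<open>Cofinality\<close>

lemma cf_cofinal:
  fixes d :: 'o
  shows "\<exists>f. (\<forall>i<cf d. f i < d) \<and> (\<forall>b<d. \<exists>i<cf d. b \<le> f i)"
  unfolding cf_def by (rule LeastI[of _ d], rule exI[of _ "\<lambda>i. i"]) auto

lemma cf_le: "(\<And>i. i < m \<Longrightarrow> f i < d) \<Longrightarrow> (\<And>b. b < d \<Longrightarrow> \<exists>i<m. b \<le> f i) \<Longrightarrow> cf d \<le> (m :: 'o)"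
  unfolding cf_def by (rule Least_le) blast

lemma cf_theta_limit:
  assumes "cf (d :: 'o) = theta"
  shows "olimit d"
  unfolding olimit_def
proof (intro conjI allI impI)
  show "\<exists>a. a < d"
  proof (rule ccontr)
    assume "\<nexists>a. a < d"
    then have "cf d \<le> ozero" by (intro cf_le[of _ "\<lambda>_. d"]) auto
    then show False using assms theta_pos by simp
  qed
  fix a assume a: "a < d"
  show "\<exists>b<d. a < b"
  proof (rule ccontr)
    assume "\<not> ?thesis"
    then have "cf d \<le> osuc ozero" using a by (intro cf_le[of _ "\<lambda>_. a"]) (auto simp: less_osuc_iff)
    then show False using assms theta_limit theta_pos by (auto simp: olimit_alt)
  qed
qed

text \<open>Supplies limits of cofinality \<theta> above any given \<open>b\<close>. A map cofinal
  in \<open>oadd b theta\<close> is pulled back to one cofinal in \<theta>, so regularity of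
  \<theta> bounds its length from below.\<close>

lemma cf_oadd_theta: "cf (oadd b theta) = theta"
proof (rule antisym)
  let ?d = "oadd b theta"
  have cof: "\<exists>i<theta. c \<le> oadd b i" if "c < ?d" for c
  proof (rule ccontr)
    assume A: "\<not> ?thesis"
    then have "b \<le> c" using theta_pos oadd_ozero by (metis leI less_imp_le)
    then have "?d \<le> c" using A by (intro oadd_least) auto
    then show False using that by simp
  qed
  then show "cf ?d \<le> theta" using oadd_less by (intro cf_le[of _ "oadd b"]) auto
  obtain f where f: "\<And>i. i < cf ?d \<Longrightarrow> f i < ?d" "\<And>c. c < ?d \<Longrightarrow> \<exists>i<cf ?d. c \<le> f i"
    using cf_cofinal[of ?d] by blast
  define g where "g = (\<lambda>i. LEAST \<epsilon>. f i \<le> oadd b \<epsilon>)"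
  have g: "g i < theta" "f i \<le> oadd b (g i)" if "i < cf ?d" for i
  proof -
    have "f i < ?d" by (rule f(1)[OF that])
    then obtain \<epsilon> where \<epsilon>: "\<epsilon> < theta" "f i \<le> oadd b \<epsilon>" using cof by blast
    show "g i < theta" using Least_le[of "\<lambda>\<epsilon>. f i \<le> oadd b \<epsilon>", OF \<epsilon>(2)] \<epsilon>(1) by (simp add: g_def)
    show "f i \<le> oadd b (g i)" unfolding g_def by (rule LeastI[of _ \<epsilon>]) (rule \<epsilon>(2))
  qed
  have "cf theta \<le> cf ?d"
  proof (rule cf_le[of _ g])
    fix \<epsilon> assume "\<epsilon> < theta"
    then obtain i where i: "i < cf ?d" "oadd b \<epsilon> \<le> f i" using f(2) oadd_less by blast
    then have "oadd b \<epsilon> \<le> oadd b (g i)" using g(2) by fastforce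
    then have "\<epsilon> \<le> g i" using oadd_less[of "g i" \<epsilon> b] by (meson leD leI)
    then show "\<exists>i<cf ?d. \<epsilon> \<le> g i" using i by blast
  qed (use g in blast)
  then show "theta \<le> cf ?d" using theta(2) by simp
qed

text \<open>Koenig's theorem in disguise: \<open>\<lambda>\<^sup>\<theta> = \<lambda>\<close> forces the cofinality of \<open>\<lambda>\<close> above \<open>\<theta>\<close>.\<close>

lemma not_cofinal_theta:
  assumes q: "\<And>\<epsilon>. \<epsilon> \<in> E \<Longrightarrow> \<epsilon> < theta \<and> q \<epsilon> < lam"
    and cof: "\<And>z. z < lam \<Longrightarrow> \<exists>\<epsilon>\<in>E. z \<le> q \<epsilon>"
  shows False
proof -
  have "|{..<lam}| =o |Func {..<theta} {..<lam}|"
    using lam_theta by (simp add: cexp_def Field_card_of)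
  \<comment> \<open>\<open>S\<close> lists all functions from \<theta> to \<lambda> in type
    \<lambda>. A diagonal function takes at \<open>\<epsilon>\<close> a value missed by
    \<open>S j \<epsilon>\<close> for all \<open>j \<le> q \<epsilon>\<close>; these are fewer than
    \<lambda> values because \<lambda> is a cardinal.\<close>
  then obtain S where S: "bij_betw S {..<lam} (Func {..<theta} {..<lam})"
    using card_of_ordIso by blast
  have "\<exists>w<lam. \<forall>j\<le>q \<epsilon>. S j \<epsilon> \<noteq> w" if "\<epsilon> \<in> E" for \<epsilon>
  proof (rule ccontr)
    assume "\<not> ?thesis"
    then have "{..<lam} \<subseteq> (\<lambda>j. S j \<epsilon>) ` {..<osuc (q \<epsilon>)}" by (fastforce simp: less_osuc_iff)
    then have "|{..<lam}| \<le>o |{..<osuc (q \<epsilon>)}|" by (rule surj_imp_ordLeq)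
    moreover have "osuc (q \<epsilon>) < lam" using q[OF that] limit_osuc[OF lam_limit] by blast
    ultimately show False using inf_card(1) not_ordLess_ordLeq unfolding infinite_cardinal_def by blast
  qed
  then obtain s where s: "\<And>\<epsilon>. \<epsilon> \<in> E \<Longrightarrow> s \<epsilon> < lam" "\<And>\<epsilon> j. \<epsilon> \<in> E \<Longrightarrow> j \<le> q \<epsilon> \<Longrightarrow> S j \<epsilon> \<noteq> s \<epsilon>"
    by metis
  \<comment> \<open>At arguments of \<theta> outside \<open>E\<close> any value below \<lambda> will
    do; outside \<theta> elements of \<open>Func\<close> are \<open>undefined\<close>.\<close>
  define s' where "s' = (\<lambda>\<epsilon>. if \<epsilon> < theta then (if \<epsilon> \<in> E then s \<epsilon> else ozero) else undefined)"
  have "s' \<in> Func {..<theta} {..<lam}" using s(1) lam_pos by (auto simp: Func_def s'_def)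
  then obtain j where j: "j < lam" "S j = s'" using S by (metis bij_betw_iff_bijections lessThan_iff)
  obtain \<epsilon> where "\<epsilon> \<in> E" "j \<le> q \<epsilon>" using cof[OF j(1)] by blast
  then show False using s(2)[of \<epsilon> j] j(2) q[of \<epsilon>] by (simp add: s'_def)
qed

section \<open>Combinatorial families and the coding ultrafilter\<close>

lemma subsets_coding: obtains Vv where "bij_betw Vv {..<lam} (Pow {..<kappa})"
proof -
  have "|Pow {..<kappa}| =o |{..<lam}|"
  proof -
    have "|Pow {..<kappa}| =o |Func {..<kappa} (UNIV :: bool set)|" by (rule card_of_Pow_Func)
    then have "|Pow {..<kappa}| =o ctwo ^c |{..<kappa}|" by (simp add: cexp_def ctwo_def Field_card_of)
    then show ?thesis using lam_kappa ordIso_symmetric ordIso_transitive by blast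
  qed
  then show ?thesis using that ordIso_symmetric card_of_ordIso by blast
qed

text \<open>Hausdorff's independent family, indexed by pairs of a finite subset \<open>s\<close> of \<open>\<kappa>\<close> and a finite
  set of subsets of \<open>s\<close>.\<close>

lemma independent_family:
  obtains u :: "'o \<Rightarrow> 'o set" where "\<And>z. u z \<subseteq> {..<kappa}"
    "\<And>Z W. finite Z \<Longrightarrow> Z \<subseteq> {..<lam} \<Longrightarrow> \<exists>i<kappa. \<forall>z\<in>Z. i \<in> u z \<longleftrightarrow> z \<in> W"
proof -
  obtain Vv where Vv: "bij_betw Vv {..<lam} (Pow {..<kappa})" by (rule subsets_coding)
  then have Vinj: "inj_on Vv {..<lam}" and Vsub: "\<And>z. z < lam \<Longrightarrow> Vv z \<subseteq> {..<kappa}"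
    by (auto simp: bij_betw_def)
  let ?I = "lists {..<kappa} \<times> lists (lists {..<kappa})"
  have l: "|lists {..<kappa}| \<le>o |{..<kappa}|"
    by (rule card_of_lists_ordLeq[OF infinite_kappa card_of_mono1]) simp
  then have "|lists (lists {..<kappa})| \<le>o |{..<kappa}|"
    by (rule card_of_lists_ordLeq[OF infinite_kappa])
  then have "|?I| \<le>o |{..<kappa}|"
    by (intro card_of_Sigma_ordLeq_infinite[OF infinite_kappa l]) simp
  then obtain g where g: "inj_on g ?I" "g ` ?I \<subseteq> {..<kappa}" unfolding card_of_ordLeq[symmetric] by metis
  \<comment> \<open>An index \<open>(s, A)\<close> belongs to \<open>u z\<close> when the trace of
    \<open>Vv z\<close> on \<open>s\<close> is one of the sets listed in \<open>A\<close>; lists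
    stand for finite sets, and \<open>g\<close> moves the indices into \<kappa>.\<close>
  define u where "u = (\<lambda>z. g ` {(s, A) \<in> ?I. Vv z \<inter> set s \<in> set ` set A})"
  show ?thesis
  proof
    show "u z \<subseteq> {..<kappa}" for z using g(2) unfolding u_def by blast
    fix Z W :: "'o set" assume Z: "finite Z" "Z \<subseteq> {..<lam}"
    have "\<exists>i\<in>{..<kappa}. i \<in> Vv z \<longleftrightarrow> i \<notin> Vv z'" if "z \<in> Z" "z' \<in> Z" "z \<noteq> z'" for z z'
    proof -
      have "Vv z \<noteq> Vv z'" using inj_onD[of Vv "{..<lam}" z z'] Vinj Z(2) that by auto
      moreover have "Vv z \<subseteq> {..<kappa}" "Vv z' \<subseteq> {..<kappa}"
        using Vsub Z(2) that by auto
      ultimately show ?thesis by blast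
    qed
    then have ex: "\<exists>i. i < kappa \<and> (i \<in> Vv z \<longleftrightarrow> i \<notin> Vv z')" if "z \<in> Z" "z' \<in> Z" "z \<noteq> z'" for z z'
      using that by auto
    define i where "i = (\<lambda>z z'. SOME i. i < kappa \<and> (i \<in> Vv z \<longleftrightarrow> i \<notin> Vv z'))"
    have i: "i z z' < kappa \<and> (i z z' \<in> Vv z \<longleftrightarrow> i z z' \<notin> Vv z')"
      if "z \<in> Z" "z' \<in> Z" "z \<noteq> z'" for z z'
      unfolding i_def by (rule someI_ex[OF ex[OF that]])
    have i1: "i z z' < kappa" if "z \<in> Z" "z' \<in> Z" "z \<noteq> z'" for z z' using i[OF that] ..
    \<comment> \<open>\<open>S\<close> separates any two of the subsets \<open>Vv z\<close> with
      \<open>z \<in> Z\<close>, so their traces on \<open>s\<close> are pairwise different and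
      \<open>A\<close> can select those with \<open>z \<in> W\<close>.\<close>
    define S where "S = (\<lambda>p. i (fst p) (snd p)) ` {p \<in> Z \<times> Z. fst p \<noteq> snd p}"
    have "finite S" unfolding S_def using Z(1) by (intro finite_imageI finite_subset[OF Collect_subset]) simp
    then obtain s where s: "set s = S" using finite_list by blast
    have iS: "i z z' \<in> S" if "z \<in> Z" "z' \<in> Z" "z \<noteq> z'" for z z'
    proof -
      have "(z, z') \<in> {p \<in> Z \<times> Z. fst p \<noteq> snd p}" using that by simp
      from imageI[OF this, of "\<lambda>p. i (fst p) (snd p)"] show ?thesis by (simp only: S_def fst_conv snd_conv)
    qed
    have "k < kappa" if k: "k \<in> S" for k
    proof -
      obtain p where "p \<in> {p \<in> Z \<times> Z. fst p \<noteq> snd p}" "k = i (fst p) (snd p)"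
        using k unfolding S_def by (rule imageE)
      then show ?thesis using i1[of "fst p" "snd p"] by (simp add: mem_Times_iff)
    qed
    then have ss: "s \<in> lists {..<kappa}" using s by auto
    define ll where "ll = (\<lambda>z. SOME l. set l = Vv z \<inter> set s)"
    have ll: "set (ll z) = Vv z \<inter> set s" for z
      unfolding ll_def by (rule someI_ex, rule finite_list) simp
    have "finite (Z \<inter> W)" using Z(1) by simp
    then obtain ws where ws: "set ws = Z \<inter> W" using finite_list[of "Z \<inter> W"] by auto
    define A where "A = map ll ws"
    have A: "A \<in> lists (lists {..<kappa})" using ll ss by (auto simp: A_def)
    have sep: "z = z'" if "z \<in> Z" "z' \<in> Z" "Vv z \<inter> set s = Vv z' \<inter> set s" for z z'
    proof (rule ccontr)
      assume "z \<noteq> z'"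
      then have "i z z' \<in> set s" "i z z' \<in> Vv z \<longleftrightarrow> i z z' \<notin> Vv z'"
        using i[OF that(1,2)] iS[OF that(1,2)] s by blast+
      then show False using that(3) by blast
    qed
    have "g (s, A) \<in> u z \<longleftrightarrow> z \<in> W" if "z \<in> Z" for z
    proof -
      have "g (s, A) \<in> u z \<longleftrightarrow> (s, A) \<in> {(s, A) \<in> ?I. Vv z \<inter> set s \<in> set ` set A}"
        unfolding u_def by (rule inj_on_image_mem_iff[OF g(1)]) (use ss A in auto)
      also have "\<dots> \<longleftrightarrow> Vv z \<inter> set s \<in> set ` set A" using ss A by auto
      also have "\<dots> \<longleftrightarrow> (\<exists>z'\<in>Z \<inter> W. Vv z \<inter> set s = Vv z' \<inter> set s)"
      proof -
        have "set ` set A = (\<lambda>z. Vv z \<inter> set s) ` (Z \<inter> W)" by (simp add: A_def ws ll image_image)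
        then show ?thesis by auto
      qed
      also have "\<dots> \<longleftrightarrow> z \<in> W" using sep that by auto
      finally show ?thesis .
    qed
    moreover have "g (s, A) < kappa" using g(2) ss A by auto
    ultimately show "\<exists>i<kappa. \<forall>z\<in>Z. i \<in> u z \<longleftrightarrow> z \<in> W" by blast
  qed
qed

text \<open>Recursion on \<open>b\<close>. The injection \<open>q b\<close> numbers the predecessors
  of \<open>b\<close> by ordinals below \<lambda>, and the value at \<open>z\<close> avoids those of
  the predecessors with number below \<open>z\<close>, which are fewer than \<lambda>. So agreement
  with a predecessor stops at its number.\<close>

lemma eventually_different:
  obtains G q :: "'o \<Rightarrow> 'o \<Rightarrow> 'o" where "\<And>b z. z < lam \<Longrightarrow> G b z < lam"
    "\<And>b b'. b' < b \<Longrightarrow> q b b' < lam"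
    "\<And>b b' z. b' < b \<Longrightarrow> z < lam \<Longrightarrow> G b z = G b' z \<Longrightarrow> z \<le> q b b'"
proof -
  define q where "q = (\<lambda>b :: 'o. SOME i :: 'o \<Rightarrow> 'o. inj_on i {..<b} \<and> i ` {..<b} \<subseteq> {..<lam})"
  have "inj_on (q b) {..<b} \<and> q b ` {..<b} \<subseteq> {..<lam}" for b
  proof -
    have "\<exists>i :: 'o \<Rightarrow> 'o. inj_on i {..<b} \<and> i ` {..<b} \<subseteq> {..<lam}"
      unfolding card_of_ordLeq by (rule card_initial)
    then show ?thesis unfolding q_def by (rule someI_ex)
  qed
  then have q: "inj_on (q b) {..<b}" "q b ` {..<b} \<subseteq> {..<lam}" for b by simp_all
  define P where "P = (\<lambda>(f :: 'o \<Rightarrow> 'o \<Rightarrow> 'o) b r. \<forall>z<lam. r z < lam \<and> (\<forall>b'<b. q b b' < z \<longrightarrow> r z \<noteq> f b' z))"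
  have "\<exists>G. \<forall>b. P G b (G b)"
  proof (rule dependent_wf_choice[of "{(x, y). x < y}"])
    show "wf {(x :: 'o, y). x < y}" by (rule wf)
    show "P f x r = P g x r" if "\<And>z. (z, x) \<in> {(x, y). x < y} \<Longrightarrow> f z = g z" for f g x r
      using that by (simp add: P_def)
    show "\<exists>r. P f b r" for b f
    proof -
      have "\<exists>w<lam. \<forall>b'<b. q b b' < z \<longrightarrow> w \<noteq> f b' z" if z: "z < lam" for z
      proof (rule ccontr)
        assume A: "\<not> ?thesis"
        have "{..<lam} \<subseteq> (\<lambda>y. f (inv_into {..<b} (q b) y) z) ` {..<z}"
        proof
          fix w assume "w \<in> {..<lam}"
          then obtain b' where b': "b' < b" "q b b' < z" "w = f b' z" using A by fastforce
          have "inv_into {..<b} (q b) (q b b') = b'" using q(1) b'(1) by (simp add: inv_into_f_f)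
          then show "w \<in> (\<lambda>y. f (inv_into {..<b} (q b) y) z) ` {..<z}"
            using b'(2,3) by (intro image_eqI[of _ _ "q b b'"]) simp_all
        qed
        then have "|{..<lam}| \<le>o |{..<z}|" by (rule surj_imp_ordLeq)
        then show False using inf_card(1) z not_ordLess_ordLeq unfolding infinite_cardinal_def by blast
      qed
      then have "\<forall>z. \<exists>w. z < lam \<longrightarrow> w < lam \<and> (\<forall>b'<b. q b b' < z \<longrightarrow> w \<noteq> f b' z)" by blast
      from choice[OF this] show ?thesis unfolding P_def by simp
    qed
  qed
  then obtain G where "\<forall>b. P G b (G b)" ..
  then have G: "P G b (G b)" for b ..
  show ?thesis
  proof
    show "G b z < lam" if "z < lam" for b z using G[of b] that by (simp add: P_def)
    show "q b b' < lam" if "b' < b" for b b' using q(2)[of b] that by auto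
    show "z \<le> q b b'" if "b' < b" "z < lam" "G b z = G b' z" for b b' z
    proof (rule ccontr)
      assume "\<not> z \<le> q b b'"
      then have "G b z \<noteq> G b' z" using G[of b] that(1,2) unfolding P_def by (simp add: not_le)
      then show False using that(3) by simp
    qed
  qed
qed

text \<open>A code in (3) is one sequence of \<kappa> elements but has to hold two sequences of
  \<kappa> tuples; the arguments are the choice between the two, the index of a tuple and a position
  in it.\<close>

lemma pair_coding:
  obtains pr :: "bool \<Rightarrow> 'o \<Rightarrow> nat \<Rightarrow> 'o" where "\<And>b k l. k < kappa \<Longrightarrow> pr b k l < kappa"
    "\<And>b k l b' k' l'. k < kappa \<Longrightarrow> k' < kappa \<Longrightarrow> pr b k l = pr b' k' l' \<Longrightarrow> b = b' \<and> k = k' \<and> l = l'"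
proof -
  have n: "|UNIV :: nat set| \<le>o |{..<kappa}|" using infinite_kappa infinite_iff_card_of_nat by blast
  have "|UNIV :: bool set| \<le>o |UNIV :: nat set|"
    by (rule card_of_ordLeqI[of of_bool]) (simp_all add: inj_on_def)
  then have b: "|UNIV :: bool set| \<le>o |{..<kappa}|" using n by (rule ordLeq_transitive)
  have "|{..<kappa} \<times> (UNIV :: nat set)| \<le>o |{..<kappa}|"
    by (rule card_of_Sigma_ordLeq_infinite[OF infinite_kappa card_of_mono1]) (use n in auto)
  then have "|(UNIV :: bool set) \<times> {..<kappa} \<times> (UNIV :: nat set)| \<le>o |{..<kappa}|"
    by (intro card_of_Sigma_ordLeq_infinite[OF infinite_kappa b]) simp
  then have "\<exists>g. inj_on g ((UNIV :: bool set) \<times> {..<kappa} \<times> (UNIV :: nat set)) \<and>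
      g ` ((UNIV :: bool set) \<times> {..<kappa} \<times> (UNIV :: nat set)) \<subseteq> {..<kappa}"
    unfolding card_of_ordLeq .
  then obtain g where g: "inj_on g ((UNIV :: bool set) \<times> {..<kappa} \<times> (UNIV :: nat set))"
    "g ` ((UNIV :: bool set) \<times> {..<kappa} \<times> (UNIV :: nat set)) \<subseteq> {..<kappa}"
    by (elim exE conjE)
  show ?thesis
  proof (rule that[of "\<lambda>b k l. g (b, k, l)"])
    show "g (b, k, l) < kappa" if "k < kappa" for b k l using subsetD[OF g(2) imageI, of "(b, k, l)"] that by simp
    show "b = b' \<and> k = k' \<and> l = l'" if "k < kappa" "k' < kappa" "g (b, k, l) = g (b', k', l')"
      for b k l b' k' l'
      using inj_onD[OF g(1) that(3)] that by auto
  qed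
qed

text \<open>Finitely many requirements mention finitely many \<open>z\<close>. By independence each
  coordinate \<open>j k\<close> can be put into exactly the prescribed sets \<open>u z\<close> among
  these, separately for every \<open>k\<close>, and \<open>s\<close> can be the finite set of the
  \<open>\<xi>\<close> that occur. So the finite intersection property holds.\<close>

lemma coding_ultrafilter:
  fixes u v :: "'o \<Rightarrow> 'o set"
  assumes u: "\<And>Z W. finite Z \<Longrightarrow> Z \<subseteq> {..<lam} \<Longrightarrow> \<exists>i<kappa. \<forall>z\<in>Z. i \<in> u z \<longleftrightarrow> z \<in> W"
  obtains U :: "(('o \<Rightarrow> 'o) \<times> 'o set) set set" where "ultra U"
    "\<And>k. k < kappa \<Longrightarrow> {(j, s). j k < kappa} \<in> U"
    "\<And>k z. k < kappa \<Longrightarrow> z < lam \<Longrightarrow> {(j, s). j k \<in> u z} \<in> U \<longleftrightarrow> k \<in> v z"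
    "\<And>\<xi>. {(j, s). finite s \<and> \<xi> \<in> s} \<in> U"
proof -
  define C where "C = (\<lambda>(k, z). {(j, s :: 'o set). j k < kappa \<and> (j k \<in> u z \<longleftrightarrow> k \<in> v z)})"
  define D where "D = (\<lambda>\<xi>. {(j :: 'o \<Rightarrow> 'o, s :: 'o set). finite s \<and> \<xi> \<in> s})"
  have "\<exists>U. ultra U \<and> C ` ({..<kappa} \<times> {..<lam}) \<union> range D \<subseteq> U"
  proof (rule ultra_extends)
    fix F assume F: "finite F" "F \<subseteq> C ` ({..<kappa} \<times> {..<lam}) \<union> range D"
    have "finite (F \<inter> C ` ({..<kappa} \<times> {..<lam}))" "finite (F \<inter> range D)" using F(1) by auto
    then obtain KZ Xi where KZ: "KZ \<subseteq> {..<kappa} \<times> {..<lam}" "finite KZ"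
      "F \<inter> C ` ({..<kappa} \<times> {..<lam}) = C ` KZ"
      and Xi: "finite Xi" "F \<inter> range D = D ` Xi"
      using finite_subset_image[OF _ Int_lower2] by metis
    have "finite (snd ` KZ)" "snd ` KZ \<subseteq> {..<lam}" using KZ by auto
    from u[OF this] have "\<forall>k. \<exists>i<kappa. \<forall>z\<in>snd ` KZ. i \<in> u z \<longleftrightarrow> z \<in> {z. k \<in> v z}" by blast
    then obtain j where j: "\<And>k. j k < kappa" "\<And>k z. z \<in> snd ` KZ \<Longrightarrow> j k \<in> u z \<longleftrightarrow> k \<in> v z"
      by (metis mem_Collect_eq)
    have "(j, Xi) \<in> A" if "A \<in> F" for A
    proof -
      have "A \<in> F \<inter> C ` ({..<kappa} \<times> {..<lam}) \<or> A \<in> F \<inter> range D" using that F(2) by auto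
      then have "A \<in> C ` KZ \<or> A \<in> D ` Xi" unfolding KZ(3) Xi(2) .
      then show ?thesis
      proof
        assume "A \<in> C ` KZ"
        then obtain k z where "(k, z) \<in> KZ" "A = C (k, z)" by auto
        moreover have "z \<in> snd ` KZ" using \<open>(k, z) \<in> KZ\<close> by (rule image_eqI[rotated]) simp
        ultimately show ?thesis using j(1)[of k] j(2)[of z k] by (simp add: C_def)
      qed (use Xi(1) in \<open>auto simp: D_def\<close>)
    qed
    then show "\<Inter>F \<noteq> {}" by blast
  qed
  then obtain U where U: "ultra U" and CU: "\<And>k z. k < kappa \<Longrightarrow> z < lam \<Longrightarrow> C (k, z) \<in> U" and DU: "\<And>\<xi>. D \<xi> \<in> U"
    by (auto simp: image_subset_iff)
  show ?thesis
  proof (rule that[OF U])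
    show "{(j, s). j k < kappa} \<in> U" if "k < kappa" for k
      by (rule ultra_mono[OF U CU[OF that lam_pos]]) (auto simp: C_def)
    show "{(j, s). j k \<in> u z} \<in> U \<longleftrightarrow> k \<in> v z" if "k < kappa" "z < lam" for k z
    proof -
      have "{(j, s). j k \<in> u z} \<in> U \<longleftrightarrow> {t :: ('o \<Rightarrow> 'o) \<times> 'o set. k \<in> v z} \<in> U"
        by (rule ultra_ev_cong[OF U CU[OF that]]) (auto simp: C_def)
      then show ?thesis using ultra_UNIV[OF U] ultra_empty[OF U] by (cases "k \<in> v z") simp_all
    qed
    show "{(j, s). finite s \<and> \<xi> \<in> s} \<in> U" for \<xi> using DU[of \<xi>] by (simp add: D_def)
  qed
qed

end

section \<open>Good sequences of parameters\<close>

lemma tuples_nth: "a \<in> tuples A n \<Longrightarrow> l < n \<Longrightarrow> a ! l \<in> A"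
  using nth_mem by (fastforce simp: tuples_def)

text \<open>\<open>assign\<close> is unspecified outside \<open>x # ys\<close>, while elementarity,
  isomorphisms and Los's theorem concern valuations with range in the universe. Here all other
  variables get the value \<open>b\<close>.\<close>

definition val :: "nat \<Rightarrow> nat list \<Rightarrow> 'a \<Rightarrow> 'a list \<Rightarrow> nat \<Rightarrow> 'a" where
  "val x ys b a = (\<lambda>i. if i \<in> set (x # ys) then assign (x # ys) (b # a) i else b)"

lemma val_simps:
  assumes "distinct (x # ys)" "length a = length ys"
  shows "val x ys b a x = b" "l < length ys \<Longrightarrow> val x ys b a (ys ! l) = a ! l"
    "i \<notin> set (x # ys) \<Longrightarrow> val x ys b a i = b"
  using assms by (auto simp: val_def assign_def map_of_zip_nth)

text \<open>\<open>g\<close> will be an isomorphism, the naming map \<open>r\<close> of the hull, or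
  evaluation at a coordinate.\<close>

lemma val_map:
  assumes "distinct (x # ys)" "length a = length ys"
  shows "g (val x ys b a i) = val x ys (g b) (map g a) i"
proof -
  consider "i = x" | l where "l < length ys" "i = ys ! l" | "i \<notin> set (x # ys)"
    by (auto simp: in_set_conv_nth)
  then show ?thesis using assms by cases (simp_all add: val_simps)
qed

lemma val_range:
  assumes "distinct (x # ys)" "length a = length ys" "b \<in> A" "set a \<subseteq> A"
  shows "range (val x ys b a) \<subseteq> A"
proof
  fix p assume "p \<in> range (val x ys b a)"
  then obtain i where p: "p = val x ys b a i" by blast
  consider "i = x" | l where "l < length ys" "i = ys ! l" | "i \<notin> set (x # ys)"
    by (auto simp: in_set_conv_nth)
  then show "p \<in> A" using assms nth_mem[of _ a] by cases (auto simp: p val_simps)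
qed

lemma sat_assign_val:
  "free_vars \<phi> \<subseteq> set (x # ys) \<Longrightarrow> sat M (assign (x # ys) (b # a)) \<phi> \<longleftrightarrow> sat M (val x ys b a) \<phi>"
  by (rule sat_cong) (auto simp: val_def)

context ordinals
begin

text \<open>Since ((2^\<kappa>)^\<kappa>)^\<theta> = \<lambda>^\<theta> = \<lambda>, a model of size
  \<lambda> contains at most \<lambda> many \<theta>-sequences of codes.\<close>

lemma card_Func:
  assumes "|A| \<le>o |{..<lam}|"
  shows "|Func ({..<theta} \<times> {..<kappa}) A| \<le>o |{..<lam}|"
proof -
  have two: "Card_order ctwo" by (rule Card_order_ctwo)
  have inf: "Cinfinite |{..<kappa}|"
    using infinite_kappa card_of_Card_order by (auto simp: cinfinite_def Field_card_of)
  have "|Func {..<kappa} A| = |A| ^c |{..<kappa}|" by (simp add: cexp_def Field_card_of)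
  moreover have "|A| ^c |{..<kappa}| \<le>o (ctwo ^c |{..<kappa}| ) ^c |{..<kappa}|"
    by (rule cexp_mono1[OF ordLeq_ordIso_trans[OF assms lam_kappa] card_of_Card_order])
  moreover have "(ctwo ^c |{..<kappa}| ) ^c |{..<kappa}| =o ctwo ^c ( |{..<kappa}| *c |{..<kappa}| )"
    by (rule cexp_cprod[OF two])
  moreover have "ctwo ^c ( |{..<kappa}| *c |{..<kappa}| ) =o ctwo ^c |{..<kappa}|"
    by (rule cexp_cong2[OF cprod_infinite[OF inf] two Card_order_cprod])
  ultimately have "|Func {..<kappa} A| \<le>o ctwo ^c |{..<kappa}|"
    using ordIso_transitive ordLeq_ordIso_trans by metis
  then have "|Func {..<kappa} A| \<le>o |{..<lam}|"
    using lam_kappa ordIso_symmetric ordLeq_ordIso_trans by blast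
  then have "|Func {..<kappa} A| ^c |{..<theta}| \<le>o |{..<lam}| ^c |{..<theta}|"
    by (rule cexp_mono1[OF _ card_of_Card_order])
  moreover have "|Func {..<theta} (Func {..<kappa} A)| = |Func {..<kappa} A| ^c |{..<theta}|"
    by (simp add: cexp_def Field_card_of)
  ultimately have "|Func {..<theta} (Func {..<kappa} A)| \<le>o |{..<lam}|"
    using lam_theta ordIso_symmetric ordLeq_ordIso_trans by metis
  then show ?thesis using card_of_Func_Times ordIso_ordLeq_trans by blast
qed

lemma card_oadd_lam: "|{..<oadd b lam} - {..<b}| =o |{..<lam}|"
proof -
  have "|{..<oadd b lam} - {..<b}| \<le>o |{..<lam}|"
    using card_of_mono1[OF Diff_subset] card_initial ordLeq_transitive by blast
  moreover have "|{..<lam}| \<le>o |{..<oadd b lam} - {..<b}|"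
  proof (rule card_of_ordLeqI[of "oadd b"])
    show "inj_on (oadd b) {..<lam}" using oadd_less by (metis linorder_inj_onI' order_less_irrefl)
    show "oadd b a \<in> {..<oadd b lam} - {..<b}" if "a \<in> {..<lam}" for a
      using oadd_less[of a lam b] oadd_ge[of b a] that by (simp add: not_less)
  qed
  ultimately show ?thesis by (simp add: ordIso_iff_ordLeq)
qed

end

section \<open>Extension of one model by an ultrapower\<close>

locale independent_setting = ordinals lam theta kappa
  for lam theta kappa :: "'o::wellorder" +
  fixes V :: "('f, 'p) vocab" and T :: "('f, 'p) fm set"
    and \<phi> :: "('f, 'p) fm" and x :: nat and ys :: "nat list"
  assumes T_sent: "T \<subseteq> sentences V" and T_card: "|{\<phi>. fm_over V \<phi>}| \<le>o |{..<lam}|"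
    and \<phi>_over: "fm_over V \<phi>" and dist: "distinct (x # ys)" and \<phi>_free: "free_vars \<phi> \<subseteq> set (x # ys)"
    and indep: "independent_fm TYPE('o) V T [x] ys \<phi>"
begin

definition rel :: "('f, 'p, 'a) struct \<Rightarrow> 'a \<Rightarrow> 'a list \<Rightarrow> bool" where
  "rel M b a \<longleftrightarrow> sat M (val x ys b a) \<phi>"

abbreviation len :: nat where "len \<equiv> length ys"

lemma rel_elem_sub:
  assumes "elem_sub V M N" "b \<in> universe M" "a \<in> tuples (universe M) len"
  shows "rel M b a \<longleftrightarrow> rel N b a"
  unfolding rel_def
  by (rule elem_sub_sat[OF assms(1) \<phi>_over val_range[OF dist]]) (use assms(2,3) in \<open>simp_all add: tuples_def\<close>)

lemma rel_iso:
  assumes "is_struct V M" "is_isomorphism V M N f" "b \<in> universe M" "a \<in> tuples (universe M) len"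
  shows "rel M b a \<longleftrightarrow> rel N (f b) (map f a)"
proof -
  have a: "length a = len" "set a \<subseteq> universe M" using assms(4) by (simp_all add: tuples_def)
  have "sat M (val x ys b a) \<phi> \<longleftrightarrow> sat N (f \<circ> val x ys b a) \<phi>"
    by (rule sat_iso[OF assms(1,2) \<phi>_over val_range[OF dist a(1) assms(3) a(2)]])
  moreover have "f \<circ> val x ys b a = val x ys (f b) (map f a)"
    by (rule ext) (simp add: val_map[OF dist a(1)])
  ultimately show ?thesis by (simp only: rel_def)
qed

text \<open>Independence is stated for initial segments of the natural numbers; the coordinates of
  the ultrapower carry finite sets of ordinals instead. Choice yields witnesses \<open>B w\<close>
  for all subsets \<open>w\<close> at once.\<close>

lemma independent_finite:
  fixes M :: "('f, 'p, 'o) struct" and s :: "'o set"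
  assumes M: "M \<in> Mod V T" and s: "finite s"
  shows "\<exists>A B. (\<forall>i\<in>s. A i \<in> tuples (universe M) len) \<and>
    (\<forall>w. w \<subseteq> s \<longrightarrow> B w \<in> universe M \<and> (\<forall>i\<in>s. rel M (B w) (A i) \<longleftrightarrow> i \<in> w))"
proof -
  obtain h where h: "bij_betw h s {..<card s}"
    using ex_bij_betw_finite_nat[OF s] by (auto simp: atLeast0LessThan)
  obtain a where a: "\<forall>l<card s. a l \<in> tuples (universe M) len"
    and ind: "\<forall>u. u \<subseteq> {..<card s} \<longrightarrow> (\<exists>b\<in>tuples (universe M) (length [x]).
      (\<forall>l\<in>u. sat M (assign ([x] @ ys) (b @ a l)) \<phi>) \<and>
      (\<forall>l\<in>{..<card s} - u. \<not> sat M (assign ([x] @ ys) (b @ a l)) \<phi>))"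
    using bspec[OF spec[OF indep[unfolded independent_fm_def], of "card s"] M] by (elim exE conjE)
  have hs: "h i < card s" if "i \<in> s" for i using h that by (auto simp: bij_betw_def)
  have "\<exists>b. w \<subseteq> s \<longrightarrow> b \<in> universe M \<and> (\<forall>i\<in>s. rel M b (a (h i)) \<longleftrightarrow> i \<in> w)" for w
  proof (cases "w \<subseteq> s")
    case True
    then have "h ` w \<subseteq> {..<card s}" using hs by auto
    from ind[THEN spec, THEN mp, OF this] obtain bs where bs: "bs \<in> tuples (universe M) (length [x])"
      "\<forall>l\<in>h ` w. sat M (assign ([x] @ ys) (bs @ a l)) \<phi>"
      "\<forall>l\<in>{..<card s} - h ` w. \<not> sat M (assign ([x] @ ys) (bs @ a l)) \<phi>"
      by (elim bexE conjE)
    obtain b where b: "bs = [b]" using bs(1) by (auto simp: tuples_def length_Suc_conv)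
    have r: "sat M (assign ([x] @ ys) (bs @ a l)) \<phi> \<longleftrightarrow> rel M b (a l)" for l
      using sat_assign_val[OF \<phi>_free] by (simp add: b rel_def)
    have "h i \<in> h ` w \<longleftrightarrow> i \<in> w" if "i \<in> s" for i
      using inj_on_image_mem_iff[of h s i w] h that True by (simp add: bij_betw_def)
    moreover have "rel M b (a (h i)) \<longleftrightarrow> h i \<in> h ` w" if "i \<in> s" for i
      using bs(2,3) hs[OF that] unfolding r by blast
    ultimately have "\<forall>i\<in>s. rel M b (a (h i)) \<longleftrightarrow> i \<in> w" by simp
    moreover have "b \<in> universe M" using bs(1) by (simp add: b tuples_def)
    ultimately show ?thesis by blast
  qed blast
  then have "\<forall>w. \<exists>b. w \<subseteq> s \<longrightarrow> b \<in> universe M \<and> (\<forall>i\<in>s. rel M b (a (h i)) \<longleftrightarrow> i \<in> w)" by blast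
  from choice[OF this] obtain B where
    "\<forall>w. w \<subseteq> s \<longrightarrow> B w \<in> universe M \<and> (\<forall>i\<in>s. rel M (B w) (a (h i)) \<longleftrightarrow> i \<in> w)" ..
  moreover have "\<forall>i\<in>s. a (h i) \<in> tuples (universe M) len" using a hs by blast
  ultimately show ?thesis by (intro exI[of _ "\<lambda>i. a (h i)"] exI[of _ B]) simp
qed

text \<open>Parameters and witnesses are both confined below \<open>\<xi>\<close>, so goodness
  depends on an initial segment only and is absolute between elementary extensions;
  \<open>par\<close> exploits this.\<close>

definition good :: "('f, 'p, 'o) struct \<Rightarrow> 'o \<Rightarrow> ('o \<Rightarrow> 'o list) \<Rightarrow> bool" where
  "good M \<xi> c \<longleftrightarrow> {..<\<xi>} \<subseteq> universe M \<and> (\<forall>i<kappa. c i \<in> tuples {..<\<xi>} len) \<and>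
     (\<forall>v. v \<subseteq> {..<kappa} \<longrightarrow> (\<exists>b<\<xi>. \<forall>i<kappa. rel M b (c i) \<longleftrightarrow> i \<in> v))"

text \<open>One ultrapower does three jobs: the \<open>W \<xi>\<close> are new elements that fill
  the universe, \<open>Ca\<close> and \<open>Bv\<close> assemble a good sequence and its witnesses
  from finite patterns as in a compactness argument, and \<open>C1\<close> gives the averages of
  \<open>c0\<close>.\<close>

lemma extension:
  fixes M :: "('f, 'p, 'o) struct" and U :: "(('o \<Rightarrow> 'o) \<times> 'o set) set set"
  assumes M: "M \<in> Mod V T" and univ: "universe M = {..<\<beta>}" and cM: "|{..<\<beta>}| =o |{..<lam}|"
    and U: "ultra U" and Uk: "\<And>k. k < kappa \<Longrightarrow> {(j, s). j k < kappa} \<in> U"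
    and Us: "\<And>\<xi>. {(j, s). finite s \<and> \<xi> \<in> s} \<in> U"
    and c0: "\<And>i. i < kappa \<Longrightarrow> c0 i \<in> tuples {..<\<beta>} len"
  shows "\<exists>N c c1. N \<in> Mod V T \<and> universe N = {..<oadd \<beta> lam} \<and> elem_sub V M N \<and>
    good N (oadd \<beta> lam) c \<and> (\<forall>k<kappa. c1 k \<in> tuples (universe N) len) \<and>
    (\<forall>b\<in>universe M. \<forall>k<kappa. rel N b (c1 k) \<longleftrightarrow> {(j, s). rel M b (c0 (j k))} \<in> U)"
proof -
  have st: "is_struct V M" using M by (simp add: Mod_def)
  obtain m0 where m0: "m0 \<in> universe M" using universe_nonempty[OF st] by blast
  have inf\<beta>: "infinite {..<\<beta>}" using card_of_ordIso_finite[OF cM] infinite_lam by simp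

  \<comment> \<open>At coordinate \<open>s\<close> the map \<open>g s\<close> sends \<open>s\<close>
    injectively to points outside \<open>s\<close>. Almost every \<open>s\<close> contains any given
    \<open>m\<close> and any two given indices, so \<open>W \<xi>\<close> equals no old element and
    differs from \<open>W \<xi>'\<close>.\<close>
  define g where "g = (\<lambda>s. SOME h. inj_on h s \<and> h ` s \<subseteq> {..<\<beta>} - s)"
  have g: "inj_on (g s) s \<and> g s ` s \<subseteq> {..<\<beta>} - s" if "finite s" for s
  proof -
    have "infinite ({..<\<beta>} - s)" using inf\<beta> that by simp
    then obtain t where t: "t \<subseteq> {..<\<beta>} - s" "finite t" "card t = card s"
      using infinite_arbitrarily_large by metis
    obtain h where "bij_betw h s t" using finite_same_card_bij[OF \<open>finite s\<close> t(2)] t(3) by metis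
    then have "\<exists>h. inj_on h s \<and> h ` s \<subseteq> {..<\<beta>} - s" using t(1) by (auto simp: bij_betw_def)
    then show ?thesis unfolding g_def by (rule someI_ex)
  qed
  define W where "W = (\<lambda>\<xi> (t :: ('o \<Rightarrow> 'o) \<times> 'o set). if finite (snd t) \<and> \<xi> \<in> snd t then g (snd t) \<xi> else m0)"
  have WM: "W \<xi> t \<in> universe M" for \<xi> t using m0 g[of "snd t"] by (auto simp: W_def univ)
  have Us': "{t. finite (snd t) \<and> \<xi> \<in> snd t} \<in> U" for \<xi>
    using Us[of \<xi>] by (simp add: case_prod_beta')
  have W_new: "{t. W \<xi> t = m} \<notin> U" for \<xi> m
  proof
    assume "{t. W \<xi> t = m} \<in> U"
    then have "{t. W \<xi> t = m} \<inter> ({t. finite (snd t) \<and> \<xi> \<in> snd t} \<inter> {t. finite (snd t) \<and> m \<in> snd t}) \<in> U"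
      using Us' ultra_Int[OF U] by simp
    moreover have "{t. W \<xi> t = m} \<inter> ({t. finite (snd t) \<and> \<xi> \<in> snd t} \<inter> {t. finite (snd t) \<and> m \<in> snd t}) = {}"
      using g by (fastforce simp: W_def)
    ultimately show False using ultra_empty[OF U] by simp
  qed
  have W_neq: "{t. W \<xi> t = W \<xi>' t} \<notin> U" if ne: "\<xi> \<noteq> \<xi>'" for \<xi> \<xi>'
  proof
    assume "{t. W \<xi> t = W \<xi>' t} \<in> U"
    then have "{t. W \<xi> t = W \<xi>' t} \<inter> ({t. finite (snd t) \<and> \<xi> \<in> snd t} \<inter> {t. finite (snd t) \<and> \<xi>' \<in> snd t}) \<in> U"
      using Us' ultra_Int[OF U] by simp
    moreover have "{t. W \<xi> t = W \<xi>' t} \<inter> ({t. finite (snd t) \<and> \<xi> \<in> snd t} \<inter> {t. finite (snd t) \<and> \<xi>' \<in> snd t}) = {}"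
      using g ne by (auto simp: W_def inj_on_def)
    ultimately show False using ultra_empty[OF U] by simp
  qed

  have "\<forall>s :: 'o set. \<exists>p. finite s \<longrightarrow> (\<forall>i\<in>s. fst p i \<in> tuples (universe M) len) \<and>
      (\<forall>w. w \<subseteq> s \<longrightarrow> snd p w \<in> universe M \<and> (\<forall>i\<in>s. rel M (snd p w) (fst p i) \<longleftrightarrow> i \<in> w))"
    (is "\<forall>s. ?P s")
  proof
    show "?P s" for s :: "'o set" using independent_finite[OF M, of s] by (cases "finite s") simp_all
  qed
  from choice[OF this] obtain AB where AB: "\<And>s :: 'o set. finite s \<Longrightarrow>
      (\<forall>i\<in>s. fst (AB s) i \<in> tuples (universe M) len) \<and>
      (\<forall>w. w \<subseteq> s \<longrightarrow> snd (AB s) w \<in> universe M \<and> (\<forall>i\<in>s. rel M (snd (AB s) w) (fst (AB s) i) \<longleftrightarrow> i \<in> w))"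
    by blast
  \<comment> \<open>The parameters at a coordinate form an independent pattern indexed by its finite
    set \<open>s\<close>, and \<open>Bv v\<close> is the witness for the trace of \<open>v\<close>
    on \<open>s\<close>.\<close>
  define Ca where "Ca = (\<lambda>i l (t :: ('o \<Rightarrow> 'o) \<times> 'o set).
    if finite (snd t) \<and> i \<in> snd t then fst (AB (snd t)) i ! l else m0)"
  define Bv where "Bv = (\<lambda>v (t :: ('o \<Rightarrow> 'o) \<times> 'o set).
    if finite (snd t) then snd (AB (snd t)) (v \<inter> snd t) else m0)"
  define C1 where "C1 = (\<lambda>k l (t :: ('o \<Rightarrow> 'o) \<times> 'o set). if fst t k < kappa then c0 (fst t k) ! l else m0)"
  have CaM: "Ca i l t \<in> universe M" if "l < len" for i l t
  proof (cases "finite (snd t) \<and> i \<in> snd t")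
    case True
    then have "fst (AB (snd t)) i \<in> tuples (universe M) len" using AB by blast
    from tuples_nth[OF this \<open>l < len\<close>] show ?thesis using True by (simp add: Ca_def)
  qed (use m0 in \<open>auto simp: Ca_def\<close>)
  have BvM: "Bv v t \<in> universe M" for v t
    using m0 AB[of "snd t"] by (auto simp: Bv_def)
  have C1M: "C1 k l t \<in> universe M" if "l < len" for k l t
  proof (cases "fst t k < kappa")
    case True
    then have "c0 (fst t k) ! l \<in> {..<\<beta>}" using tuples_nth[OF c0 \<open>l < len\<close>] by blast
    then show ?thesis using True by (simp add: C1_def univ)
  qed (use m0 in \<open>simp add: C1_def\<close>)

  \<comment> \<open>There is one \<open>Bv v\<close> for each subset of \<kappa>, so 2^\<kappa> =
    \<lambda> keeps the size of \<open>X\<close> at most \<lambda>.\<close>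
  define X where "X = W ` {..<lam} \<union> ((\<lambda>(k, l). C1 k l) ` ({..<kappa} \<times> {..<len}) \<union>
    ((\<lambda>(i, l). Ca i l) ` ({..<kappa} \<times> {..<len}) \<union> Bv ` Pow {..<kappa}))"
  have XM: "range y \<subseteq> universe M" if "y \<in> X" for y
    using that WM C1M CaM BvM unfolding X_def by auto
  have img: "|h ` A| \<le>o |{..<lam}|" if "|A| \<le>o |{..<lam}|" for h :: "'z \<Rightarrow> ('o \<Rightarrow> 'o) \<times> 'o set \<Rightarrow> 'o" and A
    using card_of_image that ordLeq_transitive by blast
  have "|{..<len}| \<le>o |{..<lam}|"
    using infinite_lam infinite_iff_card_of_nat card_of_mono1[OF subset_UNIV] ordLeq_transitive by blast
  then have "|{..<kappa} \<times> {..<len}| \<le>o |{..<lam}|"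
    by (intro card_of_Sigma_ordLeq_infinite[OF infinite_lam card_initial]) simp
  moreover have "|Pow {..<kappa}| \<le>o |{..<lam}|"
    using subsets_coding card_of_ordIsoI ordIso_symmetric ordIso_iff_ordLeq by metis
  ultimately have cX: "|X| \<le>o |{..<lam}|"
    unfolding X_def
    by (intro card_of_Un_ordLeq_infinite[OF infinite_lam] img) (simp_all add: card_initial)

  have "\<beta> \<le> oadd \<beta> lam" by (rule oadd_ge)
  then have MB: "universe M \<subseteq> {..<oadd \<beta> lam}" by (auto simp: univ)
  have cM': "|universe M| \<le>o |{..<lam}|" using cM by (simp add: univ ordIso_iff_ordLeq)
  have cB: "|{..<oadd \<beta> lam} - universe M| =o |{..<lam}|" using card_oadd_lam by (simp add: univ)
  have WX: "W \<xi> \<in> X" if "\<xi> \<in> {..<lam}" for \<xi> using that by (simp add: X_def)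
  obtain N r where N: "is_struct V N" "universe N = {..<oadd \<beta> lam}" "elem_sub V M N"
    and rc: "\<And>m. m \<in> universe M \<Longrightarrow> r (\<lambda>_. m) = m" and rX: "\<And>y. y \<in> X \<Longrightarrow> r y \<in> {..<oadd \<beta> lam}"
    and los: "\<And>\<phi> v. fm_over V \<phi> \<Longrightarrow> range v \<subseteq> X \<union> (\<lambda>m _. m) ` universe M \<Longrightarrow>
      sat N (\<lambda>n. r (v n)) \<phi> \<longleftrightarrow> {t. sat M (\<lambda>n. v n t) \<phi>} \<in> U"
    by (rule ultrapower_hull[OF U st XM infinite_lam T_card cM' cX MB cB WX W_new W_neq]) blast+
  have los_rel: "rel N (r b) (map r a) \<longleftrightarrow> {t. rel M (b t) (map (\<lambda>y. y t) a)} \<in> U"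
    if "length a = len" "b \<in> X \<union> (\<lambda>m _. m) ` universe M" "set a \<subseteq> X" for a b
  proof -
    have a: "set a \<subseteq> X \<union> (\<lambda>m _. m) ` universe M" using that(3) by blast
    have "sat N (\<lambda>n. r (val x ys b a n)) \<phi> \<longleftrightarrow> {t. sat M (\<lambda>n. val x ys b a n t) \<phi>} \<in> U"
      by (rule los[OF \<phi>_over val_range[OF dist that(1,2) a]])
    moreover have "(\<lambda>n. r (val x ys b a n)) = val x ys (r b) (map r a)"
      by (rule ext) (rule val_map[OF dist that(1)])
    moreover have "(\<lambda>n. val x ys b a n t) = val x ys (b t) (map (\<lambda>y. y t) a)" for t
      by (rule ext) (rule val_map[OF dist that(1), of "\<lambda>y. y t"])
    ultimately show ?thesis by (simp only: rel_def)
  qed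

  define c where "c = (\<lambda>i. map r (map (Ca i) [0..<len]))"
  define c1 where "c1 = (\<lambda>k. map r (map (C1 k) [0..<len]))"
  have CaX: "set (map (Ca i) [0..<len]) \<subseteq> X" and C1X: "set (map (C1 i) [0..<len]) \<subseteq> X" if "i < kappa" for i
    using that by (auto simp: X_def)
  have tup: "map r l \<in> tuples {..<oadd \<beta> lam} len" if "set l \<subseteq> X" "length l = len" for l
    using that rX by (auto simp: tuples_def)
  have BX: "Bv v \<in> X" if "v \<subseteq> {..<kappa}" for v using that by (simp add: X_def)
  have rel_c: "rel N (r (Bv v)) (c i) \<longleftrightarrow> i \<in> v" if "v \<subseteq> {..<kappa}" "i < kappa" for v i
  proof -
    have "rel N (r (Bv v)) (c i) \<longleftrightarrow> {t. rel M (Bv v t) (map (\<lambda>y. y t) (map (Ca i) [0..<len]))} \<in> U"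
      unfolding c_def by (rule los_rel) (use BX[OF that(1)] CaX[OF that(2)] in simp_all)
    \<comment> \<open>Almost every \<open>s\<close> contains \<open>i\<close>, so the trace of
      \<open>v\<close> on \<open>s\<close> decides whether \<open>i \<in> v\<close>.\<close>
    also have "\<dots> \<longleftrightarrow> {t :: ('o \<Rightarrow> 'o) \<times> 'o set. i \<in> v} \<in> U"
    proof (rule ultra_ev_cong[OF U Us'[of i]])
      fix t assume "t \<in> {t :: ('o \<Rightarrow> 'o) \<times> 'o set. finite (snd t) \<and> i \<in> snd t}"
      then have t: "finite (snd t)" "i \<in> snd t" by simp_all
      have "map (\<lambda>y. y t) (map (Ca i) [0..<len]) = fst (AB (snd t)) i"
        using AB[OF t(1)] t by (auto simp: Ca_def tuples_def intro!: nth_equalityI)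
      moreover have "Bv v t = snd (AB (snd t)) (v \<inter> snd t)" using t by (simp add: Bv_def)
      ultimately have "rel M (Bv v t) (map (\<lambda>y. y t) (map (Ca i) [0..<len])) \<longleftrightarrow> i \<in> v \<inter> snd t"
        using AB[OF t(1)] t(2) by (simp only: Int_lower2)
      then show "t \<in> {t. rel M (Bv v t) (map (\<lambda>y. y t) (map (Ca i) [0..<len]))} \<longleftrightarrow> t \<in> {t. i \<in> v}"
        using t(2) by simp
    qed
    also have "\<dots> \<longleftrightarrow> i \<in> v" using ultra_UNIV[OF U] ultra_empty[OF U] by (cases "i \<in> v") simp_all
    finally show ?thesis .
  qed
  have "good N (oadd \<beta> lam) c"
    unfolding good_def
  proof (intro conjI allI impI)
    show "c i \<in> tuples {..<oadd \<beta> lam} len" if "i < kappa" for i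
      unfolding c_def by (rule tup[OF CaX[OF that]]) simp
    show "\<exists>b < oadd \<beta> lam. \<forall>i<kappa. rel N b (c i) \<longleftrightarrow> i \<in> v" if "v \<subseteq> {..<kappa}" for v
      using rX[OF BX[OF that]] rel_c[OF that] by (intro exI[of _ "r (Bv v)"]) simp
  qed (simp add: N(2))
  moreover have "\<forall>k<kappa. c1 k \<in> tuples (universe N) len"
    unfolding c1_def N(2) using tup[OF C1X] by simp
  moreover have "rel N b (c1 k) \<longleftrightarrow> {(j, s). rel M b (c0 (j k))} \<in> U"
    if b: "b \<in> universe M" and k: "k < kappa" for b k
  proof -
    have "rel N (r (\<lambda>_. b)) (c1 k) \<longleftrightarrow> {t. rel M b (map (\<lambda>y. y t) (map (C1 k) [0..<len]))} \<in> U"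
      unfolding c1_def by (rule los_rel) (use b C1X[OF k] in simp_all)
    also have "\<dots> \<longleftrightarrow> {(j, s). rel M b (c0 (j k))} \<in> U"
    proof (rule ultra_ev_cong[OF U Uk[OF k]])
      fix t :: "('o \<Rightarrow> 'o) \<times> 'o set" assume "t \<in> {(j, s). j k < kappa}"
      then have t: "fst t k < kappa" by auto
      have "map (\<lambda>y. y t) (map (C1 k) [0..<len]) = c0 (fst t k)"
        using c0[OF t] t by (auto simp: C1_def tuples_def intro!: nth_equalityI)
      then show "t \<in> {t. rel M b (map (\<lambda>y. y t) (map (C1 k) [0..<len]))} \<longleftrightarrow>
          t \<in> {(j, s). rel M b (c0 (j k))}" by (simp only: mem_Collect_eq case_prod_beta')
    qed
    finally show ?thesis using rc[OF b] by simp
  qed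
  moreover have "N \<in> Mod V T" by (rule elem_sub_Mod[OF T_sent M N(1,3)])
  ultimately show ?thesis using N(2,3) by blast
qed

end

section \<open>The extension step and its codes\<close>

text \<open>The values \<open>Vv (G \<beta> z)\<close> are the prescribed ones for \<open>h\<^sub>\<beta> (u z)\<close>, and \<open>UU \<beta>\<close> is an ultrafilter that
  produces them: the \<open>k\<close>-th average is the class of \<open>(j, s) \<mapsto> c (j k)\<close>. The finite sets \<open>s\<close> serve to
  obtain new elements and good sequences in the same ultrapower.\<close>

locale coded_setting = independent_setting lam theta kappa V T \<phi> x ys
  for lam theta kappa :: "'o::wellorder" and V :: "('f, 'p) vocab" and T :: "('f, 'p) fm set"
    and \<phi> :: "('f, 'p) fm" and x :: nat and ys :: "nat list" +
  fixes u Vv :: "'o \<Rightarrow> 'o set" and G q :: "'o \<Rightarrow> 'o \<Rightarrow> 'o" and pr :: "bool \<Rightarrow> 'o \<Rightarrow> nat \<Rightarrow> 'o"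
    and UU :: "'o \<Rightarrow> (('o \<Rightarrow> 'o) \<times> 'o set) set set"
  assumes u_sub: "u z \<subseteq> {..<kappa}"
    and Vv_inj: "inj_on Vv {..<lam}" and Vv_sub: "z < lam \<Longrightarrow> Vv z \<subseteq> {..<kappa}"
    and G_less: "z < lam \<Longrightarrow> G b z < lam" and q_less: "b' < b \<Longrightarrow> q b b' < lam"
    and G_eq: "b' < b \<Longrightarrow> z < lam \<Longrightarrow> G b z = G b' z \<Longrightarrow> z \<le> q b b'"
    and pr_less: "k < kappa \<Longrightarrow> pr t k l < kappa"
    and pr_inj: "k < kappa \<Longrightarrow> k' < kappa \<Longrightarrow> pr t k l = pr t' k' l' \<Longrightarrow> t = t' \<and> k = k' \<and> l = l'"
    and UU: "ultra (UU b)" and UU_k: "k < kappa \<Longrightarrow> {(j, s). j k < kappa} \<in> UU b"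
    and UU_u: "k < kappa \<Longrightarrow> z < lam \<Longrightarrow> {(j, s). j k \<in> u z} \<in> UU b \<longleftrightarrow> k \<in> Vv (G b z)"
    and UU_s: "{(j, s). finite s \<and> \<xi> \<in> s} \<in> UU b"
begin

definition isgood :: "('f, 'p, 'o) struct \<Rightarrow> bool" where
  "isgood M \<longleftrightarrow> (\<exists>\<xi> c. good M \<xi> c)"

text \<open>The parameters \<open>par M\<close> depend only on the shortest initial segment of \<open>M\<close> that contains a good
  sequence. Hence they do not change when \<open>M\<close> is extended, although \<open>step\<close> below knows nothing but
  the present model.\<close>

definition par :: "('f, 'p, 'o) struct \<Rightarrow> 'o \<Rightarrow> 'o list" where
  "par M = (SOME c. good M (LEAST \<xi>. \<exists>c. good M \<xi> c) c)"

definition hgt :: "('f, 'p, 'o) struct \<Rightarrow> 'o" where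
  "hgt M = (SOME b. universe M = {..<b})"

text \<open>As a function of \<open>p\<close> this is \<open>h\<^sub>b\<close>: it collects the
  \<open>k\<close> for which \<open>p\<close> is large in the image of \<open>UU b\<close> under
  \<open>(j, s) \<mapsto> j k\<close>.\<close>

definition hull_type :: "'o \<Rightarrow> 'o set \<Rightarrow> 'o set" where
  "hull_type b p = {k. k < kappa \<and> {(j, s). j k \<in> p} \<in> UU b}"

text \<open>The clause on averages is conditional, since the first model of a sequence may have no
  good sequence of parameters; \<open>isgood N\<close> holds in any case, so the clause takes effect
  from the next stage on.\<close>

definition is_step :: "('f, 'p, 'o) struct \<Rightarrow> ('f, 'p, 'o) struct \<Rightarrow> ('o \<Rightarrow> 'o list) \<Rightarrow> bool" where
  "is_step M N c1 \<longleftrightarrow> N \<in> Mod V T \<and> universe N = {..<oadd (hgt M) lam} \<and> elem_sub V M N \<and> isgood N \<and>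
     (\<forall>k<kappa. c1 k \<in> tuples (universe N) len) \<and>
     (isgood M \<longrightarrow> (\<forall>b\<in>universe M. \<forall>k<kappa.
        rel N b (c1 k) \<longleftrightarrow> k \<in> hull_type (hgt M) {i. i < kappa \<and> rel M b (par M i)}))"

definition step_pair :: "('f, 'p, 'o) struct \<Rightarrow> ('f, 'p, 'o) struct \<times> ('o \<Rightarrow> 'o list)" where
  "step_pair M = (SOME p. is_step M (fst p) (snd p))"

definition step :: "('f, 'p, 'o) struct \<Rightarrow> ('f, 'p, 'o) struct" where
  "step M = fst (step_pair M)"

definition avg :: "('f, 'p, 'o) struct \<Rightarrow> 'o \<Rightarrow> 'o list" where
  "avg M = snd (step_pair M)"

text \<open>\<open>pr\<close> spreads the entries of \<open>par M\<close> and \<open>avg M\<close>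
  over one sequence. The default \<open>ozero\<close> lies in every model whose universe is an
  ordinal at least \<lambda>.\<close>

definition code :: "('f, 'p, 'o) struct \<Rightarrow> 'o \<Rightarrow> 'o" where
  "code M i = (let D = UNIV \<times> {..<kappa} \<times> {..<len}; h = (\<lambda>(t, k, l). pr t k l) in
     if isgood M \<and> i \<in> h ` D
     then case inv_into D h i of (t, k, l) \<Rightarrow> (if t then avg M else par M) k ! l
     else ozero)"

section \<open>Canonical parameters and the step function\<close>

lemma hgt: "universe M = {..<b} \<Longrightarrow> hgt M = b"
  unfolding hgt_def by (rule some_equality) auto

lemma EC_ord_iff:
  "M \<in> EC_ord V T lam \<longleftrightarrow> M \<in> Mod V T \<and> (\<exists>b\<ge>lam. universe M = {..<b})"
proof
  assume "M \<in> Mod V T \<and> (\<exists>b\<ge>lam. universe M = {..<b})"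
  then obtain b where b: "M \<in> Mod V T" "lam \<le> b" "universe M = {..<b}" by blast
  have "|{..<lam}| \<le>o |{..<b}|" by (rule card_of_mono1) (use b(2) in auto)
  then have "|{..<b}| =o |{..<lam}|" using card_initial ordIso_iff_ordLeq by blast
  then show "M \<in> EC_ord V T lam" using b by (auto simp: EC_ord_def EC_def)
qed (auto simp: EC_ord_def EC_def)

lemma par_good:
  assumes "isgood M"
  shows "good M (LEAST \<xi>. \<exists>c. good M \<xi> c) (par M)"
proof -
  have "\<exists>c. good M (LEAST \<xi>. \<exists>c. good M \<xi> c) c"
    using assms unfolding isgood_def by (rule LeastI_ex)
  then show ?thesis unfolding par_def by (rule someI_ex)
qed

lemma good_mono:
  assumes sub: "elem_sub V M N" and \<xi>: "{..<\<xi>} \<subseteq> universe M"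
  shows "good N \<xi> c \<longleftrightarrow> good M \<xi> c"
proof -
  have uN: "{..<\<xi>} \<subseteq> universe N" using sub \<xi> by (auto simp: elem_sub_def)
  have r: "rel N b (c i) = rel M b (c i)" if "b < \<xi>" "c i \<in> tuples {..<\<xi>} len" for b i
    by (rule rel_elem_sub[OF sub, symmetric]) (use that \<xi> in \<open>auto simp: tuples_def\<close>)
  show ?thesis
  proof (cases "\<forall>i<kappa. c i \<in> tuples {..<\<xi>} len")
    case True
    then have "(\<forall>i<kappa. rel N b (c i) \<longleftrightarrow> i \<in> v) \<longleftrightarrow> (\<forall>i<kappa. rel M b (c i) \<longleftrightarrow> i \<in> v)"
      if "b < \<xi>" for b v using r[OF that] by simp
    then have "(\<exists>b<\<xi>. \<forall>i<kappa. rel N b (c i) \<longleftrightarrow> i \<in> v) \<longleftrightarrow> (\<exists>b<\<xi>. \<forall>i<kappa. rel M b (c i) \<longleftrightarrow> i \<in> v)" for v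
      by (simp cong: conj_cong)
    then show ?thesis using uN \<xi> by (simp add: good_def)
  qed (auto simp: good_def)
qed

text \<open>By \<open>good_mono\<close> the two models agree on which segments inside
  \<open>M\<close> are good, so the least ones coincide and \<open>SOME\<close> is applied to equal
  predicates.\<close>

lemma good_extend:
  assumes sub: "elem_sub V M N" and M: "universe M = {..<a}" and g: "isgood M"
  shows "isgood N" "par N = par M"
proof -
  let ?l = "\<lambda>M. LEAST \<xi>. \<exists>c. good M \<xi> c"
  have gM: "good M (?l M) (par M)" by (rule par_good[OF g])
  then have lM: "{..<?l M} \<subseteq> universe M" by (simp add: good_def)
  have gN: "good N (?l M) (par M)" using good_mono[OF sub lM] gM by blast
  then show "isgood N" unfolding isgood_def by blast
  have le: "?l N \<le> ?l M" by (rule Least_le) (use gN in blast)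
  then have lN: "{..<?l N} \<subseteq> universe M" using lM by auto
  have "\<exists>c. good N (?l N) c" by (rule LeastI_ex) (use gN in blast)
  then have "\<exists>c. good M (?l N) c" using good_mono[OF sub lN] by blast
  then have "?l M \<le> ?l N" by (rule Least_le)
  then have "?l N = ?l M" using le by simp
  moreover have "good N (?l M) = good M (?l M)" using good_mono[OF sub lM] by blast
  ultimately show "par N = par M" unfolding par_def by simp
qed

lemma tuples_mono: "a \<in> tuples A n \<Longrightarrow> A \<subseteq> B \<Longrightarrow> a \<in> tuples B n"
  by (auto simp: tuples_def)

lemma par_tuples:
  assumes "isgood M" "i < kappa"
  shows "par M i \<in> tuples (universe M) len"
proof -
  have g: "good M (LEAST \<xi>. \<exists>c. good M \<xi> c) (par M)" by (rule par_good[OF assms(1)])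
  show ?thesis
    by (rule tuples_mono[of _ "{..<LEAST \<xi>. \<exists>c. good M \<xi> c}"]) (use g assms(2) in \<open>simp_all only: good_def\<close>)
qed

lemma is_step_ex:
  assumes M: "M \<in> EC_ord V T lam"
  shows "\<exists>p. is_step M (fst p) (snd p)"
proof -
  obtain b where b: "lam \<le> b" "universe M = {..<b}" and Mod: "M \<in> Mod V T"
    using M by (auto simp: EC_ord_iff)
  have cM: "|{..<b}| =o |{..<lam}|" using M b by (simp add: EC_ord_def EC_def)
  have b0: "ozero < b" using lam_pos b(1) by simp
  \<comment> \<open>Without a good sequence a constant sequence is averaged: nothing is claimed
    about these averages, but the extension still creates a good sequence.\<close>
  define c0 where "c0 = (if isgood M then par M else (\<lambda>_. replicate len ozero))"
  have c0: "c0 i \<in> tuples {..<b} len" if "i < kappa" for i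
  proof (cases "isgood M")
    case True
    have "c0 i = par M i" using True by (simp add: c0_def)
    then show ?thesis using par_tuples[OF True that] b(2) by simp
  next
    case False
    then have "c0 i = replicate len ozero" by (simp add: c0_def)
    then show ?thesis using b0 by (auto simp: tuples_def)
  qed
  have "\<exists>N c c1. N \<in> Mod V T \<and> universe N = {..<oadd b lam} \<and> elem_sub V M N \<and>
    good N (oadd b lam) c \<and> (\<forall>k<kappa. c1 k \<in> tuples (universe N) len) \<and>
    (\<forall>a\<in>universe M. \<forall>k<kappa. rel N a (c1 k) \<longleftrightarrow> {(j, s). rel M a (c0 (j k))} \<in> UU b)"
    by (rule extension[OF Mod b(2) cM UU UU_k UU_s]) (assumption, rule c0)
  then obtain N c c1 where
    N: "N \<in> Mod V T" "universe N = {..<oadd b lam}" "elem_sub V M N"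
      "good N (oadd b lam) c" "\<forall>k<kappa. c1 k \<in> tuples (universe N) len"
    and c1: "\<forall>a\<in>universe M. \<forall>k<kappa. rel N a (c1 k) \<longleftrightarrow> {(j, s). rel M a (c0 (j k))} \<in> UU b"
    by (elim exE conjE)
  have "rel N a (c1 k) \<longleftrightarrow> k \<in> hull_type b {i. i < kappa \<and> rel M a (par M i)}"
    if g: "isgood M" and a: "a \<in> universe M" and k: "k < kappa" for a k
  proof -
    have "rel N a (c1 k) \<longleftrightarrow> {(j, s). rel M a (c0 (j k))} \<in> UU b" using c1 a k by blast
    also have "\<dots> \<longleftrightarrow> {(j, s). j k \<in> {i. i < kappa \<and> rel M a (par M i)}} \<in> UU b"
      by (rule ultra_ev_cong[OF UU UU_k[OF k]]) (use g in \<open>auto simp: c0_def\<close>)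
    finally show ?thesis using k by (simp add: hull_type_def)
  qed
  moreover have "isgood N" using N(4) unfolding isgood_def by (intro exI)
  ultimately have "is_step M N c1"
    unfolding is_step_def hgt[OF b(2)] using N(1,2,3,5) by simp
  then show ?thesis by (intro exI[of _ "(N, c1)"]) simp
qed

lemma step:
  assumes "M \<in> EC_ord V T lam"
  shows "is_step M (step M) (avg M)"
  unfolding step_def avg_def step_pair_def by (rule someI_ex[OF is_step_ex[OF assms]])

lemma is_stepD:
  assumes "is_step M N c1"
  shows "N \<in> Mod V T" "universe N = {..<oadd (hgt M) lam}" "elem_sub V M N" "isgood N"
    "\<forall>k<kappa. c1 k \<in> tuples (universe N) len"
    "isgood M \<Longrightarrow> \<forall>b\<in>universe M. \<forall>k<kappa.
        rel N b (c1 k) \<longleftrightarrow> k \<in> hull_type (hgt M) {i. i < kappa \<and> rel M b (par M i)}"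
  using assms[unfolded is_step_def] by iprover+

lemma avg_tuples: "M \<in> EC_ord V T lam \<Longrightarrow> k < kappa \<Longrightarrow> avg M k \<in> tuples (universe (step M)) len"
  by (rule is_stepD(5)[OF step, THEN spec, THEN mp])

lemma step_rel:
  assumes "M \<in> EC_ord V T lam" "isgood M" "b \<in> universe M" "k < kappa"
  shows "rel (step M) b (avg M k) \<longleftrightarrow> k \<in> hull_type (hgt M) {i. i < kappa \<and> rel M b (par M i)}"
  by (rule is_stepD(6)[OF step[OF assms(1)] assms(2), THEN bspec, THEN spec, THEN mp, OF assms(3,4)])

lemma step_props:
  assumes M: "M \<in> EC_ord V T lam"
  shows "universe (step M) = {..<oadd (hgt M) lam}" "elem_sub V M (step M)" "step M \<in> Mod V T"
    "isgood (step M)" "step M \<in> EC_ord V T lam"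
proof -
  show 1: "universe (step M) = {..<oadd (hgt M) lam}" "elem_sub V M (step M)" "step M \<in> Mod V T"
    "isgood (step M)"
    by (rule is_stepD[OF step[OF M]])+
  obtain b where "lam \<le> b" "universe M = {..<b}" using M by (auto simp: EC_ord_iff)
  then have "lam \<le> oadd (hgt M) lam" using oadd_ge[of "hgt M" lam] hgt by fastforce
  then show "step M \<in> EC_ord V T lam" using 1 by (auto simp: EC_ord_iff)
qed

lemma code_pr:
  assumes g: "isgood M" and k: "k < kappa" and l: "l < len"
  shows "code M (pr True k l) = avg M k ! l" "code M (pr False k l) = par M k ! l"
proof -
  let ?D = "(UNIV :: bool set) \<times> {..<kappa} \<times> {..<len}" and ?h = "\<lambda>(t, k, l). pr t k l"
  have inj: "inj_on ?h ?D"
  proof (rule inj_onI)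
    fix p p' assume p: "p \<in> ?D" "p' \<in> ?D" "?h p = ?h p'"
    obtain t k l t' k' l' where e: "p = (t, k, l)" "p' = (t', k', l')" by (cases p, cases p') auto
    show "p = p'" using pr_inj[of k k' t l t' l'] p unfolding e by simp
  qed
  have "code M (pr t k l) = (if t then avg M else par M) k ! l" for t
  proof -
    have d: "(t, k, l) \<in> ?D" using k l by simp
    have 1: "inv_into ?D ?h (pr t k l) = (t, k, l)" using inv_into_f_f[OF inj d] by simp
    have "pr t k l \<in> ?h ` ?D" using imageI[OF d, of ?h] by simp
    then have "isgood M \<and> pr t k l \<in> ?h ` ?D" using g by (rule conjI[rotated])
    then show ?thesis unfolding code_def Let_def 1 by (simp only: simp_thms if_True prod.case)
  qed
  from this[of True] this[of False]
  show "code M (pr True k l) = avg M k ! l" "code M (pr False k l) = par M k ! l" by simp_all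
qed

text \<open>The averages are only known to lie in \<open>step M\<close>, which is why stage \<alpha>
  has its code in the model with index 2\<alpha>+2.\<close>

lemma code_in:
  assumes M: "M \<in> EC_ord V T lam"
  shows "code M i \<in> universe (step M)"
proof -
  let ?D = "(UNIV :: bool set) \<times> {..<kappa} \<times> {..<len}" and ?h = "\<lambda>(t, k, l). pr t k l"
  have sub: "universe M \<subseteq> universe (step M)" using step_props(2)[OF M] by (simp add: elem_sub_def)
  show ?thesis
  proof (cases "isgood M \<and> i \<in> ?h ` ?D")
    case True
    then obtain p where p: "p \<in> ?D" "i = ?h p" by (elim conjE imageE)
    obtain t k l where "p = (t, k, l)" by (rule prod_cases3)
    then have tkl: "i = pr t k l" "k < kappa" "l < len" using p by simp_all
    have "avg M k \<in> tuples (universe (step M)) len" by (rule avg_tuples[OF M tkl(2)])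
    from tuples_nth[OF this tkl(3)] have a: "avg M k ! l \<in> universe (step M)" .
    have g: "isgood M" using True ..
    have "par M k ! l \<in> universe M" by (rule tuples_nth[OF par_tuples[OF g tkl(2)] tkl(3)])
    then have "par M k ! l \<in> universe (step M)" using sub by blast
    then show ?thesis using code_pr[OF g tkl(2,3)] a unfolding tkl(1) by (cases t) (simp_all only:)
  next
    case False
    have "ozero < oadd (hgt M) lam"
      using oadd_less[OF lam_pos, of "hgt M"] ozero_le[of "oadd (hgt M) ozero"] by (rule le_less_trans[rotated])
    then have "ozero \<in> universe (step M)" unfolding step_props(1)[OF M] by simp
    moreover have "code M i = ozero" using False unfolding code_def Let_def by (rule if_not_P)
    ultimately show ?thesis by simp
  qed
qed

text \<open>What the sequences of all four statements share: \<open>P g\<close> is the model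
  extended at stage \<open>g\<close>, and the limit members of \<open>N\<close> are compared. In (2)
  to (4) \<open>P g\<close> is the member of \<open>N\<close> with index 2g+1; in (1) it is the
  reply of a strategy to the members up to \<open>g\<close>.\<close>

definition admissible :: "('o \<Rightarrow> ('f, 'p, 'o) struct) \<Rightarrow> ('o \<Rightarrow> ('f, 'p, 'o) struct) \<Rightarrow> bool" where
  "admissible P N \<longleftrightarrow> (\<forall>g. P g \<in> EC_ord V T lam) \<and> (\<forall>g g'. g < g' \<longrightarrow> elem_sub V (step (P g)) (P g')) \<and>
     (\<forall>d. olimit d \<longrightarrow> is_struct V (N d) \<and> universe (N d) = (\<Union>g\<in>{..<d}. universe (P g)) \<and>
        (\<forall>g<d. elem_sub V (P g) (N d)))"

section \<open>Isomorphisms that match codes\<close>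

context
  fixes P N :: "'o \<Rightarrow> ('f, 'p, 'o) struct"
  assumes adm: "admissible P N"
begin

lemma P_EC: "P g \<in> EC_ord V T lam"
  using adm by (simp add: admissible_def)

lemma step_P: "g < g' \<Longrightarrow> elem_sub V (step (P g)) (P g')"
  using adm by (simp add: admissible_def)

lemma P_le: "g \<le> g' \<Longrightarrow> elem_sub V (P g) (P g')"
proof (cases "g = g'")
  case False
  assume "g \<le> g'"
  then have "elem_sub V (step (P g)) (P g')" using step_P False by simp
  then show ?thesis using elem_sub_trans step_props(2)[OF P_EC] by blast
qed (simp add: elem_sub_refl)

lemma N_limit:
  assumes "olimit d"
  shows "is_struct V (N d)" "universe (N d) = (\<Union>g\<in>{..<d}. universe (P g))"
    "g < d \<Longrightarrow> elem_sub V (P g) (N d)" "g < d \<Longrightarrow> elem_sub V (step (P g)) (N d)"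
proof -
  show "is_struct V (N d)" "universe (N d) = (\<Union>g\<in>{..<d}. universe (P g))"
    and 1: "g < d \<Longrightarrow> elem_sub V (P g) (N d)" for g
    using adm assms by (simp_all add: admissible_def)
  assume "g < d"
  then show "elem_sub V (step (P g)) (N d)"
    using elem_sub_trans[OF step_P[OF less_osuc] 1[OF limit_osuc[OF assms]]] by blast
qed

text \<open>\<open>P ozero\<close> itself may have no good sequence; its extension has one, and all
  later stages inherit the same parameters.\<close>

lemma P_good:
  assumes "ozero < g"
  shows "isgood (P g)" "par (P g) = par (step (P ozero))"
  using good_extend[OF step_P[OF assms] step_props(1)[OF P_EC] step_props(4)[OF P_EC]] by simp_all

lemma hgt_mono: "g < g' \<Longrightarrow> hgt (P g) < hgt (P g')"
proof -
  assume "g < g'"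
  then have "universe (step (P g)) \<subseteq> universe (P g')" using step_P by (simp add: elem_sub_def)
  moreover obtain b where b: "universe (P g') = {..<b}" using P_EC[of g'] by (auto simp: EC_ord_iff)
  ultimately have "oadd (hgt (P g)) lam \<le> b"
    using step_props(1)[OF P_EC] by (simp add: lessThan_subset_iff)
  moreover have "hgt (P g) < oadd (hgt (P g)) lam"
    using oadd_less[OF lam_pos, of "hgt (P g)"] by (simp add: oadd_ozero)
  ultimately show ?thesis using hgt[OF b] by simp
qed

lemma map_fix: "length a = len \<Longrightarrow> length b = len \<Longrightarrow> (\<And>l. l < len \<Longrightarrow> f (a ! l) = b ! l) \<Longrightarrow> map f a = b"
  by (auto intro: nth_equalityI)

lemma par_in_N:
  assumes "olimit d" "ozero < g" "g < d" "k < kappa"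
  shows "par (P g) k \<in> tuples (universe (N d)) len" "avg (P g) k \<in> tuples (universe (N d)) len"
    "avg (P g) k \<in> tuples (universe (step (P g))) len"
proof -
  have s: "universe (P g) \<subseteq> universe (N d)" "universe (step (P g)) \<subseteq> universe (N d)"
    using N_limit[OF assms(1)] assms(3) by (simp_all add: elem_sub_def)
  show "par (P g) k \<in> tuples (universe (N d)) len"
    using par_tuples[OF P_good(1)[OF assms(2)] assms(4)] s unfolding tuples_def by blast
  show a: "avg (P g) k \<in> tuples (universe (step (P g))) len"
    by (rule avg_tuples[OF P_EC assms(4)])
  show "avg (P g) k \<in> tuples (universe (N d)) len"
    using a s unfolding tuples_def by blast
qed

text \<open>The averages of stage \<open>g\<close> are controlled on elements of \<open>P g\<close>
  only, hence the assumption on \<open>b\<close>. Truth is moved from \<open>N d\<close> down to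
  \<open>step (P g)\<close>, where the ultrafilter returns the prescribed subset.\<close>

lemma avg_realizes:
  assumes d: "olimit d" and g: "ozero < g" "g < d" and b: "b \<in> universe (P g)" and k: "k < kappa" and z: "z < lam"
    and bz: "\<And>i. i < kappa \<Longrightarrow> rel (N d) b (par (P g) i) \<longleftrightarrow> i \<in> u z"
  shows "rel (N d) b (avg (P g) k) \<longleftrightarrow> k \<in> Vv (G (hgt (P g)) z)"
proof -
  have "rel (P g) b (par (P g) i) \<longleftrightarrow> i \<in> u z" if "i < kappa" for i
    using bz[OF that] rel_elem_sub[OF N_limit(3)[OF d g(2)] b par_tuples[OF P_good(1)[OF g(1)] that]] by simp
  then have e: "{i. i < kappa \<and> rel (P g) b (par (P g) i)} = u z" using u_sub[of z] by auto
  have bs: "b \<in> universe (step (P g))" using b step_props(2)[OF P_EC] by (auto simp: elem_sub_def)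
  have "rel (N d) b (avg (P g) k) \<longleftrightarrow> rel (step (P g)) b (avg (P g) k)"
    using rel_elem_sub[OF N_limit(4)[OF d g(2)] bs par_in_N(3)[OF d g k]] by simp
  also have "\<dots> \<longleftrightarrow> k \<in> hull_type (hgt (P g)) (u z)"
    using step_rel[OF P_EC P_good(1)[OF g(1)] b k] unfolding e .
  also have "\<dots> \<longleftrightarrow> k \<in> Vv (G (hgt (P g)) z)" using UU_u[OF k z] k by (simp add: hull_type_def)
  finally show ?thesis .
qed

text \<open>Two stages have eventually different functions once their labels differ. Since
  \<open>d1 < d2\<close>, the label of \<open>e2 \<epsilon>\<close> exceeds that of
  \<open>e1 \<epsilon>\<close> as soon as \<open>d1 \<le> e2 \<epsilon>\<close>, and such
  \<open>\<epsilon>\<close> still make \<open>e2\<close> cofinal in \<open>d2\<close>; they form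
  \<open>E'\<close>.\<close>

lemma no_coding_iso_less:
  assumes d: "olimit d1" "olimit d2" "d1 < d2"
    and E: "\<And>\<epsilon>. \<epsilon> \<in> E \<Longrightarrow> \<epsilon> < theta \<and> ozero < e1 \<epsilon> \<and> e1 \<epsilon> < d1 \<and> ozero < e2 \<epsilon> \<and> e2 \<epsilon> < d2"
    and cof: "\<And>b. b < d2 \<Longrightarrow> \<exists>\<epsilon>\<in>E. b \<le> e2 \<epsilon>"
    and f: "is_isomorphism V (N d1) (N d2) f"
    and fcode: "\<And>\<epsilon> i. \<epsilon> \<in> E \<Longrightarrow> i < kappa \<Longrightarrow> f (code (P (e1 \<epsilon>)) i) = code (P (e2 \<epsilon>)) i"
  shows False
proof -
  define c where "c = par (step (P ozero))"
  define E' where "E' = {\<epsilon> \<in> E. d1 \<le> e2 \<epsilon>}"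
  have par_c: "par (P g) = c" if "ozero < g" for g using P_good(2)[OF that] by (simp add: c_def)
  have E': "\<epsilon> < theta" "ozero < e1 \<epsilon>" "e1 \<epsilon> < d1" "ozero < e2 \<epsilon>" "e2 \<epsilon> < d2" "d1 \<le> e2 \<epsilon>" "\<epsilon> \<in> E"
    if "\<epsilon> \<in> E'" for \<epsilon>
    using E that by (simp_all add: E'_def)
  have lt: "hgt (P (e1 \<epsilon>)) < hgt (P (e2 \<epsilon>))" if "\<epsilon> \<in> E'" for \<epsilon>
    using hgt_mono E'(3,6)[OF that] by simp
  have fpar: "map f (c i) = c i" and favg: "map f (avg (P (e1 \<epsilon>)) i) = avg (P (e2 \<epsilon>)) i"
    if "\<epsilon> \<in> E'" "i < kappa" for \<epsilon> i
  proof -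
    note e = E'[OF that(1)]
    have tup: "c i \<in> tuples (universe (N d1)) len" "avg (P (e1 \<epsilon>)) i \<in> tuples (universe (N d1)) len"
      "avg (P (e2 \<epsilon>)) i \<in> tuples (universe (N d2)) len"
      using par_in_N[OF d(1) e(2,3) that(2)] par_in_N[OF d(2) e(4,5) that(2)] par_c[OF e(2)] by simp_all
    show "map f (c i) = c i"
    proof (rule map_fix)
      fix l assume l: "l < len"
      show "f (c i ! l) = c i ! l"
        using fcode[OF e(7) pr_less[OF that(2)], of False l]
          code_pr(2)[OF P_good(1)[OF e(2)] that(2) l] code_pr(2)[OF P_good(1)[OF e(4)] that(2) l]
        by (simp add: par_c e)
    qed (use tup in \<open>simp_all add: tuples_def\<close>)
    show "map f (avg (P (e1 \<epsilon>)) i) = avg (P (e2 \<epsilon>)) i"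
    proof (rule map_fix)
      fix l assume l: "l < len"
      show "f (avg (P (e1 \<epsilon>)) i ! l) = avg (P (e2 \<epsilon>)) i ! l"
        using fcode[OF e(7) pr_less[OF that(2)], of True l]
          code_pr(1)[OF P_good(1)[OF e(2)] that(2) l] code_pr(1)[OF P_good(1)[OF e(4)] that(2) l]
        by simp
    qed (use tup in \<open>simp_all add: tuples_def\<close>)
  qed
  show False
  \<comment> \<open>The bound attached to \<open>\<epsilon>\<close> is the one beyond which the
    functions of the two stages never agree.\<close>
  proof (rule not_cofinal_theta[of E' "\<lambda>\<epsilon>. q (hgt (P (e2 \<epsilon>))) (hgt (P (e1 \<epsilon>)))"])
    show "\<epsilon> < theta \<and> q (hgt (P (e2 \<epsilon>))) (hgt (P (e1 \<epsilon>))) < lam" if "\<epsilon> \<in> E'" for \<epsilon>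
      using q_less[OF lt[OF that]] E'(1)[OF that] by simp
    fix z assume z: "z < lam"
    have g0: "good (step (P ozero)) (LEAST \<xi>. \<exists>c. good (step (P ozero)) \<xi> c) c"
      unfolding c_def by (rule par_good[OF step_props(4)[OF P_EC]])
    \<comment> \<open>The witness for \<open>u z\<close> is taken in the first extension, so it
      belongs to every \<open>P (e1 \<epsilon>)\<close>; only its image \<open>f b\<close> has to be
      waited for.\<close>
    then obtain b where b: "b < (LEAST \<xi>. \<exists>c. good (step (P ozero)) \<xi> c)"
      "\<forall>i<kappa. rel (step (P ozero)) b (c i) \<longleftrightarrow> i \<in> u z"
      using u_sub[of z] unfolding good_def by blast
    then have bu: "b \<in> universe (step (P ozero))" using g0 by (auto simp: good_def)
    have d10: "ozero < d1" using d(1) by (simp add: olimit_alt)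
    have sN: "elem_sub V (step (P ozero)) (N d1)" by (rule N_limit(4)[OF d(1) d10])
    have bN: "b \<in> universe (N d1)" using bu sN by (auto simp: elem_sub_def)
    have "f b \<in> universe (N d2)" using iso_bij[OF f] bN by (auto simp: bij_betw_def)
    then obtain g where g: "g < d2" "f b \<in> universe (P g)" using N_limit(2)[OF d(2)] by auto
    \<comment> \<open>A stage past \<open>d1\<close> makes the labels different, and a stage past
      \<open>g\<close> contains \<open>f b\<close>.\<close>
    have "max d1 g < d2" using d(3) g(1) by simp
    then obtain \<epsilon> where "\<epsilon> \<in> E" "max d1 g \<le> e2 \<epsilon>" using cof by blast
    then have \<epsilon>: "\<epsilon> \<in> E'" "g \<le> e2 \<epsilon>" by (simp_all add: E'_def)
    note e = E'[OF \<epsilon>(1)]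
    have b1: "b \<in> universe (P (e1 \<epsilon>))" using bu step_P[OF e(2)] by (auto simp: elem_sub_def)
    have b2: "f b \<in> universe (P (e2 \<epsilon>))" using g(2) P_le[OF \<epsilon>(2)] by (auto simp: elem_sub_def)
    have c0: "c i \<in> tuples (universe (step (P ozero))) len" if "i < kappa" for i
      unfolding c_def by (rule par_tuples[OF step_props(4)[OF P_EC] that])
    have r1: "rel (N d1) b (c i) \<longleftrightarrow> i \<in> u z" if "i < kappa" for i
      using b(2) that rel_elem_sub[OF sN bu c0[OF that]] by simp
    have cN: "c i \<in> tuples (universe (N d1)) len" if "i < kappa" for i
      using par_in_N(1)[OF d(1) e(2,3) that] by (simp add: par_c e)
    have r2: "rel (N d2) (f b) (c i) \<longleftrightarrow> i \<in> u z" if "i < kappa" for i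
      using rel_iso[OF N_limit(1)[OF d(1)] f bN cN[OF that]] r1[OF that] fpar[OF \<epsilon>(1) that] by simp
    have "k \<in> Vv (G (hgt (P (e1 \<epsilon>))) z) \<longleftrightarrow> k \<in> Vv (G (hgt (P (e2 \<epsilon>))) z)" if k: "k < kappa" for k
    proof -
      have "k \<in> Vv (G (hgt (P (e1 \<epsilon>))) z) \<longleftrightarrow> rel (N d1) b (avg (P (e1 \<epsilon>)) k)"
        using avg_realizes[OF d(1) e(2,3) b1 k z] r1 by (simp add: par_c e)
      also have "\<dots> \<longleftrightarrow> rel (N d2) (f b) (avg (P (e2 \<epsilon>)) k)"
        using rel_iso[OF N_limit(1)[OF d(1)] f bN par_in_N(2)[OF d(1) e(2,3) k]] favg[OF \<epsilon>(1) k] by simp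
      also have "\<dots> \<longleftrightarrow> k \<in> Vv (G (hgt (P (e2 \<epsilon>))) z)"
        using avg_realizes[OF d(2) e(4,5) b2 k z] r2 by (simp add: par_c e)
      finally show ?thesis .
    qed
    then have "Vv (G (hgt (P (e1 \<epsilon>))) z) = Vv (G (hgt (P (e2 \<epsilon>))) z)"
      using Vv_sub[OF G_less[OF z]] by blast
    then have "G (hgt (P (e2 \<epsilon>))) z = G (hgt (P (e1 \<epsilon>))) z"
      using inj_onD[OF Vv_inj] G_less[OF z] by simp
    from G_eq[OF lt[OF \<epsilon>(1)] z this]
    show "\<exists>\<epsilon>\<in>E'. z \<le> q (hgt (P (e2 \<epsilon>))) (hgt (P (e1 \<epsilon>)))" using \<epsilon>(1) by blast
  qed
qed

lemma code_in_N: "olimit d \<Longrightarrow> g < d \<Longrightarrow> code (P g) i \<in> universe (N d)"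
  using N_limit(4)[of d g] code_in[OF P_EC, of g i] by (auto simp: elem_sub_def)

lemma no_coding_iso:
  assumes d: "olimit d1" "olimit d2" "d1 \<noteq> d2"
    and E: "\<And>\<epsilon>. \<epsilon> \<in> E \<Longrightarrow> \<epsilon> < theta \<and> ozero < e1 \<epsilon> \<and> e1 \<epsilon> < d1 \<and> ozero < e2 \<epsilon> \<and> e2 \<epsilon> < d2"
    and cof1: "\<And>b. b < d1 \<Longrightarrow> \<exists>\<epsilon>\<in>E. b \<le> e1 \<epsilon>" and cof2: "\<And>b. b < d2 \<Longrightarrow> \<exists>\<epsilon>\<in>E. b \<le> e2 \<epsilon>"
    and f: "is_isomorphism V (N d1) (N d2) f"
    and fcode: "\<And>\<epsilon> i. \<epsilon> \<in> E \<Longrightarrow> i < kappa \<Longrightarrow> f (code (P (e1 \<epsilon>)) i) = code (P (e2 \<epsilon>)) i"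
  shows False
proof (cases "d1 < d2")
  case True
  show False by (rule no_coding_iso_less[OF d(1,2) True E cof2 f fcode])
next
  case False
  then have lt: "d2 < d1" using d(3) by simp
  let ?f = "inv_into (universe (N d1)) f"
  have "inj_on f (universe (N d1))" using iso_bij[OF f] by (simp add: bij_betw_def)
  then have inv: "?f (code (P (e2 \<epsilon>)) i) = code (P (e1 \<epsilon>)) i" if "\<epsilon> \<in> E" "i < kappa" for \<epsilon> i
    using inv_into_f_f code_in_N[OF d(1)] E[OF that(1)] fcode[OF that] by metis
  show False
    by (rule no_coding_iso_less[OF d(2,1) lt _ cof1 isomorphism_inv[OF N_limit(1)[OF d(1)] f] inv])
      (use E in auto)
qed

text \<open>For each such \<open>d\<close> an isomorphism carries the codes along a cofinal sequence
  into \<open>Q\<close>. Equal images for two limits would give an isomorphism that matches codes,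
  so by \<open>card_Func\<close> there are at most \<lambda> such limits, and \<lambda>^+ is
  regular.\<close>

lemma isomorphic_bounded:
  fixes Q :: "('f, 'p, 'm) struct"
  assumes st: "is_struct V Q" and card: "|universe Q| \<le>o |{..<lam}|"
  obtains b where "\<And>d. cf d = theta \<Longrightarrow> isomorphic V (N d) Q \<Longrightarrow> d < b"
proof -
  define S where "S = {d. cf d = theta \<and> isomorphic V (N d) Q}"
  define f where "f = (\<lambda>d. SOME f. is_isomorphism V (N d) Q f)"
  have f: "is_isomorphism V (N d) Q (f d)" if "d \<in> S" for d
    using that someI_ex[of "is_isomorphism V (N d) Q"] unfolding S_def isomorphic_def f_def by blast
  have lim: "olimit d" if "d \<in> S" for d using cf_theta_limit that by (simp add: S_def)
  define e where "e = (\<lambda>d :: 'o. SOME e :: 'o \<Rightarrow> 'o. \<forall>i<theta. e i < d \<and> ozero < e i \<and> (\<forall>b<d. \<exists>i<theta. b \<le> e i))"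
  have e: "\<forall>i<theta. e d i < d \<and> ozero < e d i \<and> (\<forall>b<d. \<exists>i<theta. b \<le> e d i)" if d: "d \<in> S" for d
  proof -
    obtain h where h: "\<forall>i<theta. h i < d" "\<forall>b<d. \<exists>i<theta. b \<le> h i"
      using cf_cofinal[of d] d by (auto simp: S_def)
    have "osuc ozero < d" using lim[OF d] by (simp add: olimit_alt)
    \<comment> \<open>Stages are raised to at least one, because stage \<open>ozero\<close> need not
      carry a good sequence. The cofinal map may be neither monotone nor continuous.\<close>
    then have "\<forall>i<theta. max (osuc ozero) (h i) < d \<and> ozero < max (osuc ozero) (h i) \<and>
        (\<forall>b<d. \<exists>i<theta. b \<le> max (osuc ozero) (h i))"
      using h by (auto simp: less_max_iff_disj le_max_iff_disj)
    then have "\<exists>e. \<forall>i<theta. e i < d \<and> ozero < e i \<and> (\<forall>b<d. \<exists>i<theta. b \<le> e i)"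
      by (intro exI[of _ "\<lambda>i. max (osuc ozero) (h i)"])
    then show ?thesis unfolding e_def by (rule someI_ex)
  qed
  define F where "F = (\<lambda>d p. if p \<in> {..<theta} \<times> {..<kappa}
    then f d (code (P (e d (fst p))) (snd p)) else undefined)"
  have F: "F d \<in> Func ({..<theta} \<times> {..<kappa}) (universe Q)" if d: "d \<in> S" for d
  proof -
    have "f d (code (P (e d i)) k) \<in> universe Q" if "i < theta" for i k
      using code_in_N[OF lim[OF d], of "e d i" k] e[OF d] that iso_bij[OF f[OF d]] by (auto simp: bij_betw_def)
    then show ?thesis by (auto simp: Func_def F_def)
  qed
  have "inj_on F S"
  proof (rule inj_onI, rule ccontr)
    fix d1 d2 assume d: "d1 \<in> S" "d2 \<in> S" "F d1 = F d2" "d1 \<noteq> d2"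
    let ?g = "inv_into (universe (N d2)) (f d2)"
    have g: "is_isomorphism V (N d1) (N d2) (?g \<circ> f d1)"
      by (rule isomorphism_comp[OF f[OF d(1)] isomorphism_inv[OF N_limit(1)[OF lim[OF d(2)]] f[OF d(2)]]])
    have inj: "inj_on (f d2) (universe (N d2))" using iso_bij[OF f[OF d(2)]] by (simp add: bij_betw_def)
    have "(?g \<circ> f d1) (code (P (e d1 i)) k) = code (P (e d2 i)) k" if "i < theta" "k < kappa" for i k
    proof -
      have "F d1 (i, k) = F d2 (i, k)" using d(3) by simp
      then have "f d1 (code (P (e d1 i)) k) = f d2 (code (P (e d2 i)) k)" using that by (simp add: F_def)
      moreover have "code (P (e d2 i)) k \<in> universe (N d2)"
        using code_in_N[OF lim[OF d(2)]] e[OF d(2)] that(1) by blast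
      ultimately show ?thesis using inv_into_f_f[OF inj] by simp
    qed
    moreover have "\<exists>i\<in>{..<theta}. b \<le> e d1 i" if "b < d1" for b using e[OF d(1)] that theta_pos by blast
    moreover have "\<exists>i\<in>{..<theta}. b \<le> e d2 i" if "b < d2" for b using e[OF d(2)] that theta_pos by blast
    ultimately show False
      using no_coding_iso[OF lim[OF d(1)] lim[OF d(2)] d(4), of "{..<theta}" "e d1" "e d2" "?g \<circ> f d1"] g
        e[OF d(1)] e[OF d(2)] by simp
  qed
  then have "|S| \<le>o |Func ({..<theta} \<times> {..<kappa}) (universe Q)|" using F by (rule card_of_ordLeqI)
  then have "|S| \<le>o |{..<lam}|" using card_Func[OF card] ordLeq_transitive by blast
  then show ?thesis
  proof (rule small_bounded)
    fix b assume b: "\<And>d. d \<in> S \<Longrightarrow> d < b"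
    show ?thesis by (rule that[of b], rule b) (simp add: S_def)
  qed
qed

end

lemma not_stationary_bounded:
  assumes "\<And>d. d \<in> S \<Longrightarrow> d < (b :: 'o)"
  shows "\<not> stationary S"
proof -
  have "club {b..}"
    unfolding club_def
  proof (intro conjI allI impI)
    fix a
    have "b \<le> max b (osuc a)" "a < max b (osuc a)" by (simp_all add: less_max_iff_disj)
    then show "\<exists>c\<in>{b..}. a < c" by (intro bexI[of _ "max b (osuc a)"]) simp_all
  next
    fix d assume d: "olimit d \<and> (\<forall>a<d. \<exists>c\<in>{b..}. a < c \<and> c < d)"
    then obtain a where "a < d" by (auto simp: olimit_def)
    then obtain c where "b \<le> c" "c < d" using d by auto
    then show "d \<in> {b..}" by simp
  qed
  moreover have "S \<inter> {b..} = {}" using assms by fastforce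
  ultimately show ?thesis unfolding stationary_def by blast
qed

end

section \<open>Sequences of models\<close>

context ordinals
begin

lemma oadd_ge_right: "(b :: 'o) \<le> oadd a b"
proof (induction b rule: less_induct)
  case (less b)
  show ?case
  proof (rule ccontr)
    assume "\<not> b \<le> oadd a b"
    then have lt: "oadd a b < b" by simp
    from less.IH[OF lt] oadd_less[OF lt, of a] show False by simp
  qed
qed

lemma ordinal_cases:
  obtains "(g :: 'o) = ozero" | g' where "g = osuc g'" | "olimit g"
proof (cases "\<exists>g'. g = osuc g'")
  case False
  have "olimit g" if "g \<noteq> ozero"
    unfolding olimit_alt
  proof (intro conjI allI impI)
    show "ozero < g" using that le_neq_trans[OF ozero_le[of g]] by auto
    fix a assume "a < g"
    then have "osuc a \<le> g" by (rule osuc_le)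
    then show "osuc a < g" using False by (metis order_le_less)
  qed
  then show ?thesis using that(1,3) by blast
qed (use that(2) in blast)

lemma osuc_inj: "osuc (a :: 'o) = osuc b \<Longrightarrow> a = b"
  by (metis antisym less_osuc less_osuc_iff)

lemma osuc_neq: "osuc (a :: 'o) \<noteq> ozero" "\<not> olimit (osuc (a :: 'o))"
proof -
  show "osuc a \<noteq> ozero" using less_osuc[of a] not_less_ozero by metis
  show "\<not> olimit (osuc a)" using limit_osuc[of "osuc a" a] less_osuc by blast
qed

lemma ozero_not_limit: "\<not> olimit (ozero :: 'o)"
  by (simp add: olimit_alt)

lemma down_closed_initial:
  fixes A :: "'o set"
  assumes "\<And>a b. a \<in> A \<Longrightarrow> b < a \<Longrightarrow> b \<in> A" "c \<notin> A"
  obtains b where "A = {..<b}"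
proof -
  define b where "b = (LEAST b. b \<notin> A)"
  have b: "b \<notin> A" unfolding b_def by (rule LeastI[of _ c]) (rule assms(2))
  have "a < b" if "a \<in> A" for a
  proof (rule ccontr)
    assume "\<not> a < b"
    then have "b = a \<or> b < a" by auto
    then show False using b assms(1)[OF that] that by auto
  qed
  moreover have "a \<in> A" if "a < b" for a using not_less_Least[of a "\<lambda>b. b \<notin> A"] that by (simp add: b_def)
  ultimately have "A = {..<b}" by auto
  then show ?thesis by (rule that)
qed

end

text \<open>Makes recursion through limits possible: the union depends on the earlier members only,
  in spite of the \<open>SOME\<close> in its functions.\<close>

lemma chain_union_cong:
  assumes "\<And>i. i \<in> I \<Longrightarrow> Ms i = Ns i"
  shows "chain_union I Ms = chain_union I Ns"
proof -
  have e: "(i \<in> I \<and> set xs \<subseteq> universe (Ms i)) = (i \<in> I \<and> set xs \<subseteq> universe (Ns i))" for i and xs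
    using assms by auto
  have "fint (Ms (SOME i. i \<in> I \<and> set xs \<subseteq> universe (Ms i))) = fint (Ns (SOME i. i \<in> I \<and> set xs \<subseteq> universe (Ms i)))"
    if "\<exists>i. i \<in> I \<and> set xs \<subseteq> universe (Ms i)" for xs
    using someI_ex[OF that] assms by simp
  then have "(if \<exists>i\<in>I. set xs \<subseteq> universe (Ms i)
      then fint (Ms (SOME i. i \<in> I \<and> set xs \<subseteq> universe (Ms i))) s xs else undefined) =
    (if \<exists>i\<in>I. set xs \<subseteq> universe (Ns i)
      then fint (Ns (SOME i. i \<in> I \<and> set xs \<subseteq> universe (Ns i))) s xs else undefined)" for s xs
    unfolding Bex_def e[symmetric] by auto
  then show ?thesis using assms by (simp add: chain_union_def)
qed

section \<open>Sequences that follow the step function\<close>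

context coded_setting
begin

lemma K_EC_ord: "M \<in> K V T lam a \<Longrightarrow> M \<in> EC_ord V T lam"
proof -
  assume M: "M \<in> K V T lam a"
  have "osuc ozero \<le> oadd (osuc ozero) a" by (rule oadd_ge)
  then have "ozero < oadd (osuc ozero) a" using less_osuc by (rule less_le_trans[rotated])
  then have "oadd (omul lam ozero) lam \<le> omul lam (oadd (osuc ozero) a)" by (rule omul_ge)
  then have "lam \<le> omul lam (oadd (osuc ozero) a)" using oadd_ge_right by (rule order_trans[rotated])
  then show ?thesis using M unfolding EC_ord_iff K_def by blast
qed

text \<open>The universe of \<open>step M\<close> was chosen for this: \<lambda>(1+\<alpha>) +
  \<lambda> = \<lambda>(1+(\<alpha>+1)).\<close>

lemma step_K:
  assumes M: "M \<in> K V T lam a"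
  shows "step M \<in> K V T lam (osuc a)"
proof -
  have "universe M = {..<omul lam (oadd (osuc ozero) a)}" using M by (simp add: K_def)
  then have "hgt M = omul lam (oadd (osuc ozero) a)" by (rule hgt)
  then show ?thesis
    using step_props(1,3)[OF K_EC_ord[OF M]] by (simp add: K_def oadd_osuc omul_osuc)
qed

lemma EC_ord_struct: "M \<in> EC_ord V T lam \<Longrightarrow> is_struct V M"
  by (simp add: EC_ord_iff Mod_def)

lemma EC_ord_card: "M \<in> EC_ord V T lam \<Longrightarrow> |universe M| \<le>o |{..<lam}|"
  using card_initial by (auto simp: EC_ord_iff)

text \<open>The member with index \<open>g\<close> lies inside the one with index 2g+1, whose index
  stays below a limit \<open>d\<close> by \<open>odouble_limit\<close>; so below \<open>d\<close>
  the odd members have the same union.\<close>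

lemma admissible_seq:
  assumes Ms: "\<And>a. Ms a \<in> EC_ord V T lam" and inc: "inc_cont V UNIV Ms"
    and st: "\<And>a. Ms (osuc (osuc (odouble a))) = step (Ms (osuc (odouble a)))"
  shows "admissible (\<lambda>g. Ms (osuc (odouble g))) Ms"
  unfolding admissible_def
proof (intro conjI allI impI)
  have sub: "elem_sub V (Ms i) (Ms j)" if "i < j" for i j using inc that by (simp add: inc_cont_def)
  show "Ms (osuc (odouble g)) \<in> EC_ord V T lam" for g by (rule Ms)
  show "elem_sub V (step (Ms (osuc (odouble g)))) (Ms (osuc (odouble g')))" if "g < g'" for g g'
    unfolding st[symmetric]
    by (rule sub) (use odouble_step[OF that] in \<open>simp add: less_osuc_iff\<close>)
  fix d :: 'o assume d: "olimit d"
  have dl: "osuc (odouble g) < d" if "g < d" for g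
    by (rule limit_osuc[OF d odouble_limit[OF d that]])
  show "is_struct V (Ms d)" by (rule EC_ord_struct[OF Ms])
  show "elem_sub V (Ms (osuc (odouble g))) (Ms d)" if "g < d" for g by (rule sub[OF dl[OF that]])
  have "Ms d = chain_union {..<d} Ms" using inc d by (simp add: inc_cont_def)
  then have "universe (Ms d) = (\<Union>g\<in>{..<d}. universe (Ms g))" by (simp add: chain_union_def)
  also have "\<dots> = (\<Union>g\<in>{..<d}. universe (Ms (osuc (odouble g))))"
  proof (rule antisym)
    show "(\<Union>g\<in>{..<d}. universe (Ms g)) \<subseteq> (\<Union>g\<in>{..<d}. universe (Ms (osuc (odouble g))))"
    proof (rule UN_mono)
      fix g :: 'o
      have "g < osuc (odouble g)" by (simp add: less_osuc_iff odouble_ge)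
      then show "universe (Ms g) \<subseteq> universe (Ms (osuc (odouble g)))" using sub by (simp add: elem_sub_def)
    qed simp
    show "(\<Union>g\<in>{..<d}. universe (Ms (osuc (odouble g)))) \<subseteq> (\<Union>g\<in>{..<d}. universe (Ms g))"
      using dl by (intro UN_least UN_upper) simp
  qed
  finally show "universe (Ms d) = (\<Union>g\<in>{..<d}. universe (Ms (osuc (odouble g))))" .
qed

lemma not_stationary_iso:
  assumes adm: "admissible P Ms" and Q: "Q \<in> EC_ord V T lam"
  shows "\<not> stationary {d. isomorphic V (Ms d) Q \<and> cf d = theta}"
proof -
  obtain b where b: "\<And>d. cf d = theta \<Longrightarrow> isomorphic V (Ms d) Q \<Longrightarrow> d < b"
    by (rule isomorphic_bounded[OF adm EC_ord_struct[OF Q] EC_ord_card[OF Q]]) (rule that, assumption+)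
  show ?thesis by (rule not_stationary_bounded[of _ b]) (use b in simp)
qed

text \<open>Index \<open>ozero\<close> is discarded because \<open>e ozero\<close> may be stage
  \<open>ozero\<close>, where no good sequence is guaranteed; the positive indices remain cofinal
  since \<theta> is a limit.\<close>

lemma seq_limit_E:
  assumes e: "inc_cont_ords theta e" "seq_limit e theta d"
  shows "olimit d" "\<And>i. ozero < i \<Longrightarrow> i < theta \<Longrightarrow> ozero < e i \<and> e i < d"
    "\<And>b. b < d \<Longrightarrow> \<exists>i. i < theta \<and> ozero < i \<and> (\<forall>j. i \<le> j \<longrightarrow> j < theta \<longrightarrow> b \<le> e j)"
proof -
  have mono: "e i < e j" if "i < j" "j < theta" for i j
    using strict_mono_onD[of "{..<theta}" e i j] e(1) that by (simp add: inc_cont_ords_def)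
  have lt: "e i < d" if "i < theta" for i using e(2) that by (simp add: seq_limit_def)
  have cof: "\<exists>i<theta. b < e i" if "b < d" for b using e(2) that by (simp add: seq_limit_def)
  show "olimit d"
    unfolding olimit_def
  proof (intro conjI allI impI)
    show "\<exists>a. a < d" using lt[OF theta_pos] by (rule exI)
    show "\<exists>b<d. a < b" if "a < d" for a using cof[OF that] lt by auto
  qed
  show "ozero < e i \<and> e i < d" if "ozero < i" "i < theta" for i
  proof -
    have "ozero < e i" using mono[OF that] ozero_le[of "e ozero"] by (rule le_less_trans[rotated])
    then show ?thesis using lt[OF that(2)] by simp
  qed
  show "\<exists>i. i < theta \<and> ozero < i \<and> (\<forall>j. i \<le> j \<longrightarrow> j < theta \<longrightarrow> b \<le> e j)" if "b < d" for b
  proof -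
    obtain i where i: "i < theta" "b < e i" using cof \<open>b < d\<close> by auto
    have "osuc i < theta" by (rule limit_osuc[OF theta_limit i(1)])
    moreover have "ozero < osuc i" using ozero_le[of i] less_osuc[of i] by (rule le_less_trans)
    moreover have "b \<le> e j" if "osuc i \<le> j" "j < theta" for j
    proof -
      have "i < j" using less_osuc[of i] that(1) by (rule less_le_trans)
      then show ?thesis using mono[of i j] that(2) i(2) by simp
    qed
    ultimately show ?thesis by auto
  qed
qed

lemma no_coding_iso_seq:
  assumes adm: "admissible P Ms"
    and e1: "inc_cont_ords theta e1" "seq_limit e1 theta a1"
    and e2: "inc_cont_ords theta e2" "seq_limit e2 theta a2" and ne: "a1 \<noteq> a2"
    and f: "is_isomorphism V (Ms a1) (Ms a2) f"
    and fc: "\<forall>\<epsilon><theta. \<forall>i<kappa. f (code (P (e1 \<epsilon>)) i) = code (P (e2 \<epsilon>)) i"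
  shows False
proof (rule no_coding_iso[OF adm seq_limit_E(1)[OF e1] seq_limit_E(1)[OF e2] ne, of "{i. i < theta \<and> ozero < i}" e1 e2])
  show "\<epsilon> < theta \<and> ozero < e1 \<epsilon> \<and> e1 \<epsilon> < a1 \<and> ozero < e2 \<epsilon> \<and> e2 \<epsilon> < a2"
    if "\<epsilon> \<in> {i. i < theta \<and> ozero < i}" for \<epsilon>
    using that seq_limit_E(2)[OF e1] seq_limit_E(2)[OF e2] by simp
  show "\<exists>\<epsilon>\<in>{i. i < theta \<and> ozero < i}. b \<le> e1 \<epsilon>" if "b < a1" for b
    using seq_limit_E(3)[OF e1 that] by auto
  show "\<exists>\<epsilon>\<in>{i. i < theta \<and> ozero < i}. b \<le> e2 \<epsilon>" if "b < a2" for b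
    using seq_limit_E(3)[OF e2 that] by auto
  show "is_isomorphism V (Ms a1) (Ms a2) f" by (rule f)
  show "f (code (P (e1 \<epsilon>)) i) = code (P (e2 \<epsilon>)) i"
    if "\<epsilon> \<in> {i. i < theta \<and> ozero < i}" "i < kappa" for \<epsilon> i
    using fc that by simp
qed

text \<open>The strategy \<open>F\<close> and \<open>step\<close> alternate:
  \<open>N (osuc g)\<close> is \<open>step\<close> of the reply of \<open>F\<close> to the sequence
  up to \<open>g\<close>. So \<open>N\<close> obeys \<open>F\<close> and is admissible as well; its
  limits of cofinality \<theta> would all be isomorphic to \<open>M\<close>, while
  \<open>isomorphic_bounded\<close> bounds those that are.\<close>

lemma no_md_limit:
  fixes M :: "('f, 'p, 'm) struct"
  shows "\<not> md_limit V T lam theta M"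
proof
  assume "md_limit V T lam theta M"
  then obtain F :: "'o \<Rightarrow> ('o \<Rightarrow> ('f, 'p, 'o) struct) \<Rightarrow> ('f, 'p, 'o) struct" where
    M: "M \<in> EC V T lam"
    and F: "\<forall>i Ms. inc_cont V {..i} Ms \<and> (\<forall>j\<le>i. Ms j \<in> EC_ord V T lam) \<longrightarrow>
           F i (restrict Ms {..i}) \<in> EC_ord V T lam \<and> elem_sub V (Ms i) (F i (restrict Ms {..i}))"
    and lim: "\<forall>d Ms. olimit d \<and> cf d = theta \<and>
           inc_cont V {..<d} Ms \<and> (\<forall>i<d. Ms i \<in> EC_ord V T lam) \<and>
           (\<forall>i<d. elem_sub V (Ms (osuc i)) (F (osuc i) (restrict Ms {..osuc i})) \<and>
                  elem_sub V (F (osuc i) (restrict Ms {..osuc i})) (Ms (osuc (osuc i)))) \<longrightarrow>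
           isomorphic V M (chain_union {..<d} Ms)"
    unfolding md_limit_def by (elim conjE exE)
  have stM: "is_struct V M" and modM: "M \<in> Mod V T" and cM: "|universe M| =o |{..<lam}|"
    using M by (simp_all add: EC_def Mod_def)
  obtain h where "bij_betw h (universe M) {..<lam}" using cM card_of_ordIso by blast
  from transport_struct[OF stM this] obtain N0 where
    N0: "is_struct V N0" "universe N0 = {..<lam}" "is_isomorphism V M N0 h" by blast
  have N0_EC: "N0 \<in> EC_ord V T lam"
    using isomorphic_Mod[OF T_sent modM N0(1,3)] N0(2) by (auto simp: EC_ord_iff)
  \<comment> \<open>At a successor the predecessor is recovered by \<open>SOME\<close>; the strategy
    is consulted at every stage, which includes the successor stages of the definition.\<close>
  define H where "H = (\<lambda>(N :: 'o \<Rightarrow> ('f, 'p, 'o) struct) g.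
    if g = ozero then N0 else if olimit g then chain_union {..<g} N
    else step (F (SOME g'. g = osuc g') (restrict N {..<g})))"
  have "\<exists>N. \<forall>g. N g = H N g"
  proof (rule dependent_wf_choice[of "{(x :: 'o, y). x < y}"])
    show "wf {(x :: 'o, y). x < y}" by (rule wf)
    show "(r = H f g) = (r = H f' g)" if "\<And>z. (z, g) \<in> {(x, y). x < y} \<Longrightarrow> f z = f' z" for f f' r g
    proof -
      have e: "f z = f' z" if "z \<in> {..<g}" for z
        using \<open>\<And>z. (z, g) \<in> {(x, y). x < y} \<Longrightarrow> f z = f' z\<close>[of z] that by simp
      have "restrict f {..<g} = restrict f' {..<g}" by (rule restrict_ext) (rule e)
      moreover have "chain_union {..<g} f = chain_union {..<g} f'" by (rule chain_union_cong) (rule e)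
      ultimately show ?thesis by (simp add: H_def)
    qed
    show "\<exists>r. r = H f g" for g f by simp
  qed
  then obtain N where N: "\<And>g. N g = H N g" by blast
  define P where "P = (\<lambda>g. F g (restrict N {..g}))"
  have N_zero: "N ozero = N0" by (subst N) (simp add: H_def)
  have N_limit: "N g = chain_union {..<g} N" if "olimit g" for g
    by (subst N) (use that ozero_not_limit in \<open>auto simp: H_def\<close>)
  have N_suc: "N (osuc g) = step (P g)" for g
  proof -
    have "(SOME g'. osuc g = osuc g') = g" by (rule some_equality) (auto dest: osuc_inj)
    moreover have "{..<osuc g} = {..g}" by (auto simp: less_osuc_iff)
    ultimately show ?thesis by (subst N) (simp add: H_def osuc_neq P_def)
  qed
  \<comment> \<open>Membership in \<open>EC_ord\<close> and the chain property are proved together,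
    as \<open>F\<close> is constrained only on sequences that have both.\<close>
  have inv: "N g \<in> EC_ord V T lam \<and> (\<forall>g'<g. elem_sub V (N g') (N g))" for g
  proof (induction g rule: less_induct)
    case (less g)
    show ?case
    proof (cases rule: ordinal_cases[of g])
      case 1
      then show ?thesis using N0_EC N_zero by simp
    next
      case (2 g')
      have le: "j < g" if "j \<le> g'" for j using that by (simp add: 2 less_osuc_iff)
      have "inc_cont V {..g'} N"
        unfolding inc_cont_def using less.IH[OF le] N_limit by auto
      then have P: "P g' \<in> EC_ord V T lam" "elem_sub V (N g') (P g')"
        using F less.IH[OF le] unfolding P_def by auto
      have s: "elem_sub V (N g') (N g)"
        using elem_sub_trans[OF P(2) step_props(2)[OF P(1)]] by (simp add: 2 N_suc)
      have "elem_sub V (N j) (N g)" if "j < g" for j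
      proof -
        have "j = g' \<or> j < g'" using that by (auto simp: 2 less_osuc_iff)
        then show ?thesis using s elem_sub_trans[OF _ s] less.IH[OF le[OF order_refl]] by auto
      qed
      then show ?thesis using step_props(5)[OF P(1)] by (simp add: 2 N_suc)
    next
      case 3
      interpret C: elem_chain V "{..<g}" N
      proof
        show "{..<g} \<noteq> {}" using 3 by (auto simp: olimit_def)
        show "is_struct V (N i)" if "i \<in> {..<g}" for i using less.IH that EC_ord_struct by simp
        show "elem_sub V (N i) (N j)" if "i \<in> {..<g}" "j \<in> {..<g}" "i < j" for i j
          using less.IH that by simp
      qed
      have sub: "elem_sub V (N j) (N g)" if "j < g" for j
        using C.elem_sub_union that by (simp add: N_limit[OF 3])
      have g0: "ozero < g" using 3 by (simp add: olimit_alt)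
      have univ: "universe (N g) = (\<Union>i\<in>{..<g}. universe (N i))"
        unfolding N_limit[OF 3] by (rule C.univ_union)
      have ini: "\<exists>b. universe (N i) = {..<b}" if "i < g" for i
        using less.IH[OF that] by (auto simp: EC_ord_iff)
      \<comment> \<open>At a limit the union must again be an ordinal: it is closed downwards, and
        it is a proper subset because it has at most \<lambda> elements.\<close>
      have small: "|universe (N g)| \<le>o |{..<lam}|"
        unfolding univ
        by (rule card_of_UNION_ordLeq_infinite[OF infinite_lam card_initial])
          (use less.IH EC_ord_card in simp)
      obtain c where c: "c \<notin> universe (N g)" using small_bounded[OF small] by (metis order_less_irrefl)
      have down: "b \<in> universe (N g)" if a: "a \<in> universe (N g)" "b < a" for a b
      proof -
        obtain i where i: "i < g" "a \<in> universe (N i)" using a(1) unfolding univ by auto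
        obtain b' where "universe (N i) = {..<b'}" using ini[OF i(1)] by auto
        then have "b \<in> universe (N i)" using i(2) a(2) by auto
        then show ?thesis unfolding univ using i(1) by auto
      qed
      have "\<exists>b. universe (N g) = {..<b}"
        by (rule down_closed_initial[OF _ c]) (erule (1) down, erule exI)
      then obtain b where b: "universe (N g) = {..<b}" ..
      have "universe (N ozero) \<subseteq> universe (N g)" using sub[OF g0] by (simp add: elem_sub_def)
      then have "lam \<le> b" by (simp add: N_zero N0 b lessThan_subset_iff)
      moreover have "N g \<in> Mod V T"
      proof (rule elem_sub_Mod[OF T_sent _ _ sub[OF g0]])
        show "N ozero \<in> Mod V T" using less.IH[OF g0] by (simp add: EC_ord_iff)
        show "is_struct V (N g)" unfolding N_limit[OF 3] by (rule C.struct_union)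
      qed
      ultimately have "N g \<in> EC_ord V T lam" using b by (auto simp: EC_ord_iff)
      then show ?thesis using sub by simp
    qed
  qed
  have N_EC: "N g \<in> EC_ord V T lam" for g using inv by simp
  have N_sub: "elem_sub V (N g) (N g')" if "g < g'" for g g' using inv that by simp
  have N_inc: "inc_cont V S N" for S unfolding inc_cont_def using N_sub N_limit by simp
  have P: "P g \<in> EC_ord V T lam" "elem_sub V (N g) (P g)" for g
    using F N_inc N_EC unfolding P_def by simp_all
  have PN: "elem_sub V (P g) (N (osuc g))" for g
    unfolding N_suc by (rule step_props(2)[OF P(1)])
  have adm: "admissible P N"
    unfolding admissible_def
  proof (intro conjI allI impI)
    show "P g \<in> EC_ord V T lam" for g by (rule P)
    show "elem_sub V (step (P g)) (P g')" if "g < g'" for g g'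
    proof -
      have "osuc g \<le> g'" by (rule osuc_le[OF that])
      then have "elem_sub V (N (osuc g)) (N g')"
        using N_sub[of "osuc g" g'] elem_sub_refl by (cases "osuc g = g'") simp_all
      then show ?thesis unfolding N_suc using P(2) by (rule elem_sub_trans)
    qed
    fix d :: 'o assume d: "olimit d"
    show "is_struct V (N d)" by (rule EC_ord_struct[OF N_EC])
    show Pd: "elem_sub V (P g) (N d)" if "g < d" for g
      by (rule elem_sub_trans[OF PN N_sub[OF limit_osuc[OF d that]]])
    have "universe (N d) = (\<Union>g\<in>{..<d}. universe (N g))" by (simp add: N_limit[OF d] chain_union_def)
    also have "\<dots> \<subseteq> (\<Union>g\<in>{..<d}. universe (P g))"
      by (rule UN_mono) (use P(2) in \<open>simp_all add: elem_sub_def\<close>)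
    finally show "universe (N d) = (\<Union>g\<in>{..<d}. universe (P g))"
      using Pd by (auto simp: elem_sub_def)
  qed
  obtain b where b: "\<And>d. cf d = theta \<Longrightarrow> isomorphic V (N d) M \<Longrightarrow> d < b"
    by (rule isomorphic_bounded[OF adm stM ordIso_imp_ordLeq[OF cM]]) (rule that, assumption+)
  \<comment> \<open>A limit of cofinality \<theta> that is not below the bound \<open>b\<close>,
    although the strategy makes its model isomorphic to \<open>M\<close>.\<close>
  define d where "d = oadd b theta"
  have cf: "cf d = theta" unfolding d_def by (rule cf_oadd_theta)
  have d: "olimit d" by (rule cf_theta_limit[OF cf])
  have "isomorphic V M (chain_union {..<d} N)"
  proof (rule lim[rule_format], intro conjI allI impI)
    show "elem_sub V (N (osuc i)) (F (osuc i) (restrict N {..osuc i}))"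
      "elem_sub V (F (osuc i) (restrict N {..osuc i})) (N (osuc (osuc i)))" for i
      using P(2)[of "osuc i"] PN[of "osuc i"] by (simp_all add: P_def)
  qed (use d cf N_inc N_EC in simp_all)
  then have "isomorphic V (N d) M"
    unfolding N_limit[OF d, symmetric] by (rule isomorphic_sym[OF stM])
  then have "d < b" by (rule b[OF cf])
  moreover have "b \<le> d" unfolding d_def by (rule oadd_ge)
  ultimately show False by simp
qed

end

section \<open>The four statements\<close>

theorem theorem2p9:
  fixes V :: "('f, 'p) vocab"
    and T :: "('f, 'p) fm set"
    and lam theta kappa :: "'o::wellorder"
  assumes order_type: "{(a :: 'o, b). a \<le> b} =o cardSuc |{..<lam}|"
    and cardinals: "infinite_cardinal lam" "infinite_cardinal theta" "infinite_cardinal kappa"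
    and complete: "complete_theory TYPE('o) V T"
    and independent: "independent_theory TYPE('o) V T"
    and T_card: "|{\<phi>. fm_over V \<phi>}| \<le>o |{..<lam}|"
    and lam_theta: "|{..<lam}| =o |{..<lam}| ^c |{..<theta}|"
    and lam_kappa: "|{..<lam}| =o ctwo ^c |{..<kappa}|"
    and theta: "theta < lam" "theta = cf theta"
  shows
    \<comment> \<open>(1)\<close>
    "(\<nexists>M :: ('f, 'p, 'm) struct. md_limit V T lam theta M) \<and>
    \<comment> \<open>(2)\<close>
     (\<exists>F. F \<in> extensional (\<Union>a\<in>{a. oodd a}. K V T lam a) \<and>
        (\<forall>a M. oodd a \<and> M \<in> K V T lam a \<longrightarrow> elem_sub V M (F M) \<and> F M \<in> K V T lam (osuc a)) \<and>
        (\<forall>Ms. (\<forall>a. Ms a \<in> K V T lam a) \<and> inc_cont V UNIV Ms \<and>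
              (\<forall>a. Ms (osuc (osuc (odouble a))) = F (Ms (osuc (odouble a)))) \<longrightarrow>
           (\<nexists>a. stationary {d. isomorphic V (Ms d) (Ms a) \<and> cf d = theta}))) \<and>
    \<comment> \<open>(3)\<close>
     (\<exists>F. F \<in> extensional (\<Union>a\<in>{a. oodd a}. K V T lam a) \<and>
        (\<forall>a M. oodd a \<and> M \<in> K V T lam a \<longrightarrow> elem_sub V M (F M) \<and> F M \<in> K V T lam (osuc a)) \<and>
        (\<forall>Ms. (\<forall>a. Ms a \<in> K V T lam a) \<and> inc_cont V UNIV Ms \<and>
              (\<forall>a. Ms (osuc (osuc (odouble a))) = F (Ms (osuc (odouble a)))) \<longrightarrow>
           (\<nexists>a. stationary {d. isomorphic V (Ms d) (Ms a) \<and> cf d = theta}) \<and>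
           (\<exists>c :: 'o \<Rightarrow> 'o \<Rightarrow> 'o.
              (\<forall>a. \<forall>i<kappa. c a i \<in> universe (Ms (osuc (osuc (odouble a))))) \<and>
              (\<forall>e1 e2 a1 a2.
                 inc_cont_ords theta e1 \<and> seq_limit e1 theta a1 \<and>
                 inc_cont_ords theta e2 \<and> seq_limit e2 theta a2 \<and> a1 \<noteq> a2 \<longrightarrow>
                 (\<nexists>f. is_isomorphism V (Ms a1) (Ms a2) f \<and>
                      (\<forall>\<epsilon><theta. \<forall>i<kappa. f (c (e1 \<epsilon>) i) = c (e2 \<epsilon>) i)))))) \<and>
    \<comment> \<open>(4)\<close>
     (\<exists>F. F \<in> extensional (\<Union>a. K V T lam a) \<and>
        (\<forall>M \<in> (\<Union>a. K V T lam a). elem_sub V M (F M) \<and> F M \<in> (\<Union>a. K V T lam a)) \<and>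
        (\<forall>Ms. (\<forall>a. Ms a \<in> (\<Union>b. K V T lam b)) \<and> inc_cont V UNIV Ms \<and>
              (\<forall>a. Ms (osuc (osuc (odouble a))) = F (Ms (osuc (odouble a)))) \<longrightarrow>
           (\<nexists>a. stationary {d. isomorphic V (Ms d) (Ms a) \<and> cf d = theta})))"
proof -
  interpret O: ordinals lam theta kappa
    by unfold_locales (fact order_type cardinals lam_theta lam_kappa theta)+
  obtain \<phi> x ys where \<phi>: "fm_over V \<phi>" "distinct (x # ys)" "free_vars \<phi> \<subseteq> set (x # ys)"
    "independent_fm TYPE('o) V T [x] ys \<phi>"
    using independent unfolding independent_theory_def by (elim exE conjE)
  have sent: "T \<subseteq> sentences V" using complete by (simp add: complete_theory_def)
  interpret I: independent_setting lam theta kappa V T \<phi> x ys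
    by unfold_locales (fact sent T_card \<phi>)+
  obtain u :: "'o \<Rightarrow> 'o set" where u: "\<And>z. u z \<subseteq> {..<kappa}"
    "\<And>Z W. finite Z \<Longrightarrow> Z \<subseteq> {..<lam} \<Longrightarrow> \<exists>i<kappa. \<forall>z\<in>Z. i \<in> u z \<longleftrightarrow> z \<in> W"
    by (rule O.independent_family) (rule that, assumption+)
  obtain Vv where "bij_betw Vv {..<lam} (Pow {..<kappa})" by (rule O.subsets_coding)
  then have Vv: "inj_on Vv {..<lam}" "\<And>z. z < lam \<Longrightarrow> Vv z \<subseteq> {..<kappa}"
    by (auto simp: bij_betw_def)
  obtain G q :: "'o \<Rightarrow> 'o \<Rightarrow> 'o" where G: "\<And>b z. z < lam \<Longrightarrow> G b z < lam" "\<And>b b'. b' < b \<Longrightarrow> q b b' < lam"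
    "\<And>b b' z. b' < b \<Longrightarrow> z < lam \<Longrightarrow> G b z = G b' z \<Longrightarrow> z \<le> q b b'"
  proof (rule O.eventually_different)
    fix G q :: "'o \<Rightarrow> 'o \<Rightarrow> 'o"
    assume "\<And>b z. z < lam \<Longrightarrow> G b z < lam" "\<And>b b'. b' < b \<Longrightarrow> q b b' < lam"
      "\<And>b b' z. b' < b \<Longrightarrow> z < lam \<Longrightarrow> G b z = G b' z \<Longrightarrow> z \<le> q b b'"
    then show thesis by (rule that[of G q])
  qed
  obtain pr :: "bool \<Rightarrow> 'o \<Rightarrow> nat \<Rightarrow> 'o" where pr: "\<And>t k l. k < kappa \<Longrightarrow> pr t k l < kappa"
    "\<And>t k l t' k' l'. k < kappa \<Longrightarrow> k' < kappa \<Longrightarrow> pr t k l = pr t' k' l' \<Longrightarrow> t = t' \<and> k = k' \<and> l = l'"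
    by (rule O.pair_coding) (rule that, assumption+)
  define good_U where "good_U = (\<lambda>b (U :: (('o \<Rightarrow> 'o) \<times> 'o set) set set). ultra U \<and>
    (\<forall>k<kappa. {(j, s). j k < kappa} \<in> U) \<and>
    (\<forall>k<kappa. \<forall>z<lam. {(j, s). j k \<in> u z} \<in> U \<longleftrightarrow> k \<in> Vv (G b z)) \<and>
    (\<forall>\<xi>. {(j, s). finite s \<and> \<xi> \<in> s} \<in> U))"
  have ex: "\<exists>U. good_U b U" for b
  proof (rule O.coding_ultrafilter[of u "\<lambda>z. Vv (G b z)"])
    show "\<exists>i<kappa. \<forall>z\<in>Z. i \<in> u z \<longleftrightarrow> z \<in> W" if "finite Z" "Z \<subseteq> {..<lam}" for Z W
      by (rule u(2)[OF that])
  qed (auto simp: good_U_def)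
  define UU where "UU = (\<lambda>b. SOME U. good_U b U)"
  have UU: "good_U b (UU b)" for b unfolding UU_def by (rule someI_ex[OF ex])
  interpret C: coded_setting lam theta kappa V T \<phi> x ys u Vv G q pr UU
  proof
    fix b k z \<xi>
    show "ultra (UU b)" "{(j, s). finite s \<and> \<xi> \<in> s} \<in> UU b"
      and "k < kappa \<Longrightarrow> {(j, s). j k < kappa} \<in> UU b"
      and "k < kappa \<Longrightarrow> z < lam \<Longrightarrow> {(j, s). j k \<in> u z} \<in> UU b \<longleftrightarrow> k \<in> Vv (G b z)"
      using UU[of b] by (simp_all add: good_U_def)
  qed (fact u(1) Vv G pr)+

  define Dom where "Dom = (\<Union>a\<in>{a. oodd a}. K V T lam a)"
  \<comment> \<open>\<open>restrict\<close> adjusts the domain: (2) and (3) use \<open>step\<close>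
    on the models with odd index, and \<open>F'\<close> uses it on the whole class for (4).\<close>
  define F where "F = restrict C.step Dom"
  have F_ext: "F \<in> extensional (\<Union>a\<in>{a. oodd a}. K V T lam a)"
    by (simp add: F_def Dom_def)
  have F_step: "\<forall>a M. oodd a \<and> M \<in> K V T lam a \<longrightarrow> elem_sub V M (F M) \<and> F M \<in> K V T lam (osuc a)"
  proof (intro allI impI, elim conjE)
    fix a M assume "oodd a" and M: "M \<in> K V T lam a"
    then have "F M = C.step M" by (auto simp: F_def Dom_def)
    then show "elem_sub V M (F M) \<and> F M \<in> K V T lam (osuc a)"
      using C.step_props(2)[OF C.K_EC_ord[OF M]] C.step_K[OF M] by simp
  qed
  have adm: "C.admissible (\<lambda>g. Ms (osuc (odouble g))) Ms" and stepF: "\<And>a. F (Ms (osuc (odouble a))) = C.step (Ms (osuc (odouble a)))"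
    if Ms: "\<forall>a. Ms a \<in> K V T lam a" "inc_cont V UNIV Ms"
      "\<forall>a. Ms (osuc (osuc (odouble a))) = F (Ms (osuc (odouble a)))" for Ms
  proof -
    show s: "F (Ms (osuc (odouble a))) = C.step (Ms (osuc (odouble a)))" for a
    proof -
      have "oodd (osuc (odouble a))" unfolding oodd_def by blast
      then have "Ms (osuc (odouble a)) \<in> Dom" unfolding Dom_def using Ms(1) by blast
      then show ?thesis by (simp add: F_def)
    qed
    show "C.admissible (\<lambda>g. Ms (osuc (odouble g))) Ms"
      by (rule C.admissible_seq[OF C.K_EC_ord[OF Ms(1)[THEN spec]] Ms(2)]) (use Ms(3) s in simp)
  qed
  have nonstat: "\<nexists>a. stationary {d. isomorphic V (Ms d) (Ms a) \<and> cf d = theta}"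
    if Ms: "\<forall>a. Ms a \<in> K V T lam a" "inc_cont V UNIV Ms"
      "\<forall>a. Ms (osuc (osuc (odouble a))) = F (Ms (osuc (odouble a)))" for Ms
    using C.not_stationary_iso[OF adm[OF Ms]] C.K_EC_ord Ms(1) by blast
  have codes: "\<exists>c :: 'o \<Rightarrow> 'o \<Rightarrow> 'o.
      (\<forall>a. \<forall>i<kappa. c a i \<in> universe (Ms (osuc (osuc (odouble a))))) \<and>
      (\<forall>e1 e2 a1 a2. inc_cont_ords theta e1 \<and> seq_limit e1 theta a1 \<and>
         inc_cont_ords theta e2 \<and> seq_limit e2 theta a2 \<and> a1 \<noteq> a2 \<longrightarrow>
         (\<nexists>f. is_isomorphism V (Ms a1) (Ms a2) f \<and>
              (\<forall>\<epsilon><theta. \<forall>i<kappa. f (c (e1 \<epsilon>) i) = c (e2 \<epsilon>) i)))"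
    if Ms: "\<forall>a. Ms a \<in> K V T lam a" "inc_cont V UNIV Ms"
      "\<forall>a. Ms (osuc (osuc (odouble a))) = F (Ms (osuc (odouble a)))" for Ms
  proof (intro exI[of _ "\<lambda>a. C.code (Ms (osuc (odouble a)))"] conjI allI impI notI)
    show "C.code (Ms (osuc (odouble a))) i \<in> universe (Ms (osuc (osuc (odouble a))))" for a i
      using C.code_in[OF C.K_EC_ord] Ms(1,3) stepF[OF Ms] by metis
    fix e1 e2 a1 a2
    assume e: "inc_cont_ords theta e1 \<and> seq_limit e1 theta a1 \<and>
         inc_cont_ords theta e2 \<and> seq_limit e2 theta a2 \<and> a1 \<noteq> a2"
      and "\<exists>f. is_isomorphism V (Ms a1) (Ms a2) f \<and> (\<forall>\<epsilon><theta. \<forall>i<kappa.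
        f (C.code (Ms (osuc (odouble (e1 \<epsilon>)))) i) = C.code (Ms (osuc (odouble (e2 \<epsilon>)))) i)"
    then obtain f where "is_isomorphism V (Ms a1) (Ms a2) f" "\<forall>\<epsilon><theta. \<forall>i<kappa.
        f (C.code (Ms (osuc (odouble (e1 \<epsilon>)))) i) = C.code (Ms (osuc (odouble (e2 \<epsilon>)))) i"
      by (elim exE conjE)
    with e show False using C.no_coding_iso_seq[OF adm[OF Ms], of e1 a1 e2 a2 f] by simp
  qed

  define F' where "F' = restrict C.step (\<Union>a. K V T lam a)"
  have F'_ext: "F' \<in> extensional (\<Union>a. K V T lam a)" by (simp add: F'_def)
  have F'_step: "\<forall>M \<in> (\<Union>a. K V T lam a). elem_sub V M (F' M) \<and> F' M \<in> (\<Union>a. K V T lam a)"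
  proof
    fix M assume M: "M \<in> (\<Union>a. K V T lam a)"
    then obtain a where a: "M \<in> K V T lam a" by blast
    have "F' M = C.step M" using M by (simp add: F'_def)
    then show "elem_sub V M (F' M) \<and> F' M \<in> (\<Union>a. K V T lam a)"
      using C.step_props(2)[OF C.K_EC_ord[OF a]] C.step_K[OF a] by auto
  qed
  have nonstat': "\<nexists>a. stationary {d. isomorphic V (Ms d) (Ms a) \<and> cf d = theta}"
    if Ms: "\<forall>a. Ms a \<in> (\<Union>b. K V T lam b)" "inc_cont V UNIV Ms"
      "\<forall>a. Ms (osuc (osuc (odouble a))) = F' (Ms (osuc (odouble a)))" for Ms
  proof -
    \<comment> \<open>In (4) the index of a member does not determine its universe; the argument
      goes through because stages are labelled by heights.\<close>
    have EC: "Ms a \<in> EC_ord V T lam" for a using Ms(1) C.K_EC_ord by blast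
    have "C.admissible (\<lambda>g. Ms (osuc (odouble g))) Ms"
      by (rule C.admissible_seq[OF EC Ms(2)]) (use Ms(1,3) in \<open>simp add: F'_def\<close>)
    then show ?thesis using C.not_stationary_iso EC by blast
  qed

  show ?thesis
  proof (intro conjI)
    show "\<nexists>M :: ('f, 'p, 'm) struct. md_limit V T lam theta M" using C.no_md_limit by blast
  next
    show "\<exists>F. F \<in> extensional (\<Union>a\<in>{a. oodd a}. K V T lam a) \<and>
        (\<forall>a M. oodd a \<and> M \<in> K V T lam a \<longrightarrow> elem_sub V M (F M) \<and> F M \<in> K V T lam (osuc a)) \<and>
        (\<forall>Ms. (\<forall>a. Ms a \<in> K V T lam a) \<and> inc_cont V UNIV Ms \<and>
              (\<forall>a. Ms (osuc (osuc (odouble a))) = F (Ms (osuc (odouble a)))) \<longrightarrow>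
           (\<nexists>a. stationary {d. isomorphic V (Ms d) (Ms a) \<and> cf d = theta}))"
      by (intro exI[of _ F] conjI[OF F_ext conjI[OF F_step]] allI impI, elim conjE) (rule nonstat)
  next
    show "\<exists>F. F \<in> extensional (\<Union>a\<in>{a. oodd a}. K V T lam a) \<and>
        (\<forall>a M. oodd a \<and> M \<in> K V T lam a \<longrightarrow> elem_sub V M (F M) \<and> F M \<in> K V T lam (osuc a)) \<and>
        (\<forall>Ms. (\<forall>a. Ms a \<in> K V T lam a) \<and> inc_cont V UNIV Ms \<and>
              (\<forall>a. Ms (osuc (osuc (odouble a))) = F (Ms (osuc (odouble a)))) \<longrightarrow>
           (\<nexists>a. stationary {d. isomorphic V (Ms d) (Ms a) \<and> cf d = theta}) \<and>
           (\<exists>c :: 'o \<Rightarrow> 'o \<Rightarrow> 'o.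
              (\<forall>a. \<forall>i<kappa. c a i \<in> universe (Ms (osuc (osuc (odouble a))))) \<and>
              (\<forall>e1 e2 a1 a2.
                 inc_cont_ords theta e1 \<and> seq_limit e1 theta a1 \<and>
                 inc_cont_ords theta e2 \<and> seq_limit e2 theta a2 \<and> a1 \<noteq> a2 \<longrightarrow>
                 (\<nexists>f. is_isomorphism V (Ms a1) (Ms a2) f \<and>
                      (\<forall>\<epsilon><theta. \<forall>i<kappa. f (c (e1 \<epsilon>) i) = c (e2 \<epsilon>) i)))))"
      by (intro exI[of _ F] conjI[OF F_ext conjI[OF F_step]] allI impI, elim conjE)
        (rule conjI[OF nonstat codes])
  next
    show "\<exists>F. F \<in> extensional (\<Union>a. K V T lam a) \<and>
        (\<forall>M \<in> (\<Union>a. K V T lam a). elem_sub V M (F M) \<and> F M \<in> (\<Union>a. K V T lam a)) \<and>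
        (\<forall>Ms. (\<forall>a. Ms a \<in> (\<Union>b. K V T lam b)) \<and> inc_cont V UNIV Ms \<and>
              (\<forall>a. Ms (osuc (osuc (odouble a))) = F (Ms (osuc (odouble a)))) \<longrightarrow>
           (\<nexists>a. stationary {d. isomorphic V (Ms d) (Ms a) \<and> cf d = theta}))"
      by (intro exI[of _ F'] conjI[OF F'_ext conjI[OF F'_step]] allI impI, elim conjE) (rule nonstat')
  qed
qed

end
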